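(* Let $N$ be a $d$-dimensional nonexplosive counting process with intensity $\lambda$, where $\lambda^i_t=1$ for all $i\le d$ and $t\ge0$, and let $\mu$ be a $d$-dimensional nonnegative, predictable and locally bounded process. Then $\mu$ is $\lambda$-compatible. Put $M^i_t=N^i_t-t$, $H^i_t=\mu^i_t-1$ and $(H\cdot M)_t=\sum_{i=1}^d\int_0^tH^i_s\,\mathrm{d}M^i_s$. If there is an $\varepsilon>0$ such that whenever $0\le u\le t$ with $t-u\le\varepsilon$, one of the following two conditions is satisfied: $$E\exp\left(\sum_{i=1}^d\int_u^t\mu^i_s\log_+\mu^i_s\,\mathrm{d}s\right)<\infty$$ or $$E\exp\left(\sum_{i=1}^d\int_u^t\log_+\mu^i_s\,\mathrm{d}N^i_s\right)<\infty,$$ then the Doléans-Dade exponential $\mathcal{E}(H\cdot M)$ is a martingale.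
   Context: All processes are defined on a filtered probability space $(\Omega,\mathcal{F},(\mathcal{F}_t)_{t\ge0},P)$ satisfying the usual conditions; expectations are under $P$. A nonexplosive $d$-dimensional counting process $N$ is a càdlàg, piecewise constant process with jumps of size one such that no two coordinates jump at the same time. A process $X$ is locally bounded if there are stopping times $T_n$ increasing almost surely to infinity such that $X^{T_n}1_{(T_n>0)}$ is bounded for each $n$. For a nonnegative, predictable, locally bounded $d$-dimensional process $\lambda$, $N$ has intensity $\lambda$ if $N^i_t-\int_0^t\lambda^i_s\,\mathrm{d}s$ is a local martingale for each $i$ (predictability and local martingales are with respect to $(\mathcal{F}_t)$, which may be larger than the filtration generated by $N$). $\mu$ is $\lambda$-compatible if for all $\omega\in\Omega$, $\mu^i_t(\omega)=0$ whenever $\lambda^i_t(\omega)=0$, and the process $\gamma$ given by $\gamma^i_t=\mu^i_t(\lambda^i_t)^{-1}$, $i\le d$, is locally bounded. For a semimartingale $X$ with initial value zero, $\mathcal{E}(X)$ is the unique càdlàg adapted solution of $Z_t=1+\int_0^tZ_{s-}\,\mathrm{d}X_s$. Further, $\log_+x=\max\{0,\log x\}$ for $x\ge0$, with $\log0=-\infty$ (so $\log_+0=0$). *)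

theory Defs
  imports "HOL-Probability.Probability"
begin

text \<open>
  A scalar process is a function of type \<open>real \<Rightarrow> 'a \<Rightarrow> real\<close> of which only the values at times
  \<open>t \<ge> 0\<close> and at points of \<open>space M\<close> matter. A \<open>d\<close>-dimensional process is a family of scalar
  processes indexed by a finite type \<open>'d\<close> with \<open>d = CARD('d)\<close>.
\<close>

type_synonym 'a process = "real \<Rightarrow> 'a \<Rightarrow> real"

section \<open>Filtered probability spaces\<close>

text \<open>
  Usual conditions: \<open>M\<close> is complete, \<open>F 0\<close> contains all null sets, \<open>F\<close> is right-continuous.
\<close>

locale filtered_prob_space_usual = prob_space M + complete_measure M for M :: "'a measure" +
  fixes F :: "real \<Rightarrow> 'a measure"
  assumes subalg: "0 \<le> t \<Longrightarrow> subalgebra M (F t)"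
    and filtration_mono: "0 \<le> s \<Longrightarrow> s \<le> t \<Longrightarrow> sets (F s) \<subseteq> sets (F t)"
    and null_sets_F0: "null_sets M \<subseteq> sets (F 0)"
    and filtration_right_cont: "0 \<le> t \<Longrightarrow> sets (F t) = (\<Inter>s\<in>{t<..}. sets (F s))"

definition adapted :: "(real \<Rightarrow> 'a measure) \<Rightarrow> 'a process \<Rightarrow> bool" where
  "adapted F X \<longleftrightarrow> (\<forall>t\<ge>0. X t \<in> borel_measurable (F t))"

definition predictable_sigma :: "'a measure \<Rightarrow> (real \<Rightarrow> 'a measure) \<Rightarrow> (real \<times> 'a) measure" where
  "predictable_sigma M F = sigma ({0..} \<times> space M)
     ({{0} \<times> A | A. A \<in> sets (F 0)} \<union>
      {{s<..t} \<times> A | s t A. 0 \<le> s \<and> s \<le> t \<and> A \<in> sets (F s)})"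

definition predictable :: "'a measure \<Rightarrow> (real \<Rightarrow> 'a measure) \<Rightarrow> 'a process \<Rightarrow> bool" where
  "predictable M F X \<longleftrightarrow> (\<lambda>(t, \<omega>). X t \<omega>) \<in> borel_measurable (predictable_sigma M F)"

text \<open>
  The library's \<open>stopping_time\<close> takes values in the index type of the filtration, here \<open>real\<close>;
  the following stopping times may be infinite.
\<close>

definition ext_stopping_time :: "'a measure \<Rightarrow> (real \<Rightarrow> 'a measure) \<Rightarrow> ('a \<Rightarrow> ennreal) \<Rightarrow> bool" where
  "ext_stopping_time M F T \<longleftrightarrow> (\<forall>t\<ge>0. {\<omega> \<in> space M. T \<omega> \<le> ennreal t} \<in> sets (F t))"

definition localising :: "'a measure \<Rightarrow> (real \<Rightarrow> 'a measure) \<Rightarrow> (nat \<Rightarrow> 'a \<Rightarrow> ennreal) \<Rightarrow> bool" where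
  "localising M F T \<longleftrightarrow> (\<forall>n. ext_stopping_time M F (T n)) \<and>
     (AE \<omega> in M. incseq (\<lambda>n. T n \<omega>) \<and> (\<lambda>n. T n \<omega>) \<longlonglongrightarrow> \<infinity>)"

text \<open>The process \<open>X\<^sup>T 1\<^sub>{\<^sub>T\<^sub>>\<^sub>0\<^sub>}\<close>.\<close>

definition stopped :: "'a process \<Rightarrow> ('a \<Rightarrow> ennreal) \<Rightarrow> 'a process" where
  "stopped X T t \<omega> =
     (if T \<omega> > 0 then X (if ennreal t \<le> T \<omega> then t else enn2real (T \<omega>)) \<omega> else 0)"

definition locally_bounded ::
    "'a measure \<Rightarrow> (real \<Rightarrow> 'a measure) \<Rightarrow> ('d::finite \<Rightarrow> 'a process) \<Rightarrow> bool" where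
  "locally_bounded M F X \<longleftrightarrow> (\<exists>T. localising M F T \<and>
     (\<forall>n. \<exists>K. \<forall>i. \<forall>t\<ge>0. \<forall>\<omega>\<in>space M. \<bar>stopped (X i) (T n) t \<omega>\<bar> \<le> K))"

definition martingale :: "'a measure \<Rightarrow> (real \<Rightarrow> 'a measure) \<Rightarrow> 'a process \<Rightarrow> bool" where
  "martingale M F X \<longleftrightarrow> adapted F X \<and> (\<forall>t\<ge>0. integrable M (X t)) \<and>
     (\<forall>s t. 0 \<le> s \<longrightarrow> s \<le> t \<longrightarrow> (AE \<omega> in M. real_cond_exp M (F s) (X t) \<omega> = X s \<omega>))"

section \<open>Paths\<close>

definition cadlag :: "(real \<Rightarrow> real) \<Rightarrow> bool" where
  "cadlag f \<longleftrightarrow> (\<forall>t\<ge>0. (f \<longlongrightarrow> f t) (at_right t)) \<and> (\<forall>t>0. \<exists>l. (f \<longlongrightarrow> l) (at_left t))"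

definition left_limit :: "(real \<Rightarrow> real) \<Rightarrow> real \<Rightarrow> real" where
  "left_limit f t = Lim (at_left t) f"

definition jump :: "(real \<Rightarrow> real) \<Rightarrow> real \<Rightarrow> real" where
  "jump f t = f t - left_limit f t"

definition piecewise_constant :: "(real \<Rightarrow> real) \<Rightarrow> bool" where
  "piecewise_constant f \<longleftrightarrow> (\<forall>t\<ge>0. \<exists>J. finite J \<and>
     (\<forall>r s. 0 \<le> r \<longrightarrow> r \<le> s \<longrightarrow> s \<le> t \<longrightarrow> {r<..s} \<inter> J = {} \<longrightarrow> f r = f s))"

definition local_martingale :: "'a measure \<Rightarrow> (real \<Rightarrow> 'a measure) \<Rightarrow> 'a process \<Rightarrow> bool" where
  "local_martingale M F X \<longleftrightarrow> adapted F X \<and> (\<forall>\<omega>\<in>space M. cadlag (\<lambda>t. X t \<omega>)) \<and>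
     (\<exists>T. localising M F T \<and> (\<forall>n. martingale M F (stopped X (T n))))"

section \<open>Counting processes and intensities\<close>

text \<open>No initial value is prescribed; only the increments of \<open>N\<close> are ever used.\<close>

definition counting_process :: "'a measure \<Rightarrow> ('d::finite \<Rightarrow> 'a process) \<Rightarrow> bool" where
  "counting_process M N \<longleftrightarrow> (\<forall>\<omega>\<in>space M.
     (\<forall>i. cadlag (\<lambda>t. N i t \<omega>) \<and> piecewise_constant (\<lambda>t. N i t \<omega>) \<and>
          (\<forall>t>0. jump (\<lambda>s. N i s \<omega>) t \<in> {0, 1})) \<and>
     (\<forall>i j. \<forall>t>0. i \<noteq> j \<longrightarrow> jump (\<lambda>s. N i s \<omega>) t = 0 \<or> jump (\<lambda>s. N j s \<omega>) t = 0))"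

definition nonneg_process :: "'a measure \<Rightarrow> ('d::finite \<Rightarrow> 'a process) \<Rightarrow> bool" where
  "nonneg_process M X \<longleftrightarrow> (\<forall>i. \<forall>t\<ge>0. \<forall>\<omega>\<in>space M. 0 \<le> X i t \<omega>)"

definition has_intensity ::
    "'a measure \<Rightarrow> (real \<Rightarrow> 'a measure) \<Rightarrow> ('d::finite \<Rightarrow> 'a process) \<Rightarrow> ('d \<Rightarrow> 'a process) \<Rightarrow> bool" where
  "has_intensity M F N ell \<longleftrightarrow>
     nonneg_process M ell \<and> (\<forall>i. predictable M F (ell i)) \<and> locally_bounded M F ell \<and>
     (\<forall>i. local_martingale M F (\<lambda>t \<omega>. N i t \<omega> - (LBINT s:{0..t}. ell i s \<omega>)))"

definition compatible ::
    "'a measure \<Rightarrow> (real \<Rightarrow> 'a measure) \<Rightarrow> ('d::finite \<Rightarrow> 'a process) \<Rightarrow> ('d \<Rightarrow> 'a process) \<Rightarrow> bool" where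
  "compatible M F ell \<mu> \<longleftrightarrow>
     (\<forall>\<omega>\<in>space M. \<forall>i. \<forall>t\<ge>0. ell i t \<omega> = 0 \<longrightarrow> \<mu> i t \<omega> = 0) \<and>
     locally_bounded M F (\<lambda>i t \<omega>. \<mu> i t \<omega> * inverse (ell i t \<omega>))"

text \<open>The case distinction encodes \<open>log 0 = -\<infinity>\<close>, so that \<open>log\<^sub>+ 0 = 0\<close>.\<close>

definition log_plus :: "real \<Rightarrow> real" where
  "log_plus x = (if x \<le> 0 then 0 else max 0 (ln x))"

section \<open>Pathwise integrals and the stochastic exponential\<close>

text \<open>
  \<open>has_ls_integral f g u t I\<close>: the integral of \<open>f\<close> over \<open>(u, t]\<close> against the signed
  Lebesgue--Stieltjes measure of the right-continuous function \<open>g\<close>, which has bounded variation on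
  \<open>[u, t]\<close>, exists and equals \<open>I\<close>. Here \<open>g\<close> is written as a difference of two nondecreasing
  right-continuous functions; \<open>I\<close> does not depend on the decomposition.
\<close>

definition has_ls_integral ::
    "(real \<Rightarrow> real) \<Rightarrow> (real \<Rightarrow> real) \<Rightarrow> real \<Rightarrow> real \<Rightarrow> real \<Rightarrow> bool" where
  "has_ls_integral f g u t I \<longleftrightarrow> (\<exists>p n.
     mono p \<and> mono n \<and> (\<forall>s. continuous (at_right s) p) \<and> (\<forall>s. continuous (at_right s) n) \<and>
     (\<forall>s\<in>{u..t}. g s = p s - n s) \<and>
     set_integrable (interval_measure p) {u<..t} f \<and>
     set_integrable (interval_measure n) {u<..t} f \<and>
     I = set_lebesgue_integral (interval_measure p) {u<..t} f
         - set_lebesgue_integral (interval_measure n) {u<..t} f)"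

definition ls_integral :: "(real \<Rightarrow> real) \<Rightarrow> (real \<Rightarrow> real) \<Rightarrow> real \<Rightarrow> real \<Rightarrow> real" where
  "ls_integral f g u t = (THE I. has_ls_integral f g u t I)"

text \<open>
  The integral process \<open>H \<cdot> M\<close> for integrators with paths of finite variation, for which the
  stochastic integral of a predictable, locally bounded process is the pathwise one.
\<close>

definition stoch_integral :: "('d::finite \<Rightarrow> 'a process) \<Rightarrow> ('d \<Rightarrow> 'a process) \<Rightarrow> 'a process" where
  "stoch_integral H X t \<omega> = (\<Sum>i\<in>UNIV. ls_integral (\<lambda>s. H i s \<omega>) (\<lambda>s. X i s \<omega>) 0 t)"

text \<open>
  \<open>Z\<close> is a version of the Doleans-Dade exponential of the finite variation process \<open>X\<close>, i.e. a
  cadlag adapted solution of \<open>Z\<^sub>t = 1 + \<integral>\<^sub>0\<^sup>t Z\<^sub>s\<^sub>- dX\<^sub>s\<close> (equality up to indistinguishability).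
  Stating the equation by means of \<open>has_ls_integral\<close> includes that the integral exists.
\<close>

definition is_doleans_dade ::
    "'a measure \<Rightarrow> (real \<Rightarrow> 'a measure) \<Rightarrow> 'a process \<Rightarrow> 'a process \<Rightarrow> bool" where
  "is_doleans_dade M F X Z \<longleftrightarrow> adapted F Z \<and> (\<forall>\<omega>\<in>space M. cadlag (\<lambda>t. Z t \<omega>)) \<and>
     (AE \<omega> in M. \<forall>t\<ge>0.
        has_ls_integral (left_limit (\<lambda>s. Z s \<omega>)) (\<lambda>s. X s \<omega>) 0 t (Z t \<omega> - 1))"

end

theory Submission
  imports Defs
begin

text \<open>
  The exponential is \<open>Z\<^sub>t = exp (- \<integral>\<^sub>0\<^sup>t \<Sum>\<^sub>i (\<mu>\<^sup>i\<^sub>s - 1) ds) \<Prod> \<mu>\<^sup>i\<^sub>r\<close>, the product being over the jump times \<open>r \<le> t\<close>;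
  uniqueness of the solution of the linear integral equation reduces every version of it to this one.
  The only probabilistic input is the compensation formula
  \<open>E (\<Sum> h\<^sub>r) = E (\<integral> h\<^sub>s ds)\<close> for predictable \<open>h \<ge> 0\<close>, the sum being over the jump times of \<open>N\<^sup>i\<close>. Together with the integral
  equation it gives \<open>E Z\<^sub>t = 1\<close> for bounded \<open>\<mu>\<close>, and \<open>E Z\<^sub>t \<le> 1\<close> in general by Fatou's lemma.
  Localising \<open>\<mu>\<close> at \<open>S\<^sub>k\<close> gives bounded \<open>\<mu>\<^sub>k\<close> with exponentials \<open>Z\<^sub>k\<close>, and it remains to prevent loss of mass as
  \<open>k \<rightarrow> \<infinity>\<close>, on each short interval separately. Under the second condition, \<open>Z\<^sub>k\<close> is dominated by
  a multiple of \<open>exp (\<integral> log\<^sub>+ \<mu> dN)\<close>. Under the first one, Gibbs' inequality gives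
  \<open>E (Z\<^sub>k \<integral> \<Sum>\<^sub>i \<mu>\<^sub>k\<^sup>i ds) \<le> C\<close> uniformly in \<open>k\<close>: the relative entropy of \<open>Z\<^sub>k\<close> is \<open>E (Z\<^sub>k \<integral> \<Sum>\<^sub>i (\<mu> log \<mu> - \<mu> + 1) ds)\<close>,
  which falls short of \<open>E (Z\<^sub>k \<integral> \<Sum>\<^sub>i \<mu> log\<^sub>+ \<mu> ds)\<close> by such a term. On the event that \<open>\<integral> \<Sum>\<^sub>i \<mu>\<^sub>k\<^sup>i ds \<le> n\<close>, \<open>Z\<^sub>k\<close> is
  dominated independently of \<open>k\<close>, because the exponential of the rate \<open>max 1 \<mu>\<close>, switched off once
  \<open>\<integral> \<mu> ds\<close> exceeds \<open>n\<close>, discounts its jump factors by at most \<open>exp (- n)\<close>.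
\<close>

section \<open>Lebesgue--Stieltjes integrals\<close>

text \<open>The entropy bound must not depend on \<open>k\<close>, although the bound on the
  localised rate does. No change of measure is made:
  \<open>w = v * exp (\<theta> * log_plus v)\<close> is \<open>v\<close> to the power
  \<open>1 + \<theta>\<close> where \<open>v \<ge> 1\<close>; its exponential has expectation at
  most 1, and \<open>exp x \<ge> 1 + x\<close> linearises it around the exponential of
  \<open>v\<close>, whose expectation is exactly 1. The admissible \<open>\<theta>\<close> depends
  on the bound of the rate, but only the difference of the two expectations divided by
  \<open>\<theta>\<close> enters, and this is at most 0. The second order error eats half of the
  term \<open>E (Z V)\<close> left over by Gibbs' inequality; the other half is the bound wanted.
  Bounded rates need an integrable dominating variable. Rates that stop acting after finitely many
  jumps have bounded exponentials, Fatou's lemma extends \<open>E Z \<le> 1\<close> to all rates,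
  and the constant rate \<open>K\<close> then yields exponential moments of the counts that dominate
  every rate below \<open>K\<close>. Short intervals suffice because a rate equal to 1 contributes
  neither drift nor jump factor, so the exponential factorises over successive intervals.\<close>

lemma interval_measure_eqI:
  fixes p :: "real \<Rightarrow> real"
  assumes "mono p" "\<And>s. continuous (at_right s) p" "sets \<nu> = sets borel"
    and "\<And>a b. a \<le> b \<Longrightarrow> emeasure \<nu> {a<..b} = ennreal (p b - p a)"
  shows "interval_measure p = \<nu>"
proof (rule measure_eqI_generator_eq)
  let ?E = "range (\<lambda>(a, b). {a<..b::real})"
  show "Int_stable ?E"
    by (rule Int_stableI) (auto simp: image_iff Int_greaterThanAtMost, metis)
  show "?E \<subseteq> Pow UNIV" by simp
  show "sets (interval_measure p) = sigma_sets UNIV ?E" "sets \<nu> = sigma_sets UNIV ?E"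
    using assms(3) by (simp_all add: borel_sigma_sets_Ioc)
  show "range (\<lambda>n::nat. {- real n<..real n}) \<subseteq> ?E" by auto
  show "(\<Union>n::nat. {- real n<..real n}) = UNIV"
  proof safe
    fix x :: real
    obtain n :: nat where "\<bar>x\<bar> < real n" using reals_Archimedean2 by blast
    then show "x \<in> (\<Union>n::nat. {- real n<..real n})" by (intro UN_I[of n]) auto
  qed auto
  have *: "emeasure (interval_measure p) {a<..b} = ennreal (p b - p a)" if "a \<le> b" for a b
    using assms(1,2) that by (intro emeasure_interval_measure_Ioc) (auto simp: mono_def)
  then show "emeasure (interval_measure p) {- real n<..real n} \<noteq> \<infinity>" for n by simp
  fix X assume "X \<in> ?E"
  then obtain a b where X: "X = {a<..b}" by auto
  show "emeasure (interval_measure p) X = emeasure \<nu> X"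
    using *[of a b] assms(4)[of a b] X by (cases "a \<le> b") auto
qed

text \<open>The sum of the two measures is built by hand on the Borel sets and then recognised on
  half-open intervals by \<open>interval_measure_eqI\<close>.\<close>

lemma emeasure_interval_measure_add:
  fixes p q :: "real \<Rightarrow> real"
  assumes p: "mono p" "\<And>s. continuous (at_right s) p" and q: "mono q" "\<And>s. continuous (at_right s) q"
    and A: "A \<in> sets borel"
  shows "emeasure (interval_measure (\<lambda>s. p s + q s)) A
    = emeasure (interval_measure p) A + emeasure (interval_measure q) A"
proof -
  let ?f = "\<lambda>A. emeasure (interval_measure p) A + emeasure (interval_measure q) A"
  define \<nu> where "\<nu> = measure_of UNIV (sets borel) ?f"
  have sets: "sets \<nu> = sets borel" "space \<nu> = UNIV"
    unfolding \<nu>_def by (auto simp: sets.sigma_sets_eq[of borel, simplified])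
  have em: "emeasure \<nu> B = ?f B" if "B \<in> sets borel" for B
  proof (rule emeasure_measure_of[OF \<nu>_def])
    show "countably_additive (sets \<nu>) ?f"
    proof (rule countably_additiveI)
      fix X :: "nat \<Rightarrow> real set"
      assume "range X \<subseteq> sets \<nu>" "disjoint_family X"
      then have "(\<Sum>n. emeasure (interval_measure p) (X n)) = emeasure (interval_measure p) (\<Union>n. X n)"
        "(\<Sum>n. emeasure (interval_measure q) (X n)) = emeasure (interval_measure q) (\<Union>n. X n)"
        by (auto intro!: suminf_emeasure simp: sets)
      then show "(\<Sum>n. ?f (X n)) = ?f (\<Union>n. X n)"
        by (subst suminf_add[symmetric]) auto
    qed
  qed (use that in \<open>auto simp: sets positive_def\<close>)
  have "interval_measure (\<lambda>s. p s + q s) = \<nu>"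
  proof (rule interval_measure_eqI)
    show "mono (\<lambda>s. p s + q s)" using p q by (auto simp: mono_def intro!: add_mono)
    show "continuous (at_right s) (\<lambda>s. p s + q s)" for s using p q by (intro continuous_intros) auto
    fix a b :: real assume "a \<le> b"
    then have "emeasure \<nu> {a<..b} = ennreal (p b - p a) + ennreal (q b - q a)"
      using p q by (subst em) (auto simp: mono_def emeasure_interval_measure_Ioc)
    also have "\<dots> = ennreal (p b + q b - (p a + q a))"
      using p q \<open>a \<le> b\<close> by (subst ennreal_plus[symmetric]) (auto simp: mono_def algebra_simps)
    finally show "emeasure \<nu> {a<..b} = ennreal (p b + q b - (p a + q a))" .
  qed (use sets in auto)
  then show ?thesis using em[OF A] by simp
qed

lemma nn_integral_interval_measure_add:
  fixes p q :: "real \<Rightarrow> real"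
  assumes p: "mono p" "\<And>s. continuous (at_right s) p" and q: "mono q" "\<And>s. continuous (at_right s) q"
    and f: "f \<in> borel_measurable borel"
  shows "(\<integral>\<^sup>+s. f s \<partial>interval_measure (\<lambda>s. p s + q s))
    = (\<integral>\<^sup>+s. f s \<partial>interval_measure p) + (\<integral>\<^sup>+s. f s \<partial>interval_measure q)"
  using f
proof (induction rule: borel_measurable_induct)
  case (cong f g)
  then show ?case by simp
next
  case (set A)
  then show ?case by (simp add: emeasure_interval_measure_add[OF p q])
next
  case (mult u c)
  then show ?case by (simp add: nn_integral_cmult distrib_left)
next
  case (add u v)
  then show ?case by (simp add: nn_integral_add ac_simps)
next
  case (seq U)
  have IH: "integral\<^sup>N (interval_measure (\<lambda>s. p s + q s)) (U i)
    = integral\<^sup>N (interval_measure p) (U i) + integral\<^sup>N (interval_measure q) (U i)" for i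
    using seq by simp
  have inc: "incseq (\<lambda>i. integral\<^sup>N \<nu> (U i))" for \<nu> :: "real measure"
    using seq(3) by (auto simp: incseq_def le_fun_def intro!: nn_integral_mono)
  have SUP: "integral\<^sup>N \<nu> (\<lambda>x. \<Squnion>i. U i x) = (\<Squnion>i. integral\<^sup>N \<nu> (U i))" if "sets \<nu> = sets borel" for \<nu>
    using seq(1,3) that by (intro nn_integral_monotone_convergence_SUP) (auto cong: measurable_cong_sets)
  show ?case
    using seq(4) IH ennreal_SUP_add[OF inc inc, of "interval_measure p" "interval_measure q"]
    by (simp add: SUP image_comp SUP_apply[abs_def])
qed

text \<open>\<open>has_ls_integral\<close> constrains the integrator on \<open>[u, t]\<close> only,
  whereas \<open>interval_measure\<close> needs a function on the whole line. Freezing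
  \<open>p\<close> outside \<open>[u, t]\<close> bridges the two: no mass remains outside
  \<open>(u, t]\<close>.\<close>

lemma interval_measure_clip:
  fixes p :: "real \<Rightarrow> real"
  assumes p: "mono p" "\<And>s. continuous (at_right s) p" and ut: "u \<le> t"
  shows "mono (\<lambda>s. p (max u (min t s)))"
    and "continuous (at_right s) (\<lambda>s. p (max u (min t s)))"
    and "interval_measure (\<lambda>s. p (max u (min t s))) = density (interval_measure p) (indicator {u<..t})"
proof -
  let ?c = "\<lambda>s::real. max u (min t s)"
  show m: "mono (\<lambda>s. p (?c s))" using p(1) by (auto simp: mono_def)
  show c: "continuous (at_right s) (\<lambda>s. p (?c s))" for s
  proof (cases "u \<le> s \<and> s < t")
    case True
    have "\<forall>\<^sub>F x in at_right s. p x = p (?c x)"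
      using True by (auto simp: eventually_at_right_field intro!: exI[of _ t])
    then show ?thesis using p(2)[of s] True unfolding continuous_within
      by (auto elim!: Lim_transform_eventually simp: max_def min_def)
  next
    case False
    have "\<forall>\<^sub>F x in at_right s. p (?c s) = p (?c x)"
    proof (cases "s < u")
      case True
      then show ?thesis using ut by (auto simp: eventually_at_right_field max_def min_def intro!: exI[of _ u])
    next
      case F: False
      then show ?thesis using False ut by (auto simp: eventually_at_right_field max_def min_def intro!: exI[of _ "s+1"])
    qed
    then show ?thesis unfolding continuous_within by (rule tendsto_eventually[OF eventually_mono]) simp
  qed
  show "interval_measure (\<lambda>s. p (?c s)) = density (interval_measure p) (indicator {u<..t})"
  proof (rule interval_measure_eqI[OF m c])
    fix a b :: real assume "a \<le> b"
    have "emeasure (density (interval_measure p) (indicator {u<..t})) {a<..b}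
      = emeasure (interval_measure p) ({a<..b} \<inter> {u<..t})"
      by (subst emeasure_density) (auto simp: indicator_inter_arith[symmetric] ac_simps)
    also have "{a<..b} \<inter> {u<..t} = {max a u<..min b t}" by auto
    also have "emeasure (interval_measure p) \<dots> = ennreal (p (?c b) - p (?c a))"
    proof (cases "max a u \<le> min b t")
      case True
      then have "?c b = min b t" "?c a = max a u" by linarith+
      moreover have "emeasure (interval_measure p) {max a u<..min b t} = ennreal (p (min b t) - p (max a u))"
        using p True by (intro emeasure_interval_measure_Ioc) (auto simp: mono_def)
      ultimately show ?thesis by (simp only:)
    next
      case False
      then have "?c b = ?c a" using \<open>a \<le> b\<close> ut by auto
      then show ?thesis using False by (simp only:) simp
    qed
    finally show "emeasure (density (interval_measure p) (indicator {u<..t})) {a<..b} = \<dots>" .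
  qed simp
qed

text \<open>Both functions have the same clipped version.\<close>

lemma nn_integral_interval_measure_cong:
  fixes p q :: "real \<Rightarrow> real"
  assumes p: "mono p" "\<And>s. continuous (at_right s) p" and q: "mono q" "\<And>s. continuous (at_right s) q"
    and pq: "\<And>s. s \<in> {u..t} \<Longrightarrow> p s = q s" and ut: "u \<le> t"
    and f: "f \<in> borel_measurable borel" "\<And>s. s \<notin> {u<..t} \<Longrightarrow> f s = 0"
  shows "(\<integral>\<^sup>+s. f s \<partial>interval_measure p) = (\<integral>\<^sup>+s. f s \<partial>interval_measure q)"
proof -
  have *: "(\<integral>\<^sup>+s. f s \<partial>interval_measure r) = (\<integral>\<^sup>+s. f s \<partial>interval_measure (\<lambda>s. r (max u (min t s))))"
    if "mono r" "\<And>s. continuous (at_right s) r" for r :: "real \<Rightarrow> real"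
    using f that ut
    by (subst interval_measure_clip(3))
       (auto simp: nn_integral_density split: split_indicator intro!: nn_integral_cong)
  have "(\<lambda>s. p (max u (min t s))) = (\<lambda>s. q (max u (min t s)))"
    using ut by (auto intro!: ext pq)
  then show ?thesis using *[OF p] *[OF q] by simp
qed

text \<open>Equality of differences is turned into equality of sums: \<open>p + n' = p' + n\<close>
  on \<open>[u, t]\<close>, and these are nondecreasing, so they give the same measure on
  \<open>(u, t]\<close>. The positive and the negative part of \<open>f\<close> are treated
  separately; all integrals involved are finite, so they may be rearranged.\<close>

lemma ls_decomposition_unique:
  fixes p n p' n' :: "real \<Rightarrow> real"
  assumes p: "mono p" "\<And>s. continuous (at_right s) p" and n: "mono n" "\<And>s. continuous (at_right s) n"
    and p': "mono p'" "\<And>s. continuous (at_right s) p'" and n': "mono n'" "\<And>s. continuous (at_right s) n'"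
    and eq: "\<And>s. s \<in> {u..t} \<Longrightarrow> p s - n s = p' s - n' s" and ut: "u \<le> t"
    and int: "set_integrable (interval_measure p) {u<..t} (f :: real \<Rightarrow> real)" "set_integrable (interval_measure n) {u<..t} f"
      "set_integrable (interval_measure p') {u<..t} f" "set_integrable (interval_measure n') {u<..t} f"
  shows "set_lebesgue_integral (interval_measure p) {u<..t} f - set_lebesgue_integral (interval_measure n) {u<..t} f
    = set_lebesgue_integral (interval_measure p') {u<..t} f - set_lebesgue_integral (interval_measure n') {u<..t} f"
proof -
  define h where "h = (\<lambda>s. indicator {u<..t} s *\<^sub>R f s)"
  have h[measurable]: "h \<in> borel_measurable borel"
    using int(1) unfolding set_integrable_def h_def by auto
  note I = int[unfolded set_integrable_def, folded h_def]
  have key: "(\<integral>\<^sup>+s. k s \<partial>interval_measure p) + (\<integral>\<^sup>+s. k s \<partial>interval_measure n')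
    = (\<integral>\<^sup>+s. k s \<partial>interval_measure p') + (\<integral>\<^sup>+s. k s \<partial>interval_measure n)"
    if k: "k \<in> borel_measurable borel" "\<And>s. s \<notin> {u<..t} \<Longrightarrow> k s = 0" for k
  proof -
    have "(\<integral>\<^sup>+s. k s \<partial>interval_measure (\<lambda>s. p s + n' s)) = (\<integral>\<^sup>+s. k s \<partial>interval_measure (\<lambda>s. p' s + n s))"
    proof (rule nn_integral_interval_measure_cong[OF _ _ _ _ _ ut k])
      show "p s + n' s = p' s + n s" if "s \<in> {u..t}" for s using eq[OF that] by simp
    qed (use p n p' n' in \<open>auto simp: mono_def intro!: add_mono continuous_intros\<close>)
    then show ?thesis
      by (simp add: nn_integral_interval_measure_add[OF p n' k(1)] nn_integral_interval_measure_add[OF p' n k(1)])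
  qed
  have z: "h s = 0" if "s \<notin> {u<..t}" for s using that by (simp add: h_def)
  have fin: "(\<integral>\<^sup>+s. ennreal (h s) \<partial>interval_measure r) < \<infinity>" "(\<integral>\<^sup>+s. ennreal (- h s) \<partial>interval_measure r) < \<infinity>"
    if "integrable (interval_measure r) h" for r
    using that by (simp_all add: real_integrable_def less_top)
  have split: "enn2real a - enn2real b = enn2real c - enn2real d" if "a + d = c + b" "a < \<infinity>" "b < \<infinity>" "c < \<infinity>" "d < \<infinity>" for a b c d :: ennreal
  proof -
    have "enn2real (a + d) = enn2real (c + b)" using that(1) by simp
    then have "enn2real a + enn2real d = enn2real c + enn2real b"
      using that(2-5) by (simp add: enn2real_plus)
    then show ?thesis by simp
  qed
  have pos: "enn2real (\<integral>\<^sup>+s. ennreal (h s) \<partial>interval_measure p) - enn2real (\<integral>\<^sup>+s. ennreal (h s) \<partial>interval_measure n)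
     = enn2real (\<integral>\<^sup>+s. ennreal (h s) \<partial>interval_measure p') - enn2real (\<integral>\<^sup>+s. ennreal (h s) \<partial>interval_measure n')"
    by (intro split key fin I) (auto simp: z)
  have neg: "enn2real (\<integral>\<^sup>+s. ennreal (- h s) \<partial>interval_measure p) - enn2real (\<integral>\<^sup>+s. ennreal (- h s) \<partial>interval_measure n)
     = enn2real (\<integral>\<^sup>+s. ennreal (- h s) \<partial>interval_measure p') - enn2real (\<integral>\<^sup>+s. ennreal (- h s) \<partial>interval_measure n')"
    by (intro split key fin I) (auto simp: z)
  show ?thesis
    unfolding set_lebesgue_integral_def h_def[symmetric]
    using pos neg by (simp add: real_lebesgue_integral_def I)
qed

lemma has_ls_integral_unique:
  assumes "has_ls_integral f g u t I" "has_ls_integral f g u t I'" "u \<le> t"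
  shows "I = I'"
proof -
  obtain p n where 1: "mono p" "mono n" "\<And>s. continuous (at_right s) p" "\<And>s. continuous (at_right s) n"
      "\<And>s. s \<in> {u..t} \<Longrightarrow> g s = p s - n s"
      "set_integrable (interval_measure p) {u<..t} f" "set_integrable (interval_measure n) {u<..t} f"
      "I = set_lebesgue_integral (interval_measure p) {u<..t} f - set_lebesgue_integral (interval_measure n) {u<..t} f"
    using assms(1) unfolding has_ls_integral_def by auto
  obtain p' n' where 2: "mono p'" "mono n'" "\<And>s. continuous (at_right s) p'" "\<And>s. continuous (at_right s) n'"
      "\<And>s. s \<in> {u..t} \<Longrightarrow> g s = p' s - n' s"
      "set_integrable (interval_measure p') {u<..t} f" "set_integrable (interval_measure n') {u<..t} f"
      "I' = set_lebesgue_integral (interval_measure p') {u<..t} f - set_lebesgue_integral (interval_measure n') {u<..t} f"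
    using assms(2) unfolding has_ls_integral_def by auto
  show ?thesis unfolding 1(8) 2(8)
    by (rule ls_decomposition_unique) (use 1 2 assms(3) in auto)
qed

lemma ls_integral_eqI: "has_ls_integral f g u t I \<Longrightarrow> u \<le> t \<Longrightarrow> ls_integral f g u t = I"
  unfolding ls_integral_def by (rule the_equality) (auto intro: has_ls_integral_unique)

lemma has_ls_integral_cong:
  assumes "has_ls_integral f g u t I"
    and f: "\<And>s. s \<in> {u<..t} \<Longrightarrow> f s = f' s" and "\<And>s. s \<in> {u..t} \<Longrightarrow> g s = g' s"
  shows "has_ls_integral f' g' u t I"
proof -
  have "(\<lambda>s. indicator {u<..t} s *\<^sub>R f s) = (\<lambda>s. indicator {u<..t} s *\<^sub>R f' s)"
    using f by (auto split: split_indicator)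
  then show ?thesis using assms unfolding has_ls_integral_def set_integrable_def set_lebesgue_integral_def by simp
qed

lemma interval_measure_integral_add:
  fixes p q h :: "real \<Rightarrow> real"
  assumes p: "mono p" "\<And>s. continuous (at_right s) p" and q: "mono q" "\<And>s. continuous (at_right s) q"
    and I: "integrable (interval_measure p) h" "integrable (interval_measure q) h"
  shows "integrable (interval_measure (\<lambda>s. p s + q s)) h"
    and "integral\<^sup>L (interval_measure (\<lambda>s. p s + q s)) h
      = integral\<^sup>L (interval_measure p) h + integral\<^sup>L (interval_measure q) h"
proof -
  have h[measurable]: "h \<in> borel_measurable borel" using I(1) by auto
  have fin: "(\<integral>\<^sup>+s. ennreal (h s) \<partial>interval_measure r) < \<infinity>" "(\<integral>\<^sup>+s. ennreal (- h s) \<partial>interval_measure r) < \<infinity>"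
    if "integrable (interval_measure r) h" for r
    using that by (simp_all add: real_integrable_def less_top)
  note N = nn_integral_interval_measure_add[OF p q]
  have 1: "integrable (interval_measure (\<lambda>s. p s + q s)) h"
    using fin[OF I(1)] fin[OF I(2)] by (simp add: real_integrable_def N less_top)
  show "integrable (interval_measure (\<lambda>s. p s + q s)) h" by fact
  show "integral\<^sup>L (interval_measure (\<lambda>s. p s + q s)) h
      = integral\<^sup>L (interval_measure p) h + integral\<^sup>L (interval_measure q) h"
    using fin[OF I(1)] fin[OF I(2)]
    by (simp add: real_lebesgue_integral_def 1 I N enn2real_plus)
qed

lemma has_ls_integral_add:
  assumes "has_ls_integral f g u t I" "has_ls_integral f g' u t I'"
  shows "has_ls_integral f (\<lambda>s. g s + g' s) u t (I + I')"
proof -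
  obtain p n where 1: "mono p" "mono n" "\<And>s. continuous (at_right s) p" "\<And>s. continuous (at_right s) n"
      "\<And>s. s \<in> {u..t} \<Longrightarrow> g s = p s - n s"
      "set_integrable (interval_measure p) {u<..t} f" "set_integrable (interval_measure n) {u<..t} f"
      "I = set_lebesgue_integral (interval_measure p) {u<..t} f - set_lebesgue_integral (interval_measure n) {u<..t} f"
    using assms(1) unfolding has_ls_integral_def by auto
  obtain p' n' where 2: "mono p'" "mono n'" "\<And>s. continuous (at_right s) p'" "\<And>s. continuous (at_right s) n'"
      "\<And>s. s \<in> {u..t} \<Longrightarrow> g' s = p' s - n' s"
      "set_integrable (interval_measure p') {u<..t} f" "set_integrable (interval_measure n') {u<..t} f"
      "I' = set_lebesgue_integral (interval_measure p') {u<..t} f - set_lebesgue_integral (interval_measure n') {u<..t} f"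
    using assms(2) unfolding has_ls_integral_def by auto
  note int = 1(6,7) 2(6,7)
  note P = interval_measure_integral_add[OF 1(1,3) 2(1,3) int(1,3)[unfolded set_integrable_def]]
  note Q = interval_measure_integral_add[OF 1(2,4) 2(2,4) int(2,4)[unfolded set_integrable_def]]
  show ?thesis unfolding has_ls_integral_def
  proof (rule exI[of _ "\<lambda>s. p s + p' s"], rule exI[of _ "\<lambda>s. n s + n' s"], intro conjI)
    show "set_integrable (interval_measure (\<lambda>s. p s + p' s)) {u<..t} f"
      "set_integrable (interval_measure (\<lambda>s. n s + n' s)) {u<..t} f"
      using P(1) Q(1) by (simp_all add: set_integrable_def)
    show "I + I' = (LINT x:{u<..t}|interval_measure (\<lambda>s. p s + p' s). f x) -
             (LINT x:{u<..t}|interval_measure (\<lambda>s. n s + n' s). f x)"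
      using P(2) Q(2) unfolding 1(8) 2(8) by (simp add: set_lebesgue_integral_def)
  qed (use 1(1-5) 2(1-5) in \<open>auto simp: mono_def intro!: add_mono continuous_intros\<close>)
qed

lemma has_ls_integral_uminus:
  assumes "has_ls_integral f g u t I"
  shows "has_ls_integral f (\<lambda>s. - g s) u t (- I)"
proof -
  obtain p n where 1: "mono p" "mono n" "\<And>s. continuous (at_right s) p" "\<And>s. continuous (at_right s) n"
      "\<And>s. s \<in> {u..t} \<Longrightarrow> g s = p s - n s"
      "set_integrable (interval_measure p) {u<..t} f" "set_integrable (interval_measure n) {u<..t} f"
      "I = set_lebesgue_integral (interval_measure p) {u<..t} f - set_lebesgue_integral (interval_measure n) {u<..t} f"
    using assms(1) unfolding has_ls_integral_def by auto
  show ?thesis unfolding has_ls_integral_def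
    by (rule exI[of _ n], rule exI[of _ p]) (use 1 in auto)
qed

lemma has_ls_integral_diff:
  "has_ls_integral f g u t I \<Longrightarrow> has_ls_integral f g' u t I' \<Longrightarrow>
    has_ls_integral f (\<lambda>s. g s - g' s) u t (I - I')"
  using has_ls_integral_add[OF _ has_ls_integral_uminus, of f g u t I g' I'] by simp

lemma has_ls_integral_const:
  assumes "set_borel_measurable borel {u<..t} f"
  shows "has_ls_integral f (\<lambda>s. c) u t 0"
proof -
  have "interval_measure (\<lambda>s. d) = null_measure borel" for d :: real
    by (rule interval_measure_eqI) (auto simp: mono_def)
  then show ?thesis unfolding has_ls_integral_def
  proof -
    note z = \<open>\<And>d. interval_measure (\<lambda>s. d) = null_measure borel\<close>
    show "\<exists>p n. mono p \<and> mono n \<and> (\<forall>s. continuous (at_right s) p) \<and> (\<forall>s. continuous (at_right s) n) \<and>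
       (\<forall>s\<in>{u..t}. c = p s - n s) \<and> set_integrable (interval_measure p) {u<..t} f \<and>
       set_integrable (interval_measure n) {u<..t} f \<and>
       0 = set_lebesgue_integral (interval_measure p) {u<..t} f - set_lebesgue_integral (interval_measure n) {u<..t} f"
      by (rule exI[of _ "\<lambda>s. c"], rule exI[of _ "\<lambda>s. 0"])
         (use assms in \<open>auto simp: z mono_def set_integrable_def set_lebesgue_integral_def set_borel_measurable_def\<close>)
  qed
qed

lemma has_ls_integral_sum:
  "set_borel_measurable borel {u<..t} f \<Longrightarrow> finite A \<Longrightarrow> (\<And>i. i \<in> A \<Longrightarrow> has_ls_integral f (g i) u t (I i)) \<Longrightarrow>
    has_ls_integral f (\<lambda>s. \<Sum>i\<in>A. g i s) u t (\<Sum>i\<in>A. I i)"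
  by (rotate_tac 1, induction A rule: finite_induct) (auto intro: has_ls_integral_const has_ls_integral_add)

text \<open>For \<open>c \<ge> 0\<close> the Stieltjes measure is \<open>c\<close> times the point
  mass at \<open>a\<close>; negative \<open>c\<close> follows by exchanging the two parts of the
  decomposition. The point \<open>a\<close> has to exceed \<open>u\<close>, since a jump at
  \<open>u\<close> is invisible to an integral over \<open>(u, t]\<close>.\<close>

lemma has_ls_integral_step:
  fixes c :: real
  assumes a: "u < a" "a \<le> t" and f: "set_borel_measurable borel {u<..t} f"
  shows "has_ls_integral f (\<lambda>s. c * indicator {a..} s) u t (c * f a)"
proof -
  have *: "has_ls_integral f (\<lambda>s. c * indicator {a..} s) u t (c * f a)" if c: "0 \<le> c" for c :: real
  proof -
    let ?p = "\<lambda>s. c * indicator {a..} s :: real"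
    have mono: "mono ?p" using c by (auto simp: mono_def split: split_indicator)
    have cont: "continuous (at_right s) ?p" for s
    proof (cases "a \<le> s")
      case True
      then have "\<forall>\<^sub>F x in at_right s. ?p x = ?p s"
        by (auto simp: eventually_at_right_field intro!: exI[of _ "s+1"])
      then show ?thesis unfolding continuous_within by (rule tendsto_eventually)
    next
      case False
      then have "\<forall>\<^sub>F x in at_right s. ?p x = ?p s"
        by (auto simp: eventually_at_right_field intro!: exI[of _ a])
      then show ?thesis unfolding continuous_within by (rule tendsto_eventually)
    qed
    have im: "interval_measure ?p = density (return borel a) (\<lambda>_. ennreal c)"
    proof (rule interval_measure_eqI[OF mono cont])
      fix x y :: real assume "x \<le> y"
      then show "emeasure (density (return borel a) (\<lambda>_. ennreal c)) {x<..y} = ennreal (?p y - ?p x)"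
        by (subst emeasure_density) (auto simp: nn_integral_cmult split: split_indicator)
    qed simp
    have z: "interval_measure (\<lambda>s. 0 :: real) = null_measure borel"
      by (rule interval_measure_eqI) (auto simp: mono_def)
    have m: "(\<lambda>s. indicator {u<..t} s *\<^sub>R f s) \<in> borel_measurable borel"
      using f by (simp add: set_borel_measurable_def)
    have fin: "integrable (return borel a) (\<lambda>s. indicator {u<..t} s *\<^sub>R f s)"
      using m a by (intro integrableI_bounded) (auto simp: nn_integral_return)
    show ?thesis unfolding has_ls_integral_def
    proof (rule exI[of _ ?p], rule exI[of _ "\<lambda>s. 0"], intro conjI)
      show "set_integrable (interval_measure ?p) {u<..t} f"
        unfolding set_integrable_def im using m c integrable_scaleR_right[OF fin, of c]
        by (subst integrable_density) auto
      have "(LINT s:{u<..t}|interval_measure ?p. f s) = c * f a"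
        unfolding set_lebesgue_integral_def im using m c a
        by (subst integral_density) (auto simp: integral_return)
      then show "c * f a = (LINT s:{u<..t}|interval_measure ?p. f s) - (LINT s:{u<..t}|interval_measure (\<lambda>s. 0). f s)"
        by (simp add: z set_lebesgue_integral_def)
      show "set_integrable (interval_measure (\<lambda>s. 0)) {u<..t} f"
        unfolding set_integrable_def z using m by simp
      show "mono ?p" by (rule mono)
      show "mono (\<lambda>s. 0 :: real)" by (simp add: mono_def)
      show "\<forall>s. continuous (at_right s) ?p" using cont by blast
    qed simp_all
  qed
  show ?thesis
  proof (cases "0 \<le> c")
    case False
    then have "has_ls_integral f (\<lambda>s. - ((- c) * indicator {a..} s)) u t (- ((- c) * f a))"
      by (intro has_ls_integral_uminus *) auto
    then show ?thesis by simp
  qed (rule *)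
qed

text \<open>The density is first cut to \<open>(u, t]\<close>, so that its primitive
  \<open>p\<close> is defined and Lipschitz on the whole line; the Lipschitz bound supplies the
  continuity that \<open>interval_measure\<close> demands. Because \<open>h \<ge> 0\<close>,
  \<open>p\<close> minus 0 is already a decomposition.\<close>

lemma has_ls_integral_absolutely_continuous:
  fixes h f :: "real \<Rightarrow> real"
  assumes f: "set_borel_measurable borel {u<..t} f" and h: "h \<in> borel_measurable borel" "\<And>s. 0 \<le> h s"
    and K: "\<And>s. s \<in> {u<..t} \<Longrightarrow> \<bar>f s\<bar> \<le> K" "\<And>s. s \<in> {u<..t} \<Longrightarrow> h s \<le> K" and ut: "u \<le> t"
  shows "has_ls_integral f (\<lambda>s. LBINT r:{u<..s}. h r) u t (LBINT r:{u<..t}. f r * h r)"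
proof -
  define k where "k = (\<lambda>s. indicator {u<..t} s * h s)"
  have k[measurable]: "k \<in> borel_measurable borel" unfolding k_def using h by measurable
  have k0: "0 \<le> k s" for s using h by (simp add: k_def)
  have kK: "k s \<le> \<bar>K\<bar> * indicator {u<..t} s" for s using K(2)[of s] by (auto simp: k_def split: split_indicator)
  have kint: "integrable lborel (\<lambda>s. indicator A s * k s)" if [measurable]: "A \<in> sets borel" for A
  proof (rule Bochner_Integration.integrable_bound)
    show "integrable lborel (\<lambda>s. \<bar>K\<bar> * indicator {u<..t} s)"
      by (cases "u \<le> t") (auto intro!: integrable_mult_right integrable_real_indicator)
    show "AE x in lborel. norm (indicator A x * k x) \<le> norm (\<bar>K\<bar> * indicator {u<..t} x)"
    proof (rule AE_I2)
      fix x show "norm (indicator A x * k x) \<le> norm (\<bar>K\<bar> * indicator {u<..t} x)"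
        using kK[of x] k0[of x] by (auto simp: split: split_indicator split_indicator_asm)
    qed
  qed measurable
  define p where "p = (\<lambda>s. LINT r|lborel. indicator {..s} r * k r)"
  have inc: "p b - p a = (LINT r|lborel. indicator {a<..b} r * k r)" if "a \<le> b" for a b
  proof -
    have "p b - p a = (LINT r|lborel. indicator {..b} r * k r - indicator {..a} r * k r)"
      unfolding p_def by (subst Bochner_Integration.integral_diff) (auto intro: kint)
    also have "\<dots> = (LINT r|lborel. indicator {a<..b} r * k r)"
      using that by (intro Bochner_Integration.integral_cong) (auto split: split_indicator)
    finally show ?thesis .
  qed
  have bnd: "p b - p a \<le> \<bar>K\<bar> * (b - a)" "0 \<le> p b - p a" if "a \<le> b" for a b
  proof -
    have "(LINT r|lborel. indicator {a<..b} r * k r) \<le> (LINT r|lborel. \<bar>K\<bar> * indicator {a<..b} r)"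
    proof (intro integral_mono kint)
      fix x show "indicator {a<..b} x * k x \<le> \<bar>K\<bar> * indicator {a<..b} x"
        using kK[of x] by (auto split: split_indicator split_indicator_asm)
    qed (auto simp: that intro!: integrable_mult_right integrable_real_indicator)
    then show "p b - p a \<le> \<bar>K\<bar> * (b - a)" using inc[OF that] that by simp
    show "0 \<le> p b - p a" unfolding inc[OF that] using k0 by (intro integral_nonneg_AE) (auto split: split_indicator)
  qed
  have mono: "mono p" using bnd(2) by (auto simp: mono_def)
  have lip: "\<bar>p x - p y\<bar> \<le> \<bar>K\<bar> * \<bar>x - y\<bar>" for x y
    using bnd[of x y] bnd[of y x] by (cases "x \<le> y") (auto simp: abs_if)
  have cont: "continuous (at_right s) p" for s
  proof -
    have "continuous_on UNIV p"
      by (rule lipschitz_on_continuous_on[of "\<bar>K\<bar>"] ) (auto simp: lipschitz_on_def dist_real_def lip)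
    then show ?thesis by (simp add: continuous_on_eq_continuous_within continuous_at_imp_continuous_at_within)
  qed
  have im: "interval_measure p = density lborel (\<lambda>s. ennreal (k s))"
  proof (rule interval_measure_eqI[OF mono cont])
    fix x y :: real assume "x \<le> y"
    have "emeasure (density lborel (\<lambda>s. ennreal (k s))) {x<..y} = (\<integral>\<^sup>+s. ennreal (indicator {x<..y} s * k s) \<partial>lborel)"
      by (subst emeasure_density) (auto intro!: nn_integral_cong split: split_indicator)
    also have "\<dots> = ennreal (p y - p x)"
      unfolding inc[OF \<open>x \<le> y\<close>] using k0 by (intro nn_integral_eq_integral kint) auto
    finally show "emeasure (density lborel (\<lambda>s. ennreal (k s))) {x<..y} = ennreal (p y - p x)" .
  qed simp
  have z: "interval_measure (\<lambda>s. 0 :: real) = null_measure borel"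
    by (rule interval_measure_eqI) (auto simp: mono_def)
  define F where "F = (\<lambda>s. indicator {u<..t} s *\<^sub>R f s)"
  have m[measurable]: "F \<in> borel_measurable borel"
    using f by (simp add: set_borel_measurable_def F_def)
  have FK: "\<bar>F s\<bar> \<le> \<bar>K\<bar>" for s using K(1)[of s] by (auto simp: F_def split: split_indicator)
  have int: "integrable lborel (\<lambda>s. k s *\<^sub>R F s)"
  proof (rule Bochner_Integration.integrable_bound)
    show "integrable lborel (\<lambda>s. \<bar>K\<bar> * (indicator UNIV s * k s))" by (intro integrable_mult_right kint) simp
    show "AE x in lborel. norm (k x *\<^sub>R F x) \<le> norm (\<bar>K\<bar> * (indicator UNIV x * k x))"
    proof (rule AE_I2)
      fix x show "norm (k x *\<^sub>R F x) \<le> norm (\<bar>K\<bar> * (indicator UNIV x * k x))"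
        using mult_right_mono[OF FK[of x] k0[of x]] k0[of x] by (simp add: abs_mult mult.commute)
    qed
  qed measurable
  have "has_ls_integral f p u t (LBINT r:{u<..t}. f r * h r)"
    unfolding has_ls_integral_def
  proof (rule exI[of _ p], rule exI[of _ "\<lambda>s. 0"], intro conjI)
    show "set_integrable (interval_measure p) {u<..t} f"
      unfolding set_integrable_def F_def[symmetric] im using int k0 by (subst integrable_density) auto
    have "(LINT s:{u<..t}|interval_measure p. f s) = (LINT s|lborel. k s *\<^sub>R F s)"
      unfolding set_lebesgue_integral_def F_def[symmetric] im using k0 by (subst integral_density) auto
    also have "\<dots> = (LBINT r:{u<..t}. f r * h r)"
      unfolding set_lebesgue_integral_def by (intro Bochner_Integration.integral_cong) (auto simp: k_def F_def split: split_indicator)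
    finally show "(LBINT r:{u<..t}. f r * h r) = (LINT s:{u<..t}|interval_measure p. f s) - (LINT s:{u<..t}|interval_measure (\<lambda>s. 0). f s)"
      by (simp add: z set_lebesgue_integral_def)
    show "set_integrable (interval_measure (\<lambda>s. 0)) {u<..t} f"
      unfolding set_integrable_def F_def[symmetric] z by simp
  qed (use mono cont in \<open>auto simp: mono_def\<close>)
  then show ?thesis
  proof (rule has_ls_integral_cong)
    fix s assume s: "s \<in> {u..t}"
    show "p s = (LBINT r:{u<..s}. h r)"
      unfolding p_def set_lebesgue_integral_def using s
      by (intro Bochner_Integration.integral_cong) (auto simp: k_def split: split_indicator)
  qed auto
qed

section \<open>Paths\<close>

lemma left_limit_eqI: "(f \<longlongrightarrow> l) (at_left t) \<Longrightarrow> left_limit f t = l"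
  unfolding left_limit_def by (rule tendsto_Lim) (simp add: trivial_limit_at_left_real)

lemma left_limit_tendsto:
  assumes "cadlag f" "0 < t"
  shows "(f \<longlongrightarrow> left_limit f t) (at_left t)"
proof -
  obtain l where "(f \<longlongrightarrow> l) (at_left t)" using assms unfolding cadlag_def by blast
  then show ?thesis using left_limit_eqI by metis
qed

text \<open>The largest multiple of \<open>1 / (n + 1)\<close> strictly below \<open>s\<close>: the
  ceiling minus 1, not the floor, keeps it strict at grid points. It approaches \<open>s\<close>
  from the left and takes countably many values.\<close>

definition left_point :: "nat \<Rightarrow> real \<Rightarrow> real" where
  "left_point n s = (of_int \<lceil>s * real (Suc n)\<rceil> - 1) / real (Suc n)"

lemma left_point:
  shows left_point_less: "left_point n s < s"
    and left_point_ge: "s - 1 / real (Suc n) \<le> left_point n s"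
    and left_point_nonneg: "0 < s \<Longrightarrow> 0 \<le> left_point n s"
proof -
  have "of_int \<lceil>s * real (Suc n)\<rceil> - 1 < s * real (Suc n)" by linarith
  then show "left_point n s < s" unfolding left_point_def by (simp add: divide_less_eq)
  have "s * real (Suc n) - 1 \<le> of_int \<lceil>s * real (Suc n)\<rceil> - 1" by linarith
  then have "(s * real (Suc n) - 1) / real (Suc n) \<le> left_point n s"
    unfolding left_point_def by (intro divide_right_mono) auto
  then show "s - 1 / real (Suc n) \<le> left_point n s" by (simp add: field_simps)
  assume "0 < s"
  then have "0 < s * real (Suc n)" by simp
  then have "1 \<le> \<lceil>s * real (Suc n)\<rceil>" by linarith
  then show "0 \<le> left_point n s" unfolding left_point_def by simp
qed

lemma left_point_tendsto: "filterlim (\<lambda>n. left_point n s) (at_left s) sequentially"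
  unfolding filterlim_at
proof (intro conjI)
  show "\<forall>\<^sub>F n in sequentially. left_point n s \<in> {..<s} \<and> left_point n s \<noteq> s"
    using left_point_less[of _ s] by (auto simp: less_imp_neq)
  show "(\<lambda>n. left_point n s) \<longlonglongrightarrow> s"
  proof (rule real_tendsto_sandwich)
    show "\<forall>\<^sub>F n in sequentially. s - 1 / real (Suc n) \<le> left_point n s" using left_point_ge by auto
    show "\<forall>\<^sub>F n in sequentially. left_point n s \<le> s"
      using left_point_less by (intro always_eventually allI less_imp_le)
    have "(\<lambda>n. s - 1 / real (Suc n)) \<longlonglongrightarrow> s - 0"
      by (intro tendsto_intros LIMSEQ_Suc[OF lim_1_over_n])
    then show "(\<lambda>n. s - 1 / real (Suc n)) \<longlonglongrightarrow> s" by simp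
  qed simp
qed

lemma left_limit_left_point:
  "cadlag f \<Longrightarrow> 0 < s \<Longrightarrow> (\<lambda>n. f (left_point n s)) \<longlonglongrightarrow> left_limit f s"
  by (rule filterlim_compose[OF left_limit_tendsto left_point_tendsto])

text \<open>Near each point the path is bounded, through its right limit on one side and its left
  limit on the other, and \<open>[0, T]\<close> is compact.\<close>

lemma cadlag_bounded:
  assumes f: "cadlag f"
  obtains K where "\<And>s. s \<in> {0..T} \<Longrightarrow> \<bar>f s\<bar> \<le> K"
proof -
  have "\<exists>d>0. \<exists>K. \<forall>y\<in>{0..T}. dist x y < d \<longrightarrow> \<bar>f y\<bar> \<le> K" if x: "x \<in> {0..T}" for x
  proof -
    have "\<forall>\<^sub>F y in at_right x. \<bar>f y\<bar> < \<bar>f x\<bar> + 1"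
      using f x unfolding cadlag_def by (intro order_tendstoD(2)[OF tendsto_rabs]) auto
    then obtain b where b: "x < b" "\<And>y. x < y \<Longrightarrow> y < b \<Longrightarrow> \<bar>f y\<bar> < \<bar>f x\<bar> + 1"
      unfolding eventually_at_right_field by blast
    have "\<exists>a<x. \<exists>L. \<forall>y. 0 \<le> y \<longrightarrow> a < y \<longrightarrow> y < x \<longrightarrow> \<bar>f y\<bar> < L"
    proof (cases "0 < x")
      case True
      then have "\<forall>\<^sub>F y in at_left x. \<bar>f y\<bar> < \<bar>left_limit f x\<bar> + 1"
        using left_limit_tendsto[OF f True] by (intro order_tendstoD(2)[OF tendsto_rabs]) auto
      then show ?thesis unfolding eventually_at_left_field by blast
    next
      \<comment> \<open>Here \<open>x = 0\<close>, with no times of \<open>[0, T]\<close> to its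
        left, so any \<open>a\<close> below it does.\<close>
      case False
      then show ?thesis using x by (intro exI[of _ "x - 1"]) auto
    qed
    then obtain a L where a: "a < x" "\<And>y. 0 \<le> y \<Longrightarrow> a < y \<Longrightarrow> y < x \<Longrightarrow> \<bar>f y\<bar> < L" by blast
    show ?thesis
    proof (rule exI[of _ "min (b - x) (x - a)"], rule conjI)
      show "0 < min (b - x) (x - a)" using a b by simp
      show "\<exists>K. \<forall>y\<in>{0..T}. dist x y < min (b - x) (x - a) \<longrightarrow> \<bar>f y\<bar> \<le> K"
      proof (rule exI[of _ "max (\<bar>f x\<bar> + 1) L"], intro ballI impI)
        fix y assume y: "y \<in> {0..T}" "dist x y < min (b - x) (x - a)"
        consider "y = x" | "y < x" "a < y" | "x < y" "y < b" using y by (auto simp: dist_real_def abs_if split: if_splits) linarith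
        then show "\<bar>f y\<bar> \<le> max (\<bar>f x\<bar> + 1) L"
          by cases (use a(2)[of y] b(2)[of y] y in auto)
      qed
    qed
  qed
  then obtain d K where dK: "\<And>x. x \<in> {0..T} \<Longrightarrow> 0 < d x"
      "\<And>x y. x \<in> {0..T} \<Longrightarrow> y \<in> {0..T} \<Longrightarrow> dist x y < d x \<Longrightarrow> \<bar>f y\<bar> \<le> K x" by metis
  have "compact {0..T}" by simp
  then obtain C where C: "C \<subseteq> {0..T}" "finite C" "{0..T} \<subseteq> (\<Union>x\<in>C. ball x (d x))"
    by (rule compactE_image[of _ "{0..T}" "\<lambda>x. ball x (d x)"]) (use dK in auto)
  show ?thesis
  proof (rule that)
    fix s assume s: "s \<in> {0..T}"
    then obtain x where x: "x \<in> C" "dist x s < d x" using C by auto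
    then have "\<bar>f s\<bar> \<le> K x" using dK(2) C s by auto
    also have "\<dots> \<le> \<bar>K x\<bar>" by simp
    also have "\<dots> \<le> (\<Sum>x\<in>C. \<bar>K x\<bar>)" using C x by (intro member_le_sum) auto
    finally show "\<bar>f s\<bar> \<le> (\<Sum>x\<in>C. \<bar>K x\<bar>)" .
  qed
qed

lemma left_limit_bounded:
  assumes f: "cadlag f" and K: "\<And>s. s \<in> {0..T} \<Longrightarrow> \<bar>f s\<bar> \<le> K" and s: "s \<in> {0<..T}"
  shows "\<bar>left_limit f s\<bar> \<le> K"
proof (rule LIMSEQ_le_const2)
  show "(\<lambda>n. \<bar>f (left_point n s)\<bar>) \<longlonglongrightarrow> \<bar>left_limit f s\<bar>"
    using s by (intro tendsto_intros left_limit_left_point f) auto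
  show "\<exists>N. \<forall>n\<ge>N. \<bar>f (left_point n s)\<bar> \<le> K"
  proof (intro exI[of _ 0] allI impI K)
    fix n show "left_point n s \<in> {0..T}" using s left_point_less[of n s] left_point_nonneg[of s n] by simp
  qed
qed

text \<open>The grid value \<open>f (left_point n s)\<close> depends on \<open>s\<close> only
  through an integer, hence is Borel whatever \<open>f\<close> is; the left limit is the pointwise
  limit of these. Time 0 is excluded because no left limit is prescribed there.\<close>

lemma measurable_left_limit:
  assumes f: "cadlag f"
  shows "set_borel_measurable borel {0<..T} (left_limit f)"
proof -
  have [measurable]: "(\<lambda>s. f (left_point n s)) \<in> borel_measurable borel" for n
  proof -
    have "(\<lambda>s::real. \<lceil>s * real (Suc n)\<rceil>) \<in> measurable borel (count_space UNIV)" by measurable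
    then have "(\<lambda>s. (\<lambda>k. f ((of_int k - 1) / real (Suc n))) \<lceil>s * real (Suc n)\<rceil>) \<in> borel_measurable borel"
      by (rule measurable_compose) simp
    then show ?thesis by (simp add: left_point_def)
  qed
  show ?thesis unfolding set_borel_measurable_def
  proof (rule borel_measurable_LIMSEQ_real)
    fix s :: real
    show "(\<lambda>n. indicator {0<..T} s *\<^sub>R f (left_point n s)) \<longlonglongrightarrow> indicator {0<..T} s *\<^sub>R left_limit f s"
      by (auto split: split_indicator intro: left_limit_left_point[OF f])
  qed measurable
qed

text \<open>Induction on the number of points of \<open>J\<close> in \<open>(s, t]\<close>. The last
  one, \<open>r\<close>, is split off: with \<open>q\<close> the preceding point of
  \<open>J\<close>, or \<open>s\<close>, the path equals \<open>f q\<close> on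
  \<open>[q, r)\<close>, so that its jump at \<open>r\<close> is \<open>f r - f q\<close>. Points of
  \<open>J\<close> without a jump contribute 0.\<close>

lemma piecewise_constant_increment:
  fixes f :: "real \<Rightarrow> real"
  assumes J: "finite J" "\<forall>r s. 0 \<le> r \<longrightarrow> r \<le> s \<longrightarrow> s \<le> T \<longrightarrow> {r<..s} \<inter> J = {} \<longrightarrow> f r = f s"
    and s: "0 \<le> s" "s \<le> t" "t \<le> T"
  shows "f t - f s = (\<Sum>r\<in>J \<inter> {s<..t}. jump f r)"
  using s(2,3)
proof (induction "card (J \<inter> {s<..t})" arbitrary: t rule: less_induct)
  case less
  show ?case
  proof (cases "J \<inter> {s<..t} = {}")
    case True
    then have "f s = f t" using less.prems s True by (intro J(2)[rule_format]) auto
    then show ?thesis using True by simp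
  next
    case False
    define r where "r = Max (J \<inter> {s<..t})"
    have fin: "finite (J \<inter> A)" for A using J(1) by simp
    have r: "r \<in> J \<inter> {s<..t}" "\<And>x. x \<in> J \<inter> {s<..t} \<Longrightarrow> x \<le> r"
      unfolding r_def using Max_in[OF fin False] Max_ge[OF fin] by auto
    define q where "q = Max (insert s (J \<inter> {s<..<r}))"
    have q: "s \<le> q" "q < r" "\<And>x. x \<in> J \<inter> {s<..<r} \<Longrightarrow> x \<le> q"
    proof -
      let ?Q = "insert s (J \<inter> {s<..<r})"
      have Q: "finite ?Q" "?Q \<noteq> {}" using fin by auto
      show "s \<le> q" unfolding q_def by (rule Max_ge[OF Q(1)]) simp
      show "q < r" using Max_in[OF Q] r(1) unfolding q_def by auto
      show "x \<le> q" if "x \<in> J \<inter> {s<..<r}" for x unfolding q_def by (rule Max_ge[OF Q(1)]) (use that in simp)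
    qed
    have "{r<..t} \<inter> J = {}"
    proof (rule ccontr)
      assume "{r<..t} \<inter> J \<noteq> {}"
      then obtain x where "r < x" "x \<le> t" "x \<in> J" by auto
      then show False using r(1) r(2)[of x] by auto
    qed
    then have "f r = f t" using r(1) less.prems s by (intro J(2)[rule_format]) auto
    have fq: "f y = f q" if "q \<le> y" "y < r" for y
    proof -
      have "{q<..y} \<inter> J = {}"
      proof (rule ccontr)
        assume "{q<..y} \<inter> J \<noteq> {}"
        then obtain x where "q < x" "x \<le> y" "x \<in> J" by auto
        then show False using q(1) q(3)[of x] that by auto
      qed
      then show ?thesis using that q(1,2) s r(1) less.prems by (intro J(2)[rule_format, symmetric]) auto
    qed
    have "(f \<longlongrightarrow> f q) (at_left r)"
    proof (rule tendsto_eventually)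
      show "\<forall>\<^sub>F y in at_left r. f y = f q"
        unfolding eventually_at_left_field
        by (rule exI[of _ q], intro conjI allI impI q(2), rule fq) (rule less_imp_le)
    qed
    then have "jump f r = f r - f q" unfolding jump_def by (simp add: left_limit_eqI)
    moreover have eq: "J \<inter> {s<..t} = insert r (J \<inter> {s<..q})"
    proof (intro set_eqI iffI)
      fix x assume x: "x \<in> J \<inter> {s<..t}"
      then show "x \<in> insert r (J \<inter> {s<..q})" using r(2)[OF x] q(3)[of x] by (cases "x = r") auto
    qed (use q(1,2) r(1) in auto)
    moreover have "f q - f s = (\<Sum>r\<in>J \<inter> {s<..q}. jump f r)"
    proof (rule less.hyps)
      show "card (J \<inter> {s<..q}) < card (J \<inter> {s<..t})"
        unfolding eq using q(2) fin by simp
    qed (use q(1,2) r(1) less.prems in auto)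
    moreover have "(\<Sum>r\<in>J \<inter> {s<..t}. jump f r) = jump f r + (\<Sum>r\<in>J \<inter> {s<..q}. jump f r)"
      unfolding eq using q(2) fin by simp
    ultimately show ?thesis using \<open>f r = f t\<close> by simp
  qed
qed

text \<open>If \<open>r\<close> is not in \<open>J\<close>, the path is constant from just after the
  last point of \<open>J\<close> before \<open>r\<close> up to and including \<open>r\<close>, so it
  has no jump there.\<close>

lemma piecewise_constant_jump_subset:
  fixes f :: "real \<Rightarrow> real"
  assumes J: "finite J" "\<forall>r s. 0 \<le> r \<longrightarrow> r \<le> s \<longrightarrow> s \<le> T \<longrightarrow> {r<..s} \<inter> J = {} \<longrightarrow> f r = f s"
  shows "{r. 0 < r \<and> r \<le> T \<and> jump f r \<noteq> 0} \<subseteq> J"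
proof (safe, rule ccontr)
  fix r assume r: "0 < r" "r \<le> T" "jump f r \<noteq> 0" "r \<notin> J"
  define q where "q = Max (insert 0 (J \<inter> {0<..<r}))"
  have q: "0 \<le> q" "q < r" "\<And>x. x \<in> J \<inter> {0<..<r} \<Longrightarrow> x \<le> q"
  proof -
    let ?Q = "insert 0 (J \<inter> {0<..<r})"
    have Q: "finite ?Q" "?Q \<noteq> {}" using J(1) by auto
    show "0 \<le> q" unfolding q_def by (rule Max_ge[OF Q(1)]) simp
    show "q < r" using Max_in[OF Q] r(1) unfolding q_def by auto
    show "x \<le> q" if "x \<in> J \<inter> {0<..<r}" for x unfolding q_def by (rule Max_ge[OF Q(1)]) (use that in simp)
  qed
  have "f y = f r" if "q < y" "y < r" for y
  proof -
    have "{y<..r} \<inter> J = {}"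
    proof (rule ccontr)
      assume "{y<..r} \<inter> J \<noteq> {}"
      then obtain x where "y < x" "x \<le> r" "x \<in> J" by auto
      then show False using q(1) q(3)[of x] r(4) that by (cases "x = r") auto
    qed
    then show ?thesis using that q r by (intro J(2)[rule_format]) auto
  qed
  then have "(f \<longlongrightarrow> f r) (at_left r)"
    by (intro tendsto_eventually) (use q in \<open>auto simp: eventually_at_left_field intro!: exI[of _ q]\<close>)
  then show False using r(3) left_limit_eqI unfolding jump_def by fastforce
qed

text \<open>Time 0 is left out because \<open>left_limit\<close> there would consult negative times,
  at which a process has no meaning.\<close>

definition jump_times :: "(real \<Rightarrow> real) \<Rightarrow> real set" where
  "jump_times f = {r. 0 < r \<and> jump f r \<noteq> 0}"

lemma finite_jump_times:
  assumes "piecewise_constant f"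
  shows "finite (jump_times f \<inter> {..t})"
proof (cases "0 \<le> t")
  case True
  then obtain J where J: "finite J" "\<forall>r s. 0 \<le> r \<longrightarrow> r \<le> s \<longrightarrow> s \<le> t \<longrightarrow> {r<..s} \<inter> J = {} \<longrightarrow> f r = f s"
    using assms unfolding piecewise_constant_def by meson
  from finite_subset[OF piecewise_constant_jump_subset[OF J] J(1)] show ?thesis
    by (rule rev_finite_subset) (auto simp: jump_times_def)
next
  case False
  then have "jump_times f \<inter> {..t} = {}" by (auto simp: jump_times_def)
  then show ?thesis by simp
qed

lemma counting_path_increment:
  assumes f: "piecewise_constant f" "\<And>r. 0 < r \<Longrightarrow> jump f r \<in> {0, 1}" and s: "0 \<le> s" "s \<le> t"
  shows "f t - f s = real (card (jump_times f \<inter> {s<..t}))"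
proof -
  have "0 \<le> t" using s by simp
  obtain J where J: "finite J" "\<forall>r s. 0 \<le> r \<longrightarrow> r \<le> s \<longrightarrow> s \<le> t \<longrightarrow> {r<..s} \<inter> J = {} \<longrightarrow> f r = f s"
    using f(1) \<open>0 \<le> t\<close> unfolding piecewise_constant_def by meson
  have "f t - f s = (\<Sum>r\<in>J \<inter> {s<..t}. jump f r)"
    by (rule piecewise_constant_increment[where f = f and T = t, OF J s order_refl])
  also have "\<dots> = (\<Sum>r\<in>jump_times f \<inter> {s<..t}. 1)"
  proof (rule sum.mono_neutral_cong_right)
    show "jump_times f \<inter> {s<..t} \<subseteq> J \<inter> {s<..t}"
      using piecewise_constant_jump_subset[where f = f and T = t, OF J] by (auto simp: jump_times_def)
    show "jump f r = 1" if "r \<in> jump_times f \<inter> {s<..t}" for r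
      using f(2)[of r] that by (auto simp: jump_times_def)
  qed (use J(1) s in \<open>auto simp: jump_times_def\<close>)
  finally show ?thesis by simp
qed

section \<open>The exponential of a path\<close>

lemma set_integral_sum:
  fixes f :: "'i \<Rightarrow> 'b \<Rightarrow> real"
  assumes "\<And>i. i \<in> A \<Longrightarrow> set_integrable M S (f i)"
  shows "set_integrable M S (\<lambda>x. \<Sum>i\<in>A. f i x)"
    and "(LINT x:S|M. \<Sum>i\<in>A. f i x) = (\<Sum>i\<in>A. LINT x:S|M. f i x)"
  using assms unfolding set_integrable_def set_lebesgue_integral_def
  by (simp_all add: sum_distrib_left Bochner_Integration.integral_sum)

lemma set_integrable_bounded_interval:
  fixes f :: "real \<Rightarrow> real"
  assumes "set_borel_measurable borel {u<..t} f" "\<And>s. s \<in> {u<..t} \<Longrightarrow> \<bar>f s\<bar> \<le> K"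
  shows "set_integrable lborel {u<..t} f"
  unfolding set_integrable_def
proof (rule Bochner_Integration.integrable_bound)
  show "integrable lborel (\<lambda>s. \<bar>K\<bar> * indicator {u<..t} s)"
    by (cases "u \<le> t") (auto intro!: integrable_mult_right integrable_real_indicator)
  show "(\<lambda>s. indicator {u<..t} s *\<^sub>R f s) \<in> borel_measurable lborel"
    using assms(1) by (simp add: set_borel_measurable_def)
  show "AE s in lborel. norm (indicator {u<..t} s *\<^sub>R f s) \<le> norm (\<bar>K\<bar> * indicator {u<..t} s)"
    using assms(2) by (intro AE_I2) (force split: split_indicator)
qed

lemma set_integral_Ioc_bound:
  fixes f :: "real \<Rightarrow> real"
  assumes "set_borel_measurable borel {u<..t} f" "\<And>s. s \<in> {u<..t} \<Longrightarrow> \<bar>f s\<bar> \<le> K" "u \<le> t"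
  shows "\<bar>LBINT s:{u<..t}. f s\<bar> \<le> K * (t - u)"
proof -
  have "norm (LBINT s:{u<..t}. f s) \<le> (LINT s|lborel. norm (indicator {u<..t} s *\<^sub>R f s))"
    unfolding set_lebesgue_integral_def by (rule integral_norm_bound)
  also have "\<dots> \<le> (LINT s|lborel. K * indicator {u<..t} s)"
  proof (rule integral_mono)
    show "integrable lborel (\<lambda>s. norm (indicator {u<..t} s *\<^sub>R f s))"
      using set_integrable_bounded_interval[OF assms(1,2)] by (simp add: set_integrable_def)
    show "integrable lborel (\<lambda>s. K * indicator {u<..t} s)"
      using assms(3) by (auto intro!: integrable_mult_right integrable_real_indicator)
    show "norm (indicator {u<..t} s *\<^sub>R f s) \<le> K * indicator {u<..t} s" for s
      using assms(2)[of s] by (auto split: split_indicator)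
  qed
  also have "\<dots> = K * (t - u)" using assms(3) by simp
  finally show ?thesis by simp
qed

lemma set_integral_Ioc_split:
  fixes f :: "real \<Rightarrow> real"
  assumes "set_integrable lborel {a<..c} f" "a \<le> b" "b \<le> c"
  shows "(LBINT s:{a<..c}. f s) = (LBINT s:{a<..b}. f s) + (LBINT s:{b<..c}. f s)"
proof -
  have *: "{a<..c} = {a<..b} \<union> {b<..c}" using assms(2,3) by auto
  show ?thesis unfolding *
    by (rule set_integral_Un) (use assms in \<open>auto intro: set_integrable_subset\<close>)
qed

lemma exp_diff_bound: "\<bar>exp x - exp y\<bar> \<le> \<bar>x - y\<bar> * max (exp x) (exp (y::real))"
proof -
  have *: "exp x - exp y \<le> \<bar>x - y\<bar> * exp x" for x y :: real
  proof -
    have "1 + (y - x) \<le> exp (y - x)" by (rule exp_ge_add_one_self)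
    then have "(1 + (y - x)) * exp x \<le> exp (y - x) * exp x" by (rule mult_right_mono) simp
    then have "exp x - exp y \<le> (x - y) * exp x" by (simp add: exp_diff algebra_simps)
    also have "\<dots> \<le> \<bar>x - y\<bar> * exp x" by (intro mult_right_mono) auto
    finally show ?thesis .
  qed
  have "exp x - exp y \<le> \<bar>x - y\<bar> * max (exp x) (exp y)" "exp y - exp x \<le> \<bar>x - y\<bar> * max (exp x) (exp y)"
    using *[of x y] *[of y x] by (auto intro!: order_trans[OF _ mult_left_mono] simp: abs_minus_commute)
  then show ?thesis by linarith
qed

text \<open>The error of linearising \<open>exp\<close> is quadratic, which is what makes a
  derivative vanish in \<open>exp_integral_eq\<close>.\<close>

lemma exp_second_order_bound:
  "\<bar>exp x - exp y - (x - y) * exp y\<bar> \<le> (x - y)\<^sup>2 * max (exp x) (exp (y::real))"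
proof -
  have "1 + (x - y) \<le> exp (x - y)" "1 + (y - x) \<le> exp (y - x)" by (rule exp_ge_add_one_self)+
  then have "(1 + (x - y)) * exp y \<le> exp (x - y) * exp y" "(1 + (y - x)) * exp x \<le> exp (y - x) * exp x"
    by (auto intro: mult_right_mono)
  then have "0 \<le> exp x - exp y - (x - y) * exp y" "exp x - exp y - (x - y) * exp y \<le> (x - y) * (exp x - exp y)"
    by (simp_all add: exp_diff algebra_simps)
  then have "\<bar>exp x - exp y - (x - y) * exp y\<bar> \<le> \<bar>(x - y) * (exp x - exp y)\<bar>"
    by linarith
  then have "\<bar>exp x - exp y - (x - y) * exp y\<bar> \<le> \<bar>x - y\<bar> * \<bar>exp x - exp y\<bar>"
    by (simp only: abs_mult)
  also have "\<dots> \<le> \<bar>x - y\<bar> * (\<bar>x - y\<bar> * max (exp x) (exp y))"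
    by (intro mult_left_mono exp_diff_bound) simp
  finally show ?thesis by (simp add: power2_eq_square mult.assoc[symmetric] abs_mult[symmetric])
qed

lemma exp_integral_eq:
  fixes b :: "real \<Rightarrow> real"
  assumes b[measurable]: "b \<in> borel_measurable borel" and B: "\<And>s. s \<in> {0<..T} \<Longrightarrow> \<bar>b s\<bar> \<le> B"
    and t: "0 \<le> t" "t \<le> T"
  defines "a \<equiv> \<lambda>s. LBINT r:{0<..s}. b r"
  shows "set_borel_measurable borel {0<..T} (\<lambda>s. exp (- a s))"
    and "\<And>s. s \<in> {0..T} \<Longrightarrow> exp (- a s) \<le> exp (B * T)"
    and "\<And>x y. x \<in> {0..T} \<Longrightarrow> y \<in> {0..T} \<Longrightarrow> \<bar>a x - a y\<bar> \<le> B * \<bar>x - y\<bar>"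
    and "exp (- a t) = 1 - (LBINT s:{0<..t}. b s * exp (- a s))"
proof -
  have bm: "set_borel_measurable borel {x<..y} b" for x y by (simp add: set_borel_measurable_def)
  have bi: "set_integrable lborel {x<..y} b" if "0 \<le> x" "y \<le> T" for x y
    using that B by (intro set_integrable_bounded_interval[OF bm, of _ _ B]) auto
  have inc: "a y - a x = (LBINT r:{x<..y}. b r)" if "0 \<le> x" "x \<le> y" "y \<le> T" for x y
    unfolding a_def using set_integral_Ioc_split[OF bi, of 0 y x] that by simp
  have lip0: "\<bar>a y - a x\<bar> \<le> B * (y - x)" if "0 \<le> x" "x \<le> y" "y \<le> T" for x y
    unfolding inc[OF that] using that B by (intro set_integral_Ioc_bound[OF bm]) auto
  show lip: "\<bar>a x - a y\<bar> \<le> B * \<bar>x - y\<bar>" if "x \<in> {0..T}" "y \<in> {0..T}" for x y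
    using lip0[of x y] lip0[of y x] that by (cases "x \<le> y") (auto simp: abs_minus_commute)
  have a0: "a 0 = 0" by (simp add: a_def set_lebesgue_integral_def)
  show eb: "exp (- a s) \<le> exp (B * T)" if "s \<in> {0..T}" for s
  proof -
    \<comment> \<open>For \<open>T = 0\<close> the bound on \<open>b\<close> is vacuous and
      \<open>B\<close> may be negative.\<close>
    have "0 \<le> B \<or> T = 0" using B[of T] that by force
    then have "B * s \<le> B * T" using that by (auto intro: mult_left_mono)
    then show ?thesis using lip0[of 0 s] that a0 by simp
  qed
  have contL: "continuous_on {0..T} (\<lambda>s. exp (- a s))"
  proof -
    have "\<bar>a x - a y\<bar> \<le> \<bar>B\<bar> * \<bar>x - y\<bar>" if "x \<in> {0..T}" "y \<in> {0..T}" for x y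
      by (rule order_trans[OF lip[OF that] mult_right_mono]) auto
    then have "continuous_on {0..T} a"
      by (intro lipschitz_on_continuous_on[of "\<bar>B\<bar>"]) (auto simp: lipschitz_on_def dist_real_def)
    then show ?thesis by (intro continuous_intros)
  qed
  show em: "set_borel_measurable borel {0<..T} (\<lambda>s. exp (- a s))"
    unfolding set_borel_measurable_def
    by (rule borel_measurable_continuous_on_indicator) (auto intro: continuous_on_subset[OF contL])
  define E where "E = exp (B * T)"
  define g where "g = (\<lambda>s. b s * exp (- a s))"
  have gm: "set_borel_measurable borel {x<..y} g" if "0 \<le> x" "y \<le> T" for x y
  proof -
    have "(\<lambda>s. indicator {x<..y} s *\<^sub>R g s) = (\<lambda>s. indicator {x<..y} s * (b s * (indicator {0<..T} s *\<^sub>R exp (- a s))))"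
      using that by (auto simp: g_def split: split_indicator)
    then show ?thesis using em unfolding set_borel_measurable_def by simp
  qed
  have gB: "\<bar>g s\<bar> \<le> B * E" if "s \<in> {0<..T}" for s
    unfolding g_def E_def abs_mult using B[OF that] eb[of s] that
    by (intro mult_mono) (auto intro: order_trans[OF abs_ge_zero])
  have gi: "set_integrable lborel {x<..y} g" if "0 \<le> x" "y \<le> T" for x y
    using that gB by (intro set_integrable_bounded_interval[OF gm, of _ _ "B * E"]) auto
  define \<Psi> where "\<Psi> = (\<lambda>s. exp (- a s) + (LBINT r:{0<..s}. g r))"
  \<comment> \<open>Two errors of size at most \<open>E * B\<^sup>2 * (y - x)\<^sup>2\<close> each:
    linearising \<open>exp\<close> at \<open>- a x\<close>, and replacing \<open>exp (- a r)\<close>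
    by \<open>exp (- a x)\<close> under the integral over \<open>(x, y]\<close>.\<close>
  have est: "\<bar>\<Psi> y - \<Psi> x\<bar> \<le> 2 * E * B\<^sup>2 * (y - x)\<^sup>2" if xy: "0 \<le> x" "x < y" "y \<le> T" for x y
  proof -
    have B0: "0 \<le> B" using B[of y] xy by force
    have m: "max (exp (- a y)) (exp (- a x)) \<le> E" using eb[of x] eb[of y] xy by (simp add: E_def)
    have d: "\<bar>a y - a x\<bar> \<le> B * (y - x)" using lip0 xy by auto
    have d2: "(a y - a x)\<^sup>2 \<le> B\<^sup>2 * (y - x)\<^sup>2" using power_mono[OF d, of 2] by (simp add: power_mult_distrib)
    have 1: "\<bar>exp (- a y) - exp (- a x) - (- a y - (- a x)) * exp (- a x)\<bar> \<le> B\<^sup>2 * (y - x)\<^sup>2 * E"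
    proof -
      have "(- a y - (- a x))\<^sup>2 * max (exp (- a y)) (exp (- a x)) \<le> B\<^sup>2 * (y - x)\<^sup>2 * E"
        using d2 m by (intro mult_mono) (auto simp: power2_commute le_max_iff_disj)
      then show ?thesis using exp_second_order_bound[of "- a y" "- a x"] by linarith
    qed
    have bx: "set_integrable lborel {x<..y} (\<lambda>r. b r * exp (- a x))" using bi[of x y] xy by simp
    have "(LBINT r:{x<..y}. g r) - (a y - a x) * exp (- a x) = (LBINT r:{x<..y}. g r - b r * exp (- a x))"
      using inc[of x y] xy gi bx by (simp add: set_integral_diff)
    also have "\<bar>\<dots>\<bar> \<le> B\<^sup>2 * (y - x) * E * (y - x)"
    proof (rule set_integral_Ioc_bound)
      show "set_borel_measurable borel {x<..y} (\<lambda>r. g r - b r * exp (- a x))"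
        using gm[of x y] xy bm[of x y] unfolding set_borel_measurable_def
        by (simp add: scaleR_diff_right[symmetric] right_diff_distrib)
      fix r assume r: "r \<in> {x<..y}"
      have "g r - b r * exp (- a x) = b r * (exp (- a r) - exp (- a x))" by (simp add: g_def algebra_simps)
      moreover have "\<bar>b r * (exp (- a r) - exp (- a x))\<bar> \<le> B * (B * (y - x) * E)"
      proof -
        have "\<bar>exp (- a r) - exp (- a x)\<bar> \<le> \<bar>- a r - (- a x)\<bar> * max (exp (- a r)) (exp (- a x))" by (rule exp_diff_bound)
        also have "\<dots> \<le> (B * (y - x)) * E"
        proof (rule mult_mono)
          have "\<bar>a r - a x\<bar> \<le> B * (r - x)" using lip0 xy r by auto
          also have "\<dots> \<le> B * (y - x)" using r B0 by (intro mult_left_mono) auto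
          finally show "\<bar>- a r - (- a x)\<bar> \<le> B * (y - x)" by (simp add: abs_minus_commute)
          show "max (exp (- a r)) (exp (- a x)) \<le> E" using eb[of x] eb[of r] xy r by (simp add: E_def)
        qed (use B0 xy in \<open>auto simp: le_max_iff_disj\<close>)
        finally show ?thesis unfolding abs_mult using B[of r] r xy B0 by (intro mult_mono) auto
      qed
      ultimately show "\<bar>g r - b r * exp (- a x)\<bar> \<le> B\<^sup>2 * (y - x) * E" by (simp add: power2_eq_square ac_simps)
    qed (use xy in auto)
    finally have 2: "\<bar>(LBINT r:{x<..y}. g r) - (a y - a x) * exp (- a x)\<bar> \<le> B\<^sup>2 * (y - x) * E * (y - x)" .
    have "\<Psi> y - \<Psi> x = (exp (- a y) - exp (- a x) - (- a y - (- a x)) * exp (- a x)) + ((LBINT r:{x<..y}. g r) - (a y - a x) * exp (- a x))"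
      unfolding \<Psi>_def using set_integral_Ioc_split[OF gi, of 0 y x] xy by (simp add: algebra_simps)
    moreover have "\<bar>A + C\<bar> \<le> 2 * E * B\<^sup>2 * (y - x)\<^sup>2"
      if "\<bar>A\<bar> \<le> B\<^sup>2 * (y - x)\<^sup>2 * E" "\<bar>C\<bar> \<le> B\<^sup>2 * (y - x) * E * (y - x)" for A C
    proof -
      have "B\<^sup>2 * (y - x) * E * (y - x) = B\<^sup>2 * (y - x)\<^sup>2 * E" by (simp add: power2_eq_square)
      then have "\<bar>A + C\<bar> \<le> B\<^sup>2 * (y - x)\<^sup>2 * E + B\<^sup>2 * (y - x)\<^sup>2 * E" using that by linarith
      then show ?thesis by (simp add: ac_simps)
    qed
    ultimately show ?thesis using 1 2 by presburger
  qed
  have est': "\<bar>\<Psi> y - \<Psi> x\<bar> \<le> 2 * E * B\<^sup>2 * (y - x)\<^sup>2" if "x \<in> {0..T}" "y \<in> {0..T}" for x y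
    using est[of x y] est[of y x] that by (cases x y rule: linorder_cases) (auto simp: abs_minus_commute power2_commute)
  have D: "(\<Psi> has_derivative (\<lambda>h. 0)) (at x within {0..T})" if x: "x \<in> {0..T}" for x
  proof (rule has_derivativeI_sandwich[of 1])
    show "((\<lambda>y. 2 * E * B\<^sup>2 * \<bar>y - x\<bar>) \<longlongrightarrow> 0) (at x within {0..T})"
      by (auto intro!: tendsto_eq_intros)
    show "norm (\<Psi> y - \<Psi> x - 0) / norm (y - x) \<le> 2 * E * B\<^sup>2 * \<bar>y - x\<bar>"
      if "y \<in> {0..T}" "y \<noteq> x" "dist y x < 1" for y
      using est'[OF x that(1)] that(2) by (simp add: divide_le_eq power2_eq_square ac_simps abs_mult[symmetric])
  qed auto
  have "\<Psi> t = \<Psi> 0"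
  proof (rule has_derivative_zero_unique_strong_interval[of "{}" 0 T \<Psi>])
    show "continuous_on {0..T} \<Psi>"
      unfolding continuous_on_eq_continuous_within using has_derivative_continuous[OF D] by blast
  qed (use D t in auto)
  then show "exp (- a t) = 1 - (LBINT s:{0<..t}. b s * exp (- a s))"
    by (simp add: \<Psi>_def g_def a0 set_lebesgue_integral_def)
qed

text \<open>Read the product as a path that jumps at the points of \<open>S\<close>: the summands
  are its successive jumps, each the left limit times the relative jump.\<close>

lemma prod_telescope:
  fixes m :: "'b::linorder \<Rightarrow> real"
  assumes "finite S"
  shows "(\<Prod>r\<in>S. m r) = 1 + (\<Sum>r\<in>S. (\<Prod>q\<in>{q\<in>S. q < r}. m q) * (m r - 1))"
  using assms
proof (induction rule: finite_linorder_max_induct)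
  case (insert b A)
  then have b: "b \<notin> A" by auto
  have "{q \<in> insert b A. q < b} = A" using insert by auto
  moreover have "{q \<in> insert b A. q < r} = {q \<in> A. q < r}" if "r \<in> A" for r using insert that by auto
  ultimately show ?case using insert b by (simp add: algebra_simps cong: sum.cong)
qed simp

definition drift :: "('d::finite \<Rightarrow> real \<Rightarrow> real) \<Rightarrow> real \<Rightarrow> real" where
  "drift v s = (\<Sum>i\<in>UNIV. v i s - 1)"

definition expo :: "('d::finite \<Rightarrow> real set) \<Rightarrow> ('d \<Rightarrow> real \<Rightarrow> real) \<Rightarrow> real \<Rightarrow> real" where
  "expo J v t = exp (- (LBINT s:{0<..t}. drift v s)) * (\<Prod>i\<in>UNIV. \<Prod>r\<in>J i \<inter> {0<..t}. v i r)"

text \<open>The left limit of \<open>expo\<close> at positive times, see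
  \<open>left_limit_expo\<close>: the drift integral is continuous, so only the product loses the
  jumps at \<open>t\<close>.\<close>

definition expo_left :: "('d::finite \<Rightarrow> real set) \<Rightarrow> ('d \<Rightarrow> real \<Rightarrow> real) \<Rightarrow> real \<Rightarrow> real" where
  "expo_left J v t = exp (- (LBINT s:{0<..t}. drift v s)) * (\<Prod>i\<in>UNIV. \<Prod>r\<in>J i \<inter> {0<..<t}. v i r)"

text \<open>One path at a time, with the sample point frozen: \<open>J i\<close> holds the jump
  times of coordinate \<open>i\<close>, and \<open>v i\<close> is its rate. Everything pathwise
  about the exponential is proved here without a probability space. Rates have to be Borel and
  bounded also at negative times, where those used later are constantly 1.\<close>

locale marked_path =
  fixes J :: "'d::finite \<Rightarrow> real set" and v :: "'d \<Rightarrow> real \<Rightarrow> real"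
  assumes J_finite: "finite (J i \<inter> {..t})"
    and J_disjoint: "i \<noteq> j \<Longrightarrow> J i \<inter> J j = {}"
    and v_borel[measurable]: "v i \<in> borel_measurable borel"
    and v_nonneg: "0 \<le> v i s"
    and v_bounded: "\<exists>K. \<forall>i. \<forall>s\<le>t. v i s \<le> K"
begin

lemma drift_borel[measurable]: "drift v \<in> borel_measurable borel"
  unfolding drift_def[abs_def] by measurable

lemma drift_bounded: obtains B where "\<And>s. s \<le> t \<Longrightarrow> \<bar>drift v s\<bar> \<le> B"
proof -
  obtain K where K: "\<And>i s. s \<le> t \<Longrightarrow> v i s \<le> K" using v_bounded[of t] by blast
  show ?thesis
  proof (rule that)
    fix s assume "s \<le> t"
    have "\<bar>drift v s\<bar> \<le> (\<Sum>i\<in>(UNIV::'d set). \<bar>v i s - 1\<bar>)" unfolding drift_def by (rule sum_abs)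
    also have "\<dots> \<le> (\<Sum>i\<in>(UNIV::'d set). K + 1)"
    proof (rule sum_mono)
      fix i show "\<bar>v i s - 1\<bar> \<le> K + 1" using K[OF \<open>s \<le> t\<close>, of i] v_nonneg[of i s] by linarith
    qed
    finally show "\<bar>drift v s\<bar> \<le> (\<Sum>i\<in>(UNIV::'d set). K + 1)" .
  qed
qed

lemma J_finite': "finite (J i \<inter> {0<..t})" "finite (J i \<inter> {0<..<t})"
  by (rule finite_subset[OF _ J_finite[of i t]]; auto)+

definition mark :: "real \<Rightarrow> real" where
  "mark r = (\<Prod>i\<in>UNIV. if r \<in> J i then v i r else 1)"

text \<open>At most one index has \<open>r\<close> among its jump times, so the product has at most
  one factor besides the default 1. This is where the absence of common jumps enters; simultaneous
  jumps would produce mixed terms.\<close>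

lemma mark_minus_1: "mark r - 1 = (\<Sum>i\<in>UNIV. if r \<in> J i then v i r - 1 else 0)"
proof (cases "\<exists>i. r \<in> J i")
  case True
  then obtain i where i: "r \<in> J i" by blast
  then have "r \<notin> J j" if "j \<noteq> i" for j using J_disjoint[OF that] by blast
  then have "r \<in> J j \<longleftrightarrow> j = i" for j using i by blast
  then show ?thesis by (simp add: mark_def)
qed (simp add: mark_def)

lemma prod_mark:
  assumes "finite S" "S \<subseteq> (\<Union>i. J i)"
  shows "(\<Prod>i\<in>UNIV. \<Prod>r\<in>J i \<inter> S. v i r) = (\<Prod>r\<in>S. mark r)"
  unfolding mark_def by (subst prod.swap) (simp add: prod.inter_restrict[OF assms(1)] Int_commute)

text \<open>By \<open>prod_telescope\<close> the jump product, as a function of time, is 1 plus a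
  combination of step functions switched on after the jump times \<open>r\<close>, with weights
  \<open>c r\<close>. Multiplied by \<open>exp (- a)\<close> and integrated against the drift, each
  step function contributes a difference of two values of \<open>exp (- a)\<close> by
  \<open>exp_integral_eq\<close>, so both sides reduce to finite sums.\<close>

lemma expo_equation:
  assumes t: "0 \<le> t"
  shows "expo J v t - 1 = (\<Sum>i\<in>UNIV. (\<Sum>r\<in>J i \<inter> {0<..t}. expo_left J v r * (v i r - 1)))
    - (LBINT s:{0<..t}. expo_left J v s * drift v s)"
proof -
  let ?a = "\<lambda>s. LBINT r:{0<..s}. drift v r"
  let ?g = "\<lambda>s. drift v s * exp (- ?a s)"
  define U where "U = (\<Union>i. J i) \<inter> {0<..t}"
  have fU: "finite U"
  proof -
    have "U = (\<Union>i. J i \<inter> {0<..t})" unfolding U_def by auto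
    then show ?thesis using J_finite'(1) by (simp only: finite_UN finite_class.finite_UNIV) simp
  qed
  obtain B where B: "\<And>s. s \<le> t \<Longrightarrow> \<bar>drift v s\<bar> \<le> B" using drift_bounded by blast
  have B': "\<And>s. s \<in> {0<..t} \<Longrightarrow> \<bar>drift v s\<bar> \<le> B" using B by auto
  note E = exp_integral_eq[OF drift_borel B', of t]
  define c where "c = (\<lambda>r. (\<Prod>q\<in>{q\<in>U. q < r}. mark q) * (mark r - 1))"
  have left: "(\<Prod>i\<in>UNIV. \<Prod>q\<in>J i \<inter> {0<..<r}. v i q) = (\<Prod>q\<in>{q\<in>U. q < r}. mark q)" if "r \<le> t" for r
  proof -
    have "J i \<inter> {0<..<r} = J i \<inter> {q\<in>U. q < r}" for i unfolding U_def using that by auto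
    then have "(\<Prod>i\<in>UNIV. \<Prod>q\<in>J i \<inter> {0<..<r}. v i q) = (\<Prod>i\<in>UNIV. \<Prod>q\<in>J i \<inter> {q\<in>U. q < r}. v i q)"
      by (simp only:)
    also have "\<dots> = (\<Prod>q\<in>{q\<in>U. q < r}. mark q)"
    proof (rule prod_mark)
      show "finite {q\<in>U. q < r}" using fU by simp
    qed (auto simp: U_def)
    finally show ?thesis .
  qed
  \<comment> \<open>The strict \<open>q < s\<close> matches \<open>expo_left\<close>, hence the open
    half-lines \<open>{r<..}\<close>.\<close>
  have tele: "(\<Prod>q\<in>{q\<in>U. q < s}. mark q) = 1 + (\<Sum>r\<in>U. c r * indicator {r<..} s)" for s
  proof -
    have "(\<Prod>q\<in>{q\<in>U. q < s}. mark q) = 1 + (\<Sum>r\<in>{q\<in>U. q < s}. c r)"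
      by (subst prod_telescope) (use fU in \<open>auto simp: c_def intro!: sum.cong prod.cong arg_cong2[of _ _ _ _ "(*)"]\<close>)
    also have "(\<Sum>r\<in>{q\<in>U. q < s}. c r) = (\<Sum>r\<in>U. c r * indicator {r<..} s)"
      using fU by (intro sum.mono_neutral_cong_left) auto
    finally show ?thesis .
  qed
  have gm: "set_borel_measurable borel {0<..t} ?g"
    using E(1) t unfolding set_borel_measurable_def by (auto simp: mult.left_commute)
  have gb: "\<bar>?g s\<bar> \<le> B * exp (B * t)" if "s \<in> {0<..t}" for s
    unfolding abs_mult using B'[OF that] E(2)[of s] that t
    by (intro mult_mono) (auto intro: order_trans[OF abs_ge_zero])
  have gi: "set_integrable lborel {0<..t} ?g" by (rule set_integrable_bounded_interval[OF gm gb])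
  have gi': "set_integrable lborel {0<..t} (\<lambda>s. ?g s * indicator {r<..} s)" if "r \<in> U" for r
  proof -
    have "set_integrable lborel {r<..t} ?g" using that by (intro set_integrable_subset[OF gi]) (auto simp: U_def)
    moreover have "(\<lambda>s. indicator {r<..t} s *\<^sub>R ?g s) = (\<lambda>s. indicator {0<..t} s *\<^sub>R (?g s * indicator {r<..} s))"
      using that by (auto simp: U_def split: split_indicator)
    ultimately show ?thesis unfolding set_integrable_def by simp
  qed
  have ge: "(LBINT s:{0<..t}. ?g s * indicator {r<..} s) = exp (- ?a r) - exp (- ?a t)" if "r \<in> U" for r
  proof -
    have r: "0 < r" "r \<le> t" using that by (auto simp: U_def)
    have "(LBINT s:{0<..t}. ?g s * indicator {r<..} s) = (LBINT s:{r<..t}. ?g s)"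
      unfolding set_lebesgue_integral_def using r by (intro Bochner_Integration.integral_cong) (auto split: split_indicator)
    also have "\<dots> = (LBINT s:{0<..t}. ?g s) - (LBINT s:{0<..r}. ?g s)"
      using set_integral_Ioc_split[OF gi, of r] r by simp
    also have "\<dots> = exp (- ?a r) - exp (- ?a t)"
      using exp_integral_eq(4)[OF drift_borel B', of t] exp_integral_eq(4)[OF drift_borel B', of r] r t by simp
    finally show ?thesis .
  qed
  have "(LBINT s:{0<..t}. expo_left J v s * drift v s) = (LBINT s:{0<..t}. ?g s + (\<Sum>r\<in>U. c r * (?g s * indicator {r<..} s)))"
  proof (rule set_lebesgue_integral_cong)
    show "\<forall>s. s \<in> {0<..t} \<longrightarrow> expo_left J v s * drift v s = ?g s + (\<Sum>r\<in>U. c r * (?g s * indicator {r<..} s))"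
      by (auto simp: expo_left_def left tele algebra_simps sum_distrib_left sum_distrib_right)
  qed simp
  also have "\<dots> = (LBINT s:{0<..t}. ?g s) + (\<Sum>r\<in>U. c r * (LBINT s:{0<..t}. ?g s * indicator {r<..} s))"
    using gi gi' fU by (subst set_integral_add) (auto simp: set_integral_sum intro!: set_integral_sum(1))
  also have "\<dots> = 1 - exp (- ?a t) + (\<Sum>r\<in>U. c r * (exp (- ?a r) - exp (- ?a t)))"
    using exp_integral_eq(4)[OF drift_borel B', of t] t by (simp add: ge cong: sum.cong)
  finally have I: "(LBINT s:{0<..t}. expo_left J v s * drift v s) = 1 - exp (- ?a t) + (\<Sum>r\<in>U. c r * exp (- ?a r)) - exp (- ?a t) * (\<Sum>r\<in>U. c r)"
    by (simp add: right_diff_distrib sum_subtractf sum_distrib_left sum_distrib_right mult.commute)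
  have P: "(\<Prod>i\<in>UNIV. \<Prod>r\<in>J i \<inter> {0<..t}. v i r) = 1 + (\<Sum>r\<in>U. c r)"
  proof -
    have "J i \<inter> {0<..t} = J i \<inter> U" for i unfolding U_def by auto
    then have "(\<Prod>i\<in>UNIV. \<Prod>r\<in>J i \<inter> {0<..t}. v i r) = (\<Prod>i\<in>UNIV. \<Prod>r\<in>J i \<inter> U. v i r)"
      by (simp only:)
    also have "\<dots> = (\<Prod>r\<in>U. mark r)"
      by (rule prod_mark) (use fU in \<open>auto simp: U_def\<close>)
    also have "\<dots> = 1 + (\<Sum>r\<in>U. c r)" unfolding c_def by (rule prod_telescope[OF fU])
    finally show ?thesis .
  qed
  have S: "(\<Sum>r\<in>U. c r * exp (- ?a r)) = (\<Sum>i\<in>UNIV. \<Sum>r\<in>J i \<inter> {0<..t}. expo_left J v r * (v i r - 1))"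
  proof -
    have "c r * exp (- ?a r) = (\<Sum>i\<in>UNIV. if r \<in> J i then expo_left J v r * (v i r - 1) else 0)" if "r \<in> U" for r
      using that left[of r] unfolding c_def mark_minus_1
      by (auto simp: expo_left_def U_def sum_distrib_left sum_distrib_right intro!: sum.cong)
    then have "(\<Sum>r\<in>U. c r * exp (- ?a r)) = (\<Sum>i\<in>UNIV. \<Sum>r\<in>U. if r \<in> J i then expo_left J v r * (v i r - 1) else 0)"
      by (simp add: sum.swap[of _ _ U])
    also have "\<dots> = (\<Sum>i\<in>UNIV. \<Sum>r\<in>J i \<inter> {0<..t}. expo_left J v r * (v i r - 1))"
      using fU by (intro sum.cong refl sum.mono_neutral_cong_right) (auto simp: U_def)
    finally show ?thesis .
  qed
  show ?thesis unfolding I S[symmetric] by (simp add: expo_def P algebra_simps)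
qed

lemma expo_nonneg: "0 \<le> expo J v t"
  unfolding expo_def by (intro mult_nonneg_nonneg prod_nonneg) (auto intro: v_nonneg)

lemma drift_integral_continuous: "0 \<le> x \<Longrightarrow> continuous (at x within {0..}) (\<lambda>s. LBINT r:{0<..s}. drift v r)"
proof -
  assume x: "0 \<le> x"
  obtain B where B: "\<And>s. s \<le> x + 1 \<Longrightarrow> \<bar>drift v s\<bar> \<le> B" using drift_bounded by blast
  have B': "\<bar>drift v s\<bar> \<le> B" if "s \<in> {0<..x+1}" for s using B that by auto
  have lip: "\<bar>(LBINT r:{0<..y}. drift v r) - (LBINT r:{0<..z}. drift v r)\<bar> \<le> \<bar>B\<bar> * \<bar>y - z\<bar>"
    if "y \<in> {0..x+1}" "z \<in> {0..x+1}" for y z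
    by (rule order_trans[OF exp_integral_eq(3)[OF drift_borel B' _ _ that, of 0] mult_right_mono]) (use x in auto)
  then have "continuous_on {0..x+1} (\<lambda>s. LBINT r:{0<..s}. drift v r)"
    by (intro lipschitz_on_continuous_on[of "\<bar>B\<bar>"]) (auto simp: lipschitz_on_def dist_real_def)
  then have "continuous (at x within {0..x+1}) (\<lambda>s. LBINT r:{0<..s}. drift v r)"
    using x by (auto simp: continuous_on_eq_continuous_within)
  moreover have "at x within {0..x+1} = at x within {0..}"
    by (rule at_within_nhd[of _ "{..<x+1}"]) auto
  ultimately show ?thesis by simp
qed

lemma jumps_eventually_at_right: "\<forall>\<^sub>F s in at_right t. \<forall>i. J i \<inter> {0<..s} = J i \<inter> {0<..t}"
proof (rule eventually_all_finite)
  fix i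
  let ?S = "J i \<inter> {t<..t+1}"
  have fin: "finite ?S" by (rule finite_subset[OF _ J_finite[of i "t+1"]]) auto
  define d where "d = Min (insert (t + 1) ?S)"
  have d: "t < d" "d \<le> t + 1" "\<And>x. x \<in> ?S \<Longrightarrow> d \<le> x"
  proof -
    have Q: "finite (insert (t+1) ?S)" "insert (t+1) ?S \<noteq> {}" using fin by auto
    show "t < d" using Min_in[OF Q] unfolding d_def by auto
    show "d \<le> t + 1" unfolding d_def by (rule Min_le[OF Q(1)]) simp
    show "d \<le> x" if "x \<in> ?S" for x unfolding d_def by (rule Min_le[OF Q(1)]) (use that in simp)
  qed
  have "J i \<inter> {0<..s} = J i \<inter> {0<..t}" if s: "t < s" "s < d" for s
  proof (intro set_eqI iffI)
    fix x assume x: "x \<in> J i \<inter> {0<..s}"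
    then show "x \<in> J i \<inter> {0<..t}" using s d(2) d(3)[of x] by (cases "x \<le> t") auto
  qed (use s in auto)
  then show "\<forall>\<^sub>F s in at_right t. J i \<inter> {0<..s} = J i \<inter> {0<..t}"
    unfolding eventually_at_right_field using d(1) by blast
qed

lemma jumps_eventually_at_left:
  assumes t: "0 < t"
  shows "\<forall>\<^sub>F s in at_left t. \<forall>i. J i \<inter> {0<..s} = J i \<inter> {0<..<t}"
proof (rule eventually_all_finite)
  fix i
  let ?S = "J i \<inter> {0<..<t}"
  define d where "d = Max (insert 0 ?S)"
  have d: "d < t" "0 \<le> d" "\<And>x. x \<in> ?S \<Longrightarrow> x \<le> d"
  proof -
    have Q: "finite (insert 0 ?S)" "insert 0 ?S \<noteq> {}" using J_finite' by auto
    show "d < t" using Max_in[OF Q] t unfolding d_def by auto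
    show "0 \<le> d" unfolding d_def by (rule Max_ge[OF Q(1)]) simp
    show "x \<le> d" if "x \<in> ?S" for x unfolding d_def by (rule Max_ge[OF Q(1)]) (use that in simp)
  qed
  have "J i \<inter> {0<..s} = J i \<inter> {0<..<t}" if s: "d < s" "s < t" for s
  proof (intro set_eqI iffI)
    fix x assume x: "x \<in> J i \<inter> {0<..<t}"
    then show "x \<in> J i \<inter> {0<..s}" using s d(3)[of x] by auto
  qed (use s in auto)
  then show "\<forall>\<^sub>F s in at_left t. J i \<inter> {0<..s} = J i \<inter> {0<..<t}"
    unfolding eventually_at_left_field using d(1) by blast
qed

lemma expo_tendsto_right:
  assumes "0 \<le> t"
  shows "(expo J v \<longlongrightarrow> expo J v t) (at_right t)"
proof -
  have "((\<lambda>s. LBINT r:{0<..s}. drift v r) \<longlongrightarrow> (LBINT r:{0<..t}. drift v r)) (at_right t)"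
    by (rule tendsto_within_subset[OF drift_integral_continuous[OF assms, unfolded continuous_within]])
      (use assms in auto)
  moreover have "((\<lambda>s. \<Prod>i\<in>UNIV. \<Prod>r\<in>J i \<inter> {0<..s}. v i r) \<longlongrightarrow> (\<Prod>i\<in>UNIV. \<Prod>r\<in>J i \<inter> {0<..t}. v i r)) (at_right t)"
    by (rule tendsto_eventually) (rule eventually_mono[OF jumps_eventually_at_right], simp)
  ultimately show ?thesis unfolding expo_def[abs_def] by (intro tendsto_mult tendsto_exp tendsto_minus)
qed

lemma expo_tendsto_left:
  assumes "0 < t"
  shows "(expo J v \<longlongrightarrow> expo_left J v t) (at_left t)"
proof -
  have "((\<lambda>s. LBINT r:{0<..s}. drift v r) \<longlongrightarrow> (LBINT r:{0<..t}. drift v r)) (at t within {0..<t})"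
    by (rule tendsto_within_subset[OF drift_integral_continuous[unfolded continuous_within]]) (use assms in auto)
  moreover have "at t within {0..<t} = at_left t"
    by (rule at_within_nhd[of _ "{0<..}"]) (use assms in auto)
  ultimately have "((\<lambda>s. LBINT r:{0<..s}. drift v r) \<longlongrightarrow> (LBINT r:{0<..t}. drift v r)) (at_left t)" by simp
  moreover have "((\<lambda>s. \<Prod>i\<in>UNIV. \<Prod>r\<in>J i \<inter> {0<..s}. v i r) \<longlongrightarrow> (\<Prod>i\<in>UNIV. \<Prod>r\<in>J i \<inter> {0<..<t}. v i r)) (at_left t)"
    by (rule tendsto_eventually) (rule eventually_mono[OF jumps_eventually_at_left[OF assms]], simp)
  ultimately show ?thesis unfolding expo_def[abs_def] expo_left_def by (intro tendsto_mult tendsto_exp tendsto_minus)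
qed

lemma cadlag_expo: "cadlag (expo J v)"
  unfolding cadlag_def using expo_tendsto_right expo_tendsto_left by blast

lemma left_limit_expo: "0 < t \<Longrightarrow> left_limit (expo J v) t = expo_left J v t"
  by (rule left_limit_eqI[OF expo_tendsto_left])

lemma expo_left_measurable: "set_borel_measurable borel {0<..t} (expo_left J v)"
proof -
  have "(\<lambda>s. indicator {0<..t} s *\<^sub>R expo_left J v s) = (\<lambda>s. indicator {0<..t} s *\<^sub>R left_limit (expo J v) s)"
    by (auto simp: left_limit_expo split: split_indicator)
  then show ?thesis using measurable_left_limit[OF cadlag_expo, of t] unfolding set_borel_measurable_def by simp
qed

lemma expo_left_bounded: obtains K where "\<And>s. s \<in> {0<..t} \<Longrightarrow> \<bar>expo_left J v s\<bar> \<le> K"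
proof -
  obtain K where K: "\<And>s. s \<in> {0..t} \<Longrightarrow> \<bar>expo J v s\<bar> \<le> K" using cadlag_bounded[OF cadlag_expo] by blast
  show ?thesis
  proof (rule that)
    show "\<bar>expo_left J v s\<bar> \<le> K" if "s \<in> {0<..t}" for s
      using left_limit_bounded[OF cadlag_expo K that] left_limit_expo[of s] that by simp
  qed
qed

lemma has_ls_integral_jumps:
  assumes f: "set_borel_measurable borel {u<..t} f" and u: "0 \<le> u"
  shows "has_ls_integral f (\<lambda>s. \<Sum>r\<in>J i \<inter> {u<..s}. c r) u t (\<Sum>r\<in>J i \<inter> {u<..t}. c r * f r)"
proof (rule has_ls_integral_cong)
  have fin: "finite (J i \<inter> {u<..t})" by (rule finite_subset[OF _ J_finite[of i t]]) auto
  show "has_ls_integral f (\<lambda>s. \<Sum>r\<in>J i \<inter> {u<..t}. c r * indicator {r..} s) u t (\<Sum>r\<in>J i \<inter> {u<..t}. c r * f r)"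
    using fin by (intro has_ls_integral_sum f has_ls_integral_step) auto
  show "(\<Sum>r\<in>J i \<inter> {u<..t}. c r * indicator {r..} s) = (\<Sum>r\<in>J i \<inter> {u<..s}. c r)" if "s \<in> {u..t}" for s
    using that fin by (intro sum.mono_neutral_cong_right) (auto split: split_indicator)
qed simp

text \<open>The stochastic integral of \<open>v - 1\<close> against the compensated counting paths
  in explicit form: relative jumps minus drift.\<close>

definition driver :: "real \<Rightarrow> real" where
  "driver s = (\<Sum>i\<in>UNIV. (\<Sum>r\<in>J i \<inter> {0<..s}. v i r - 1) - (LBINT r:{0<..s}. v i r - 1))"

lemma v_bounded': obtains K where "0 \<le> K" "\<And>i s. s \<le> t \<Longrightarrow> v i s \<le> K"
proof -
  obtain K where "\<And>i s. s \<le> t \<Longrightarrow> v i s \<le> K" using v_bounded[of t] by blast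
  then show ?thesis using that v_nonneg by (meson order_trans order_refl)
qed

lemma set_integrable_v: "set_integrable lborel {u<..t} (v i)"
proof -
  obtain K where "0 \<le> K" "\<And>i s. s \<le> t \<Longrightarrow> v i s \<le> K" using v_bounded' by blast
  then show ?thesis
    by (intro set_integrable_bounded_interval[of _ _ _ K]) (auto simp: set_borel_measurable_def v_nonneg)
qed

lemma has_ls_integral_driver:
  assumes f: "set_borel_measurable borel {0<..t} f" "\<And>s. s \<in> {0<..t} \<Longrightarrow> \<bar>f s\<bar> \<le> K" and t: "0 \<le> t"
  shows "has_ls_integral f driver 0 t
    (\<Sum>i\<in>UNIV. (\<Sum>r\<in>J i \<inter> {0<..t}. (v i r - 1) * f r) - ((LBINT r:{0<..t}. f r * v i r) - (LBINT r:{0<..t}. f r)))"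
proof (rule has_ls_integral_cong)
  obtain L where L: "0 \<le> L" "\<And>i s. s \<le> t \<Longrightarrow> v i s \<le> L" using v_bounded' by blast
  \<comment> \<open>\<open>v\<close> and the constant 1 are integrated separately: the density in
    \<open>has_ls_integral_absolutely_continuous\<close> must be nonnegative, and
    \<open>v - 1\<close> need not be.\<close>
  have 1: "has_ls_integral f (\<lambda>s. LBINT r:{0<..s}. v i r) 0 t (LBINT r:{0<..t}. f r * v i r)" for i
    using L by (intro has_ls_integral_absolutely_continuous[of _ _ _ _ "max K L"] f t)
      (auto simp: v_nonneg le_max_iff_disj f(2))
  have 2: "has_ls_integral f (\<lambda>s. LBINT r:{0<..s}. 1) 0 t (LBINT r:{0<..t}. f r * 1)"
    by (intro has_ls_integral_absolutely_continuous[of _ _ _ _ "max K 1"] f t)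
      (auto simp: le_max_iff_disj f(2))
  show "has_ls_integral f (\<lambda>s. \<Sum>i\<in>UNIV. (\<Sum>r\<in>J i \<inter> {0<..s}. v i r - 1) - ((LBINT r:{0<..s}. v i r) - (LBINT r:{0<..s}. 1))) 0 t
    (\<Sum>i\<in>UNIV. (\<Sum>r\<in>J i \<inter> {0<..t}. (v i r - 1) * f r) - ((LBINT r:{0<..t}. f r * v i r) - (LBINT r:{0<..t}. f r)))"
    by (intro has_ls_integral_sum f has_ls_integral_diff has_ls_integral_jumps 1 2[simplified mult_1_right]) auto
  fix s assume "s \<in> {0..t}"
  have "(LBINT r:{0<..s}. v i r - 1) = (LBINT r:{0<..s}. v i r) - (LBINT r:{0<..s}. 1)" for i
    using set_integrable_bounded_interval[of 0 s "\<lambda>_. 1" 1]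
    by (intro set_integral_diff set_integrable_v) (auto simp: set_borel_measurable_def)
  then show "(\<Sum>i\<in>UNIV. (\<Sum>r\<in>J i \<inter> {0<..s}. v i r - 1) - ((LBINT r:{0<..s}. v i r) - (LBINT r:{0<..s}. 1))) = driver s"
    by (simp add: driver_def)
qed simp

text \<open>\<open>expo_equation\<close> read as a Stieltjes equation: the terms are regrouped by
  coordinate to match \<open>has_ls_integral_driver\<close>.\<close>

lemma expo_solves:
  assumes t: "0 \<le> t"
  shows "has_ls_integral (left_limit (expo J v)) driver 0 t (expo J v t - 1)"
proof -
  obtain K where K: "\<And>s. s \<in> {0<..t} \<Longrightarrow> \<bar>expo_left J v s\<bar> \<le> K" using expo_left_bounded by blast
  obtain L where L: "0 \<le> L" "\<And>i s. s \<le> t \<Longrightarrow> v i s \<le> L" using v_bounded' by blast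
  have i0: "set_integrable lborel {0<..t} (expo_left J v)"
    by (rule set_integrable_bounded_interval[OF expo_left_measurable K])
  have i1: "set_integrable lborel {0<..t} (\<lambda>r. expo_left J v r * v i r)" for i
  proof (rule set_integrable_bounded_interval)
    show "set_borel_measurable borel {0<..t} (\<lambda>r. expo_left J v r * v i r)"
      using expo_left_measurable[of t] unfolding set_borel_measurable_def by (simp add: mult.assoc[symmetric])
    show "\<bar>expo_left J v r * v i r\<bar> \<le> K * L" if "r \<in> {0<..t}" for r
      unfolding abs_mult using K[OF that] L(2)[of r i] that v_nonneg[of i r]
      by (intro mult_mono) (auto intro: order_trans[OF abs_ge_zero])
  qed
  have "(LBINT s:{0<..t}. expo_left J v s * drift v s) = (LBINT s:{0<..t}. \<Sum>i\<in>UNIV. expo_left J v s * v i s - expo_left J v s)"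
    by (rule set_lebesgue_integral_cong) (auto simp: drift_def sum_distrib_left right_diff_distrib)
  also have "\<dots> = (\<Sum>i\<in>UNIV. (LBINT s:{0<..t}. expo_left J v s * v i s) - (LBINT s:{0<..t}. expo_left J v s))"
    using i0 i1 by (subst set_integral_sum(2)) auto
  finally have "expo J v t - 1 = (\<Sum>i\<in>UNIV. (\<Sum>r\<in>J i \<inter> {0<..t}. (v i r - 1) * expo_left J v r)
      - ((LBINT s:{0<..t}. expo_left J v s * v i s) - (LBINT s:{0<..t}. expo_left J v s)))"
    by (simp add: expo_equation[OF t] sum_subtractf mult.commute)
  then have "has_ls_integral (expo_left J v) driver 0 t (expo J v t - 1)"
    using has_ls_integral_driver[OF expo_left_measurable K t] by simp
  then show ?thesis by (rule has_ls_integral_cong) (auto simp: left_limit_expo)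
qed

end

section \<open>Uniqueness for the linear integral equation\<close>

lemma interval_measure_integral_bound:
  fixes p h :: "real \<Rightarrow> real"
  assumes p: "mono p" "\<And>s. continuous (at_right s) p" and h: "set_borel_measurable borel {u<..t} h"
    and C: "\<And>s. s \<in> {u<..t} \<Longrightarrow> \<bar>h s\<bar> \<le> C" and ut: "u \<le> t"
  shows "set_integrable (interval_measure p) {u<..t} h"
    and "\<bar>LINT s:{u<..t}|interval_measure p. h s\<bar> \<le> C * (p t - p u)"
proof -
  have em: "emeasure (interval_measure p) {u<..t} = ennreal (p t - p u)"
    using p ut by (intro emeasure_interval_measure_Ioc) (auto simp: mono_def)
  have ind: "integrable (interval_measure p) (\<lambda>s. C * indicator {u<..t} s)"
    by (intro integrable_mult_right integrable_real_indicator) (auto simp: em)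
  have le: "norm (indicator {u<..t} s *\<^sub>R h s) \<le> C * indicator {u<..t} s" for s
    using C[of s] by (auto split: split_indicator)
  have int: "integrable (interval_measure p) (\<lambda>s. indicator {u<..t} s *\<^sub>R h s)"
  proof (rule Bochner_Integration.integrable_bound[OF ind])
    show "(\<lambda>s. indicator {u<..t} s *\<^sub>R h s) \<in> borel_measurable (interval_measure p)"
      using h by (simp add: set_borel_measurable_def)
    show "AE s in interval_measure p. norm (indicator {u<..t} s *\<^sub>R h s) \<le> norm (C * indicator {u<..t} s)"
      by (intro AE_I2 order_trans[OF le]) auto
  qed
  then show "set_integrable (interval_measure p) {u<..t} h" by (simp add: set_integrable_def)
  have "norm (LINT s:{u<..t}|interval_measure p. h s) \<le> (LINT s|interval_measure p. norm (indicator {u<..t} s *\<^sub>R h s))"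
    unfolding set_lebesgue_integral_def by (rule integral_norm_bound)
  also have "\<dots> \<le> (LINT s|interval_measure p. C * indicator {u<..t} s)"
    by (rule integral_mono[OF _ ind le]) (use int in simp)
  also have "\<dots> = C * (p t - p u)" using p ut by (simp add: measure_def em mono_def)
  finally show "\<bar>LINT s:{u<..t}|interval_measure p. h s\<bar> \<le> C * (p t - p u)" by simp
qed

lemma cadlag_diff:
  assumes f: "cadlag f" and g: "cadlag g"
  shows "cadlag (\<lambda>t. f t - g t)"
    and "0 < t \<Longrightarrow> left_limit (\<lambda>t. f t - g t) t = left_limit f t - left_limit g t"
proof -
  have l: "((\<lambda>t. f t - g t) \<longlongrightarrow> left_limit f t - left_limit g t) (at_left t)" if "0 < t" for t
    by (intro tendsto_diff left_limit_tendsto f g that)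
  show "cadlag (\<lambda>t. f t - g t)" unfolding cadlag_def
  proof (intro conjI allI impI)
    show "((\<lambda>t. f t - g t) \<longlongrightarrow> f t - g t) (at_right t)" if "0 \<le> t" for t
      using f g that by (intro tendsto_diff) (auto simp: cadlag_def)
    show "\<exists>l. ((\<lambda>t. f t - g t) \<longlongrightarrow> l) (at_left t)" if "0 < t" for t
      using l[OF that] by blast
  qed
  show "left_limit (\<lambda>t. f t - g t) t = left_limit f t - left_limit g t" if "0 < t"
    by (rule left_limit_eqI[OF l[OF that]])
qed

text \<open>Let \<open>\<tau>\<close> be the end of the longest initial interval on which
  \<open>D\<close> vanishes. Left limits vanish up to and including \<open>\<tau>\<close>, so an
  atom of the integrator at \<open>\<tau>\<close> does no harm and \<open>D \<tau> = 0\<close>. To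
  the right of \<open>\<tau>\<close>, right-continuity keeps the joint increase of \<open>p\<close>
  and \<open>n\<close> below 1/2 for a while, and there the supremum \<open>C\<close> of
  \<open>\<bar>D\<bar>\<close> satisfies \<open>C \<le> C / 2\<close>.\<close>

lemma homogeneous_ls_equation:
  fixes D p n :: "real \<Rightarrow> real"
  assumes D: "cadlag D" and p: "mono p" "\<And>s. continuous (at_right s) p" and n: "mono n" "\<And>s. continuous (at_right s) n"
    and eq: "\<And>s. s \<in> {0..T} \<Longrightarrow> D s = (LINT r:{0<..s}|interval_measure p. left_limit D r) - (LINT r:{0<..s}|interval_measure n. left_limit D r)"
    and T: "0 \<le> T"
  shows "D T = 0"
proof -
  have meas: "set_borel_measurable borel {r<..s} (left_limit D)" if "0 \<le> r" for r s
  proof -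
    have "(\<lambda>x. indicator {r<..s} x *\<^sub>R left_limit D x) = (\<lambda>x. indicator {r<..s} x *\<^sub>R (indicator {0<..s} x *\<^sub>R left_limit D x))"
      using that by (auto split: split_indicator)
    then show ?thesis using measurable_left_limit[OF D, of s] unfolding set_borel_measurable_def by simp
  qed
  obtain K where K: "\<And>s. s \<in> {0..T} \<Longrightarrow> \<bar>D s\<bar> \<le> K" using cadlag_bounded[OF D] by blast
  have KL: "\<bar>left_limit D s\<bar> \<le> K" if "s \<in> {0<..T}" for s by (rule left_limit_bounded[OF D K that])
  have est: "\<bar>D s - D r\<bar> \<le> C * ((p s - p r) + (n s - n r))"
    if rs: "0 \<le> r" "r \<le> s" "s \<le> T" and C: "\<And>x. x \<in> {r<..s} \<Longrightarrow> \<bar>left_limit D x\<bar> \<le> C" for r s C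
  proof -
    have split: "(LINT x:{0<..s}|interval_measure q. left_limit D x) = (LINT x:{0<..r}|interval_measure q. left_limit D x) + (LINT x:{r<..s}|interval_measure q. left_limit D x)"
      if q: "mono q" "\<And>s. continuous (at_right s) q" for q
    proof -
      have *: "{0<..s} = {0<..r} \<union> {r<..s}" using rs by auto
      have "set_integrable (interval_measure q) {0<..s} (left_limit D)"
        by (rule interval_measure_integral_bound(1)[OF q meas KL]) (use rs in auto)
      then show ?thesis unfolding * by (intro set_integral_Un) (auto intro: set_integrable_subset)
    qed
    have "D s - D r = (LINT x:{r<..s}|interval_measure p. left_limit D x) - (LINT x:{r<..s}|interval_measure n. left_limit D x)"
      using eq[of s] eq[of r] split[OF p] split[OF n] rs by simp
    moreover have "\<bar>LINT x:{r<..s}|interval_measure p. left_limit D x\<bar> \<le> C * (p s - p r)"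
      by (rule interval_measure_integral_bound(2)[OF p meas[OF rs(1)] C rs(2)])
    moreover have "\<bar>LINT x:{r<..s}|interval_measure n. left_limit D x\<bar> \<le> C * (n s - n r)"
      by (rule interval_measure_integral_bound(2)[OF n meas[OF rs(1)] C rs(2)])
    ultimately show ?thesis by (simp add: distrib_left)
  qed
  have D0: "D 0 = 0" using eq[of 0] T by (simp add: set_lebesgue_integral_def)
  define S where "S = {s \<in> {0..T}. \<forall>x\<in>{0..s}. D x = 0}"
  define \<tau> where "\<tau> = Sup S"
  have S0: "0 \<in> S" using D0 T by (simp add: S_def)
  have bdd: "bdd_above S" unfolding S_def by (rule bdd_aboveI[of _ T]) auto
  have \<tau>: "0 \<le> \<tau>" "\<tau> \<le> T" unfolding \<tau>_def
    by (rule cSup_upper[OF S0 bdd]) (rule cSup_least; use S0 in \<open>auto simp: S_def\<close>)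
  have below: "D x = 0" if "0 \<le> x" "x < \<tau>" for x
  proof -
    have "\<exists>s\<in>S. x < s" using less_cSup_iff[of S x] S0 bdd that(2) unfolding \<tau>_def by blast
    then obtain s where "s \<in> S" "x < s" by blast
    then show ?thesis using that by (auto simp: S_def)
  qed
  have ll: "left_limit D x = 0" if "x \<in> {0<..\<tau>}" for x
  proof (rule left_limit_eqI, rule tendsto_eventually)
    show "\<forall>\<^sub>F y in at_left x. D y = 0"
      unfolding eventually_at_left_field using below that by (intro exI[of _ 0]) auto
  qed
  have D\<tau>: "D \<tau> = 0"
    using est[of 0 \<tau> 0] ll \<tau> D0 by auto
  have "\<tau> = T"
  proof (rule ccontr)
    assume "\<tau> \<noteq> T"
    then have lt: "\<tau> < T" using \<tau> by simp
    have "((\<lambda>s. (p s - p \<tau>) + (n s - n \<tau>)) \<longlongrightarrow> (p \<tau> - p \<tau>) + (n \<tau> - n \<tau>)) (at_right \<tau>)"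
      using p(2)[of \<tau>] n(2)[of \<tau>] unfolding continuous_within by (intro tendsto_intros)
    then have "\<forall>\<^sub>F s in at_right \<tau>. (p s - p \<tau>) + (n s - n \<tau>) < 1 / 2"
      by (rule order_tendstoD) simp
    then obtain b where b: "\<tau> < b" "\<And>s. \<tau> < s \<Longrightarrow> s < b \<Longrightarrow> (p s - p \<tau>) + (n s - n \<tau>) < 1 / 2"
      unfolding eventually_at_right_field by blast
    define s0 where "s0 = min T ((\<tau> + b) / 2)"
    have s0: "\<tau> < s0" "s0 \<le> T" "s0 < b" using lt b(1) unfolding s0_def by (auto simp: min_less_iff_disj)
    define C where "C = (SUP x\<in>{0..s0}. \<bar>D x\<bar>)"
    have bdC: "bdd_above ((\<lambda>x. \<bar>D x\<bar>) ` {0..s0})"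
      by (rule bdd_aboveI[of _ K]) (use K s0 in auto)
    have C: "\<bar>D x\<bar> \<le> C" if "x \<in> {0..s0}" for x unfolding C_def by (rule cSUP_upper[OF that bdC])
    have C0: "0 \<le> C" using C[of 0] s0 \<tau> by (auto intro: order_trans[OF abs_ge_zero])
    have half: "\<bar>D x\<bar> \<le> C * (1 / 2)" if x: "x \<in> {0..s0}" for x
    proof (cases "x \<le> \<tau>")
      case True
      then have "D x = 0" using below[of x] D\<tau> x by (cases "x = \<tau>") auto
      then show ?thesis using C0 by simp
    next
      case False
      have "\<bar>D x - D \<tau>\<bar> \<le> C * ((p x - p \<tau>) + (n x - n \<tau>))"
      proof (rule est)
        show "\<bar>left_limit D y\<bar> \<le> C" if "y \<in> {\<tau><..x}" for y
          by (rule left_limit_bounded[OF D, of s0]) (use C that \<tau> x in auto)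
      qed (use False x s0 \<tau> in auto)
      also have "\<dots> \<le> C * (1 / 2)"
        using b(2)[of x] False x s0 C0 by (intro mult_left_mono) auto
      finally show ?thesis using D\<tau> by simp
    qed
    have "C \<le> C * (1 / 2)" unfolding C_def[symmetric]
      by (subst C_def, rule cSUP_least) (use half s0 \<tau> in auto)
    then have "C = 0" using C0 by simp
    then have "s0 \<in> S" using C s0 \<tau> by (auto simp: S_def)
    then have "s0 \<le> \<tau>" unfolding \<tau>_def by (rule cSup_upper[OF _ bdd])
    then show False using s0 by simp
  qed
  then show ?thesis using D\<tau> by simp
qed

text \<open>A Gronwall argument; \<open>X\<close> need not be continuous because only \<open>Z\<^sub>-\<close> enters the integral.\<close>

lemma ls_equation_unique:
  assumes f: "cadlag f" and g: "cadlag g"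
    and F: "\<And>t. 0 \<le> t \<Longrightarrow> has_ls_integral (left_limit f) X 0 t (f t - 1)"
    and G: "\<And>t. 0 \<le> t \<Longrightarrow> has_ls_integral (left_limit g) X 0 t (g t - 1)"
    and T: "0 \<le> T"
  shows "f T = g T"
proof -
  \<comment> \<open>One decomposition of \<open>X\<close> on \<open>[0, T]\<close> serves both
    solutions at all times up to \<open>T\<close>; \<open>has_ls_integral_unique\<close> permits the
    change from whichever decomposition each equation supplied.\<close>
  obtain p n where pn: "mono p" "mono n" "\<And>s. continuous (at_right s) p" "\<And>s. continuous (at_right s) n"
      "\<And>s. s \<in> {0..T} \<Longrightarrow> X s = p s - n s"
    using F[OF T] unfolding has_ls_integral_def by auto
  let ?p = "interval_measure p" and ?n = "interval_measure n"
  have int: "set_integrable (interval_measure q) {0<..s} (left_limit h)"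
    if h: "cadlag h" "0 \<le> s" and q: "mono q" "\<And>s. continuous (at_right s) q" for h s q
  proof -
    obtain K where K: "\<And>x. x \<in> {0..s} \<Longrightarrow> \<bar>h x\<bar> \<le> K" using cadlag_bounded[OF h(1)] by blast
    show ?thesis
      by (rule interval_measure_integral_bound(1)[OF q measurable_left_limit[OF h(1)]
          left_limit_bounded[OF h(1) K] h(2)])
  qed
  have sol: "h s - 1 = (LINT r:{0<..s}|?p. left_limit h r) - (LINT r:{0<..s}|?n. left_limit h r)"
    if h: "cadlag h" "\<And>t. 0 \<le> t \<Longrightarrow> has_ls_integral (left_limit h) X 0 t (h t - 1)" and s: "s \<in> {0..T}" for h s
  proof (rule has_ls_integral_unique[OF h(2)])
    show "has_ls_integral (left_limit h) X 0 s ((LINT r:{0<..s}|?p. left_limit h r) - (LINT r:{0<..s}|?n. left_limit h r))"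
      unfolding has_ls_integral_def
      by (rule exI[of _ p], rule exI[of _ n]) (use pn s int[OF h(1)] in auto)
  qed (use s in auto)
  have "f T - g T = 0"
  proof (rule homogeneous_ls_equation[OF cadlag_diff(1)[OF f g] pn(1,3) pn(2,4) _ T])
    fix s assume s: "s \<in> {0..T}"
    have *: "(LINT r:{0<..s}|interval_measure q. left_limit (\<lambda>t. f t - g t) r)
      = (LINT r:{0<..s}|interval_measure q. left_limit f r) - (LINT r:{0<..s}|interval_measure q. left_limit g r)"
      if q: "mono q" "\<And>s. continuous (at_right s) q" for q
    proof -
      have "(LINT r:{0<..s}|interval_measure q. left_limit (\<lambda>t. f t - g t) r)
        = (LINT r:{0<..s}|interval_measure q. left_limit f r - left_limit g r)"
        by (rule set_lebesgue_integral_cong) (auto simp: cadlag_diff(2)[OF f g])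
      also have "\<dots> = (LINT r:{0<..s}|interval_measure q. left_limit f r) - (LINT r:{0<..s}|interval_measure q. left_limit g r)"
        by (rule set_integral_diff) (use int[OF f _ q] int[OF g _ q] s in auto)
      finally show ?thesis .
    qed
    show "f s - g s = (LINT r:{0<..s}|?p. left_limit (\<lambda>t. f t - g t) r) - (LINT r:{0<..s}|?n. left_limit (\<lambda>t. f t - g t) r)"
      using sol[OF f F s] sol[OF g G s] by (simp add: *[OF pn(1,3)] *[OF pn(2,4)])
  qed
  then show ?thesis by simp
qed

section \<open>Predictable processes\<close>

context filtered_prob_space_usual
begin

abbreviation P :: "(real \<times> 'a) measure" where "P \<equiv> predictable_sigma M F"

lemma space_F: "0 \<le> t \<Longrightarrow> space (F t) = space M"
  using subalg unfolding subalgebra_def by auto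

lemma sets_F: "0 \<le> t \<Longrightarrow> A \<in> sets (F t) \<Longrightarrow> A \<in> sets M"
  using subalg unfolding subalgebra_def by auto

lemma sets_F_mono: "0 \<le> s \<Longrightarrow> s \<le> t \<Longrightarrow> A \<in> sets (F s) \<Longrightarrow> A \<in> sets (F t)"
  using filtration_mono by auto

lemma measurable_F_mono:
  assumes s: "0 \<le> s" "s \<le> t" and f: "f \<in> measurable (F s) N"
  shows "f \<in> measurable (F t) N"
proof (rule measurableI)
  have sp: "space (F t) = space (F s)" using s space_F by simp
  show "f x \<in> space N" if "x \<in> space (F t)" for x using measurable_space[OF f] that sp by simp
  show "f -` A \<inter> space (F t) \<in> sets (F t)" if "A \<in> sets N" for A
    unfolding sp by (rule sets_F_mono[OF s measurable_sets[OF f that]])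
qed

lemma measurable_F_M:
  assumes "0 \<le> s" "f \<in> measurable (F s) N"
  shows "f \<in> measurable M N"
  by (rule measurable_from_subalg[OF subalg]) (use assms in auto)

definition pgen :: "(real \<times> 'a) set set" where
  "pgen = {{0} \<times> A | A. A \<in> sets (F 0)} \<union> {{s<..t} \<times> A | s t A. 0 \<le> s \<and> s \<le> t \<and> A \<in> sets (F s)}"

lemma pgen_subset: "pgen \<subseteq> Pow ({0..} \<times> space M)"
proof -
  have "A \<subseteq> space M" if "0 \<le> s" "A \<in> sets (F s)" for s A
    using sets.sets_into_space[OF that(2)] space_F[OF that(1)] by simp
  then show ?thesis unfolding pgen_def by auto
qed

lemma space_P: "space P = {0..} \<times> space M"
  unfolding predictable_sigma_def by (rule space_measure_of[OF pgen_subset[unfolded pgen_def]])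

lemma sets_P: "sets P = sigma_sets ({0..} \<times> space M) pgen"
  unfolding predictable_sigma_def pgen_def by (rule sets_measure_of[OF pgen_subset[unfolded pgen_def]])

lemma pgen_sets: "A \<in> pgen \<Longrightarrow> A \<in> sets P"
  unfolding sets_P by (rule sigma_sets.Basic)

lemma predictable_Ioc: "0 \<le> s \<Longrightarrow> A \<in> sets (F s) \<Longrightarrow> {s<..t} \<times> A \<in> sets P"
proof (cases "s \<le> t")
  assume "0 \<le> s" "A \<in> sets (F s)" "s \<le> t"
  then show ?thesis by (intro pgen_sets) (auto simp: pgen_def)
qed simp

lemma predictable_Ioi:
  assumes "0 \<le> s" "A \<in> sets (F s)"
  shows "{s<..} \<times> A \<in> sets P"
proof -
  have "{s<..} \<times> A = (\<Union>n::nat. {s<..real n} \<times> A)"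
    using real_arch_simple by auto blast
  then show ?thesis using predictable_Ioc[OF assms] by (simp only:) (rule sets.countable_UN, auto)
qed

lemma predictable_zero: "A \<in> sets (F 0) \<Longrightarrow> {0} \<times> A \<in> sets P"
  by (intro pgen_sets) (auto simp: pgen_def)

lemma pgen_Int_stable: "Int_stable pgen"
proof (rule Int_stableI)
  fix a b assume "a \<in> pgen" "b \<in> pgen"
  then consider (1) A B where "a = {0} \<times> A" "b = {0} \<times> B" "A \<in> sets (F 0)" "B \<in> sets (F 0)"
    | (2) A B s t where "a = {0} \<times> A" "b = {s<..t} \<times> B" "0 \<le> s"
    | (3) A B s t where "b = {0} \<times> A" "a = {s<..t} \<times> B" "0 \<le> s"
    | (4) A B s t s' t' where "a = {s<..t} \<times> A" "b = {s'<..t'} \<times> B" "0 \<le> s" "0 \<le> s'" "A \<in> sets (F s)" "B \<in> sets (F s')" "s \<le> t" "s' \<le> t'"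
    unfolding pgen_def by blast
  then show "a \<inter> b \<in> pgen"
  proof cases
    case 1
    then show ?thesis unfolding pgen_def by (auto simp: Times_Int_Times)
  next
    case 2
    \<comment> \<open>The empty set belongs to the generator in this guise.\<close>
    then have "a \<inter> b = {0} \<times> {}" by auto
    then show ?thesis unfolding pgen_def by blast
  next
    case 3
    then have "a \<inter> b = {0} \<times> {}" by auto
    then show ?thesis unfolding pgen_def by blast
  next
    case 4
    show ?thesis
    proof (cases "max s s' \<le> min t t'")
      case True
      have "a \<inter> b = {max s s'<..min t t'} \<times> (A \<inter> B)" using 4 by auto
      moreover have "A \<inter> B \<in> sets (F (max s s'))"
        using 4 by (intro sets.Int sets_F_mono[of s "max s s'"] sets_F_mono[of s' "max s s'"]) auto
      moreover have "0 \<le> max s s'" using 4 by simp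
      ultimately show ?thesis using True unfolding pgen_def by blast
    next
      case False
      then have "a \<inter> b = {0} \<times> {}" using 4 by auto
      then show ?thesis unfolding pgen_def by blast
    qed
  qed
qed

lemma measurable_section:
  assumes "\<omega> \<in> space M"
  shows "(\<lambda>s. (s, \<omega>)) \<in> measurable (restrict_space borel {0..}) P"
  unfolding predictable_sigma_def
proof (rule measurable_measure_of)
  show "(\<lambda>s. (s, \<omega>)) \<in> space (restrict_space borel {0..}) \<rightarrow> {0..} \<times> space M"
    using assms by (auto simp: space_restrict_space)
  fix B assume "B \<in> {{0} \<times> A |A. A \<in> sets (F 0)} \<union> {{s<..t} \<times> A |s t A. 0 \<le> s \<and> s \<le> t \<and> A \<in> sets (F s)}"
  then obtain S A where B: "B = S \<times> A" "S \<in> sets borel" by auto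
  have "(\<lambda>s. (s, \<omega>)) -` B \<inter> space (restrict_space borel {0..}) = (if \<omega> \<in> A then S else {}) \<inter> {0..}"
    by (auto simp: B space_restrict_space)
  then show "(\<lambda>s. (s, \<omega>)) -` B \<inter> space (restrict_space borel {0..}) \<in> sets (restrict_space borel {0..})"
    using B(2) by (auto simp: sets_restrict_space)
qed (use pgen_subset in \<open>auto simp: pgen_def\<close>)

lemma measurable_section':
  assumes "\<omega> \<in> space M" "h \<in> measurable P N"
  shows "(\<lambda>s. h (s, \<omega>)) \<in> measurable (restrict_space borel {0..}) N"
  using measurable_compose[OF measurable_section[OF assms(1)] assms(2)] by simp

lemma predictable_time[measurable]: "fst \<in> borel_measurable P"
proof (rule borel_measurableI_le)
  fix a :: real
  have "{w \<in> space P. fst w \<le> a} = (if a < 0 then {} else ({0} \<times> space M) \<union> ({0<..a} \<times> space M))"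
    by (auto simp: space_P)
  moreover have "{0} \<times> space M \<in> sets P" "{0<..a} \<times> space M \<in> sets P"
    using sets.top[of "F 0"] space_F[of 0] by (auto intro!: predictable_zero predictable_Ioc)
  ultimately show "{w \<in> space P. fst w \<le> a} \<in> sets P" by (simp only: split: if_split) auto
qed

lemma predictable_after:
  assumes "0 \<le> u" "A \<in> sets (F u)"
  shows "(\<lambda>w. u < fst w \<and> snd w \<in> A) \<in> measurable P (count_space UNIV)"
proof -
  have "{w \<in> space P. u < fst w \<and> snd w \<in> A} = {u<..} \<times> A"
    using sets.sets_into_space[OF assms(2)] space_F[OF assms(1)] assms(1) by (auto simp: space_P)
  then show ?thesis using predictable_Ioi[OF assms] by (simp add: pred_def[symmetric] pred_sets2 measurable_count_space_eq2 pred_def)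
qed

text \<open>The stochastic interval \<open>(0, S]\<close>. Its complement within positive times is a
  countable union of rectangles \<open>(q, \<infinity>) \<times> {S \<le> q}\<close> over rational
  \<open>q\<close>, each predictable because \<open>S \<le> q\<close> is decided at time
  \<open>q\<close>.\<close>

lemma predictable_stopping:
  assumes S: "ext_stopping_time M F S"
  shows "(\<lambda>w. 0 < fst w \<and> ennreal (fst w) \<le> S (snd w)) \<in> measurable P (count_space UNIV)"
proof -
  have "{w \<in> space P. 0 < fst w \<and> \<not> ennreal (fst w) \<le> S (snd w)}
    = (\<Union>q\<in>\<rat> \<inter> {0..}. {q<..} \<times> {\<omega> \<in> space M. S \<omega> \<le> ennreal q})" (is "?L = ?R")
  proof (intro set_eqI iffI)
    fix w assume "w \<in> ?L"
    then have w: "snd w \<in> space M" "0 < fst w" "S (snd w) < ennreal (fst w)" by (auto simp: space_P not_le)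
    then obtain x where x: "S (snd w) = ennreal x" "0 \<le> x" by (cases "S (snd w)") (auto simp: top_unique)
    then have "x < fst w" using w(3) by (simp add: ennreal_less_iff)
    then obtain q where "q \<in> \<rat>" "x < q" "q < fst w" using Rats_dense_in_real by blast
    then show "w \<in> ?R" using x w by (intro UN_I[of q]) (auto simp: mem_Times_iff intro!: ennreal_leI)
  next
    fix w assume "w \<in> ?R"
    then obtain q where q: "0 \<le> q" "q < fst w" "snd w \<in> space M" "S (snd w) \<le> ennreal q" by auto
    have "ennreal q < ennreal (fst w)" using q by (simp add: ennreal_less_iff)
    then have "S (snd w) < ennreal (fst w)" by (rule le_less_trans[OF q(4)])
    then show "w \<in> ?L" using q by (auto simp: space_P not_le mem_Times_iff)
  qed
  moreover have "?R \<in> sets P"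
  proof (rule sets.countable_UN'')
    show "countable (\<rat> \<inter> {0..} :: real set)" by (intro countable_Int1 countable_rat)
    show "{q<..} \<times> {\<omega> \<in> space M. S \<omega> \<le> ennreal q} \<in> sets P" if "q \<in> \<rat> \<inter> {0..}" for q
      using S that unfolding ext_stopping_time_def by (intro predictable_Ioi) auto
  qed
  ultimately have [measurable]: "(\<lambda>w. 0 < fst w \<and> \<not> ennreal (fst w) \<le> S (snd w)) \<in> measurable P (count_space UNIV)"
    by (simp add: pred_def)
  have "(\<lambda>w. 0 < fst w \<and> \<not> (0 < fst w \<and> \<not> ennreal (fst w) \<le> S (snd w))) \<in> measurable P (count_space UNIV)"
    by measurable
  also have "(\<lambda>w. 0 < fst w \<and> \<not> (0 < fst w \<and> \<not> ennreal (fst w) \<le> S (snd w)))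
    = (\<lambda>w. 0 < fst w \<and> ennreal (fst w) \<le> S (snd w))" by (intro ext) blast
  finally show ?thesis .
qed

text \<open>Evaluating at the grid point \<open>left_point n t\<close>, strictly before \<open>t\<close>, makes an adapted process predictable.\<close>

lemma predictable_left_limit:
  assumes Z: "adapted F Z" "\<And>\<omega>. \<omega> \<in> space M \<Longrightarrow> cadlag (\<lambda>t. Z t \<omega>)"
  shows "(\<lambda>w. if 0 < fst w then left_limit (\<lambda>t. Z t (snd w)) (fst w) else c) \<in> borel_measurable P"
proof (rule borel_measurable_LIMSEQ_real)
  fix w assume w: "w \<in> space P"
  show "(\<lambda>n. if 0 < fst w then Z (left_point n (fst w)) (snd w) else c)
    \<longlonglongrightarrow> (if 0 < fst w then left_limit (\<lambda>t. Z t (snd w)) (fst w) else c)"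
    using left_limit_left_point[OF Z(2), of "snd w" "fst w"] w by (auto simp: space_P)
next
  fix n
  let ?f = "\<lambda>w. if 0 < fst w then Z (left_point n (fst w)) (snd w) else c"
  let ?k = "\<lambda>k::nat. real k / real (Suc n)"
  show "?f \<in> borel_measurable P"
  proof (rule measurableI)
    fix B :: "real set" assume B: "B \<in> sets borel"
    let ?A = "\<lambda>k. {\<omega> \<in> space M. Z (?k k) \<omega> \<in> B}"
    have A: "?A k \<in> sets (F (?k k))" for k
    proof -
      have "Z (?k k) \<in> borel_measurable (F (?k k))" using Z(1) by (simp add: adapted_def)
      from measurable_sets[OF this B] show ?thesis using space_F[of "?k k"] by (simp add: vimage_def Int_def conj_commute)
    qed
    \<comment> \<open>This makes the preimage a countable union of rectangles over
      \<open>(k / (n + 1), (k + 1) / (n + 1)]\<close>, whose base sets belong to the sigma-algebra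
      of the left endpoint.\<close>
    have lp: "left_point n t = ?k k \<longleftrightarrow> ?k k < t \<and> t \<le> ?k (Suc k)" for t k
    proof -
      have "left_point n t = ?k k \<longleftrightarrow> real_of_int \<lceil>t * real (Suc n)\<rceil> = real k + 1"
        by (simp add: left_point_def eq_divide_eq divide_eq_eq) linarith
      also have "\<dots> \<longleftrightarrow> \<lceil>t * real (Suc n)\<rceil> = int k + 1" by linarith
      also have "\<dots> \<longleftrightarrow> real k < t * real (Suc n) \<and> t * real (Suc n) \<le> real k + 1"
        by (simp add: ceiling_eq_iff)
      also have "\<dots> \<longleftrightarrow> ?k k < t \<and> t \<le> ?k (Suc k)" by (simp add: field_simps)
      finally show ?thesis .
    qed
    have ex: "\<exists>k. left_point n t = ?k k" if "0 < t" for t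
    proof -
      have "0 < t * real (Suc n)" using that by simp
      then have "1 \<le> \<lceil>t * real (Suc n)\<rceil>" by linarith
      then have "left_point n t = ?k (nat (\<lceil>t * real (Suc n)\<rceil> - 1))" by (simp add: left_point_def of_nat_nat)
      then show ?thesis by blast
    qed
    have "?f -` B \<inter> space P = (\<Union>k. {?k k<..?k (Suc k)} \<times> ?A k) \<union> (if c \<in> B then {0} \<times> space M else {})" (is "?L = ?R")
    proof (intro set_eqI iffI)
      fix w assume w: "w \<in> ?L"
      show "w \<in> ?R"
      proof (cases "0 < fst w")
        case True
        then obtain k where k: "left_point n (fst w) = ?k k" using ex by blast
        then have "w \<in> {?k k<..?k (Suc k)} \<times> ?A k" using lp[of "fst w" k] w True by (auto simp: space_P mem_Times_iff)
        then show ?thesis by blast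
      next
        case False
        then show ?thesis using w by (auto simp: space_P mem_Times_iff)
      qed
    next
      fix w assume w: "w \<in> ?R"
      then consider k where "w \<in> {?k k<..?k (Suc k)} \<times> ?A k" | "c \<in> B" "w \<in> {0} \<times> space M" by (auto split: if_splits)
      then show "w \<in> ?L"
      proof cases
        case 1
        then have "left_point n (fst w) = ?k k" using lp[of "fst w" k] by auto
        moreover have "0 < fst w" using 1 by (auto intro: le_less_trans[rotated])
        ultimately show ?thesis using 1 by (auto simp: space_P mem_Times_iff)
      qed (auto simp: space_P)
    qed
    moreover have "(\<Union>k. {?k k<..?k (Suc k)} \<times> ?A k) \<in> sets P"
    proof (rule sets.countable_UN'')
      show "{?k k<..?k (Suc k)} \<times> ?A k \<in> sets P" for k by (rule predictable_Ioc[OF _ A]) simp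
    qed simp
    moreover have "{0} \<times> space M \<in> sets P" using sets.top[of "F 0"] space_F[of 0] by (auto intro!: predictable_zero)
    ultimately show "?f -` B \<inter> space P \<in> sets P" by auto
  qed simp
qed

end

section \<open>The compensation formula\<close>

lemma measurable_congI:
  "f \<in> measurable A B \<Longrightarrow> (\<And>x. x \<in> space A \<Longrightarrow> f x = g x) \<Longrightarrow> g \<in> measurable A B"
  using measurable_cong[of A f g B] by blast

locale unit_intensity = filtered_prob_space_usual M F for M :: "'a measure" and F +
  fixes N :: "'d::finite \<Rightarrow> real \<Rightarrow> 'a \<Rightarrow> real"
  assumes counting: "counting_process M N"
    and intensity: "has_intensity M F N (\<lambda>i t \<omega>. 1)"
begin

definition J :: "'d \<Rightarrow> 'a \<Rightarrow> real set" where
  "J i \<omega> = jump_times (\<lambda>s. N i s \<omega>)"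

lemma J_finite: "\<omega> \<in> space M \<Longrightarrow> finite (J i \<omega> \<inter> {..t})"
  using counting unfolding J_def counting_process_def by (intro finite_jump_times) auto

lemma J_finite_Ioc: "\<omega> \<in> space M \<Longrightarrow> finite (J i \<omega> \<inter> {s<..t})"
  by (rule finite_subset[OF _ J_finite[of \<omega> i t]]) auto

lemma J_disjoint: "\<omega> \<in> space M \<Longrightarrow> i \<noteq> j \<Longrightarrow> J i \<omega> \<inter> J j \<omega> = {}"
  using counting unfolding J_def counting_process_def jump_times_def by fastforce

lemma N_increment:
  assumes "\<omega> \<in> space M" "0 \<le> s" "s \<le> t"
  shows "N i t \<omega> - N i s \<omega> = real (card (J i \<omega> \<inter> {s<..t}))"
  unfolding J_def
  by (rule counting_path_increment) (use counting assms in \<open>auto simp: counting_process_def\<close>)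

lemma LBINT_1: "0 \<le> t \<Longrightarrow> (LBINT s:{0..t::real}. 1) = t"
  using set_integral_const[of "{0..t}" lborel "1::real"] emeasure_lborel_Icc[of 0 t] by simp

lemma N_adapted: "0 \<le> t \<Longrightarrow> N i t \<in> borel_measurable (F t)"
proof -
  assume t: "0 \<le> t"
  have "local_martingale M F (\<lambda>t \<omega>. N i t \<omega> - (LBINT s:{0..t}. 1))"
    using intensity unfolding has_intensity_def by auto
  then have "(\<lambda>\<omega>. N i t \<omega> - (LBINT s:{0..t}. 1)) \<in> borel_measurable (F t)"
    using t unfolding local_martingale_def adapted_def by auto
  then have "(\<lambda>\<omega>. (N i t \<omega> - (LBINT s:{0..t}. 1)) + (LBINT s:{0..t}. 1)) \<in> borel_measurable (F t)"
    by (intro borel_measurable_add) auto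
  then show ?thesis by simp
qed

lemma measurable_ext_stopping_time:
  assumes "ext_stopping_time M F T"
  shows "T \<in> borel_measurable M"
proof (rule borel_measurableI_le)
  fix a :: ennreal
  show "{\<omega> \<in> space M. T \<omega> \<le> a} \<in> sets M"
  proof (cases a)
    case (real r)
    then have "{\<omega> \<in> space M. T \<omega> \<le> a} \<in> sets (F r)"
      using assms unfolding ext_stopping_time_def by simp
    then show ?thesis by (rule sets_F[OF real(1)])
  qed simp
qed

text \<open>The null set does not depend on \<open>t\<close>: divergence to infinity covers all
  times at once.\<close>

lemma localising_eventually:
  assumes "localising M F T"
  shows "AE \<omega> in M. \<forall>t. \<forall>\<^sub>F n in sequentially. ennreal t < T n \<omega>"
proof -
  have "AE \<omega> in M. (\<lambda>n. T n \<omega>) \<longlonglongrightarrow> \<infinity>" using assms unfolding localising_def by auto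
  then show ?thesis by eventually_elim (auto intro: order_tendstoD)
qed

text \<open>The compensated process is only a local martingale, so the identity first holds for
  times stopped at \<open>T n\<close>. The stopped increments of \<open>N\<close> converge to the
  full increment and lie below it. Fatou's lemma bounds the expectation of the full increment by
  \<open>t - s\<close>; being integrable, it then dominates the stopped ones, and the limit gives
  equality.\<close>

lemma N_expected_increment:
  assumes s: "0 \<le> s" "s \<le> t" and A: "A \<in> sets (F s)"
  shows "(\<integral>\<^sup>+\<omega>. indicator A \<omega> * ennreal (N i t \<omega> - N i s \<omega>) \<partial>M) = ennreal (t - s) * emeasure M A"
proof -
  define X where "X = (\<lambda>t \<omega>. N i t \<omega> - t)"
  have t: "0 \<le> t" using s by simp
  have AM[measurable]: "A \<in> sets M" using sets_F[OF s(1) A] .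
  have "local_martingale M F (\<lambda>t \<omega>. N i t \<omega> - (LBINT s:{0..t}. 1))"
    using intensity unfolding has_intensity_def by auto
  then obtain T where T: "localising M F T"
    and mart: "\<And>n. martingale M F (stopped (\<lambda>t \<omega>. N i t \<omega> - (LBINT s:{0..t}. 1)) (T n))"
    unfolding local_martingale_def by auto
  have st: "stopped (\<lambda>t \<omega>. N i t \<omega> - (LBINT s:{0..t}. 1)) (T n) r = stopped X (T n) r" if "0 \<le> r" for n r
    using that by (auto simp: stopped_def X_def fun_eq_iff LBINT_1)
  \<comment> \<open>The time \<open>r\<close> stopped at \<open>T n\<close>, as in the definition of
    \<open>stopped\<close>; \<open>cc\<close> below records its two shapes, \<open>r\<close> itself
    or \<open>min r x\<close>.\<close>
  define c where "c = (\<lambda>n r \<omega>. if ennreal r \<le> T n \<omega> then r else enn2real (T n \<omega>))"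
  have [measurable]: "T n \<in> borel_measurable M" for n
    using T unfolding localising_def by (intro measurable_ext_stopping_time) auto
  have cm[measurable]: "c n r \<in> borel_measurable M" for n r unfolding c_def by measurable
  have cc: "(\<forall>r\<ge>0. c n r \<omega> = r) \<or> (\<exists>x\<ge>0. \<forall>r\<ge>0. c n r \<omega> = min r x)" for n \<omega>
  proof (cases "T n \<omega>")
    case (real x)
    then have "c n r \<omega> = min r x" if "0 \<le> r" for r
      using that by (simp add: c_def ennreal_le_iff min_def)
    then show ?thesis using real(1) by blast
  qed (simp add: c_def)
  have c0: "0 \<le> c n r \<omega>" "c n r \<omega> \<le> r" if "0 \<le> r" for n r \<omega>
    using cc[of n \<omega>] that by auto
  have cst: "c n s \<omega> \<le> c n t \<omega>" "c n t \<omega> - c n s \<omega> \<le> t - s" for n \<omega>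
    using cc[of n \<omega>] s t by (auto simp: min_def)
  define Y where "Y = (\<lambda>n \<omega>. (N i (c n t \<omega>) \<omega> - N i (c n s \<omega>) \<omega>) - (c n t \<omega> - c n s \<omega>))"
  \<comment> \<open>On \<open>T n = 0\<close> the stopped process is set to 0; both stopped times
    are 0 there, so \<open>Y n\<close> vanishes as well.\<close>
  have Y: "Y n \<omega> = stopped X (T n) t \<omega> - stopped X (T n) s \<omega>" for n \<omega>
    using s t by (auto simp: Y_def stopped_def X_def c_def)
  have intX: "integrable M (stopped X (T n) r)" if "0 \<le> r" for n r
  proof -
    have "integrable M (stopped (\<lambda>t \<omega>. N i t \<omega> - (LBINT s:{0..t}. 1)) (T n) r)"
      using mart[of n] that unfolding martingale_def by blast
    then show ?thesis by (simp only: st[OF that])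
  qed
  have intY: "integrable M (Y n)" for n
    unfolding Y[abs_def] using intX t s by auto
  interpret Fs: finite_measure_subalgebra M "F s" by unfold_locales (use subalg s in auto)
  have EY: "(LINT \<omega>|M. indicator A \<omega> * Y n \<omega>) = 0" for n
  proof -
    have ae: "AE \<omega> in M. real_cond_exp M (F s) (stopped X (T n) t) \<omega> = stopped X (T n) s \<omega>"
    proof -
      have "AE \<omega> in M. real_cond_exp M (F s) (stopped (\<lambda>t \<omega>. N i t \<omega> - (LBINT s:{0..t}. 1)) (T n) t) \<omega>
          = stopped (\<lambda>t \<omega>. N i t \<omega> - (LBINT s:{0..t}. 1)) (T n) s \<omega>"
        using mart[of n] s unfolding martingale_def by blast
      then show ?thesis by (simp only: st[OF t] st[OF s(1)])
    qed
    have "(LINT \<omega>:A|M. stopped X (T n) t \<omega>) = (LINT \<omega>:A|M. real_cond_exp M (F s) (stopped X (T n) t) \<omega>)"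
      by (rule Fs.real_cond_exp_intA[OF intX[OF t] A])
    also have "\<dots> = (LINT \<omega>:A|M. stopped X (T n) s \<omega>)"
      using ae intX[OF s(1)] by (intro set_lebesgue_integral_cong_AE) auto
    finally have "(LINT \<omega>:A|M. stopped X (T n) t \<omega>) - (LINT \<omega>:A|M. stopped X (T n) s \<omega>) = 0" by simp
    moreover have "set_integrable M A (stopped X (T n) r)" if "0 \<le> r" for r
      unfolding set_integrable_def using intX[OF that] by (intro integrable_mult_indicator) auto
    ultimately have "(LINT \<omega>:A|M. stopped X (T n) t \<omega> - stopped X (T n) s \<omega>) = 0"
      using s t by (subst set_integral_diff(2)) auto
    then show ?thesis by (simp add: Y set_lebesgue_integral_def)
  qed
  have intc: "integrable M (\<lambda>\<omega>. c n t \<omega> - c n s \<omega>)" for n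
    by (rule integrable_const_bound[of _ "t - s"]) (use cst in auto)
  define G where "G = (\<lambda>n \<omega>. indicator A \<omega> * (N i (c n t \<omega>) \<omega> - N i (c n s \<omega>) \<omega>))"
  have G: "G n \<omega> = indicator A \<omega> * Y n \<omega> + indicator A \<omega> * (c n t \<omega> - c n s \<omega>)" for n \<omega>
    by (simp add: G_def Y_def algebra_simps)
  have intG: "integrable M (G n)" for n
    unfolding G[abs_def] using integrable_mult_indicator[OF AM intY] integrable_mult_indicator[OF AM intc]
    by (intro Bochner_Integration.integrable_add) simp_all
  have EG: "integral\<^sup>L M (G n) = (LINT \<omega>|M. indicator A \<omega> * (c n t \<omega> - c n s \<omega>))" for n
  proof -
    have "integral\<^sup>L M (G n) = (LINT \<omega>|M. indicator A \<omega> * Y n \<omega>) + (LINT \<omega>|M. indicator A \<omega> * (c n t \<omega> - c n s \<omega>))"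
      unfolding G[abs_def] using integrable_mult_indicator[OF AM intY[of n]] integrable_mult_indicator[OF AM intc[of n]]
      by (intro Bochner_Integration.integral_add) simp_all
    then show ?thesis using EY by simp
  qed
  define L where "L = (\<lambda>\<omega>. indicator A \<omega> * (N i t \<omega> - N i s \<omega>))"
  have [measurable]: "N i r \<in> borel_measurable M" if "0 \<le> r" for r
    by (rule measurable_F_M[OF that N_adapted[OF that]])
  have Lm[measurable]: "L \<in> borel_measurable M" unfolding L_def using s t by measurable
  have Ninc: "N i r \<omega> \<le> N i r' \<omega>" if "\<omega> \<in> space M" "0 \<le> r" "r \<le> r'" for r r' \<omega>
    using N_increment[OF that, of i] by simp
  have L0: "0 \<le> L \<omega>" if "\<omega> \<in> space M" for \<omega>
    using Ninc[OF that s] by (simp add: L_def)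
  have G0: "0 \<le> G n \<omega>" if "\<omega> \<in> space M" for n \<omega>
    using Ninc[OF that, of "c n s \<omega>" "c n t \<omega>"] c0[OF s(1)] cst by (simp add: G_def)
  have GL: "G n \<omega> \<le> L \<omega>" if \<omega>: "\<omega> \<in> space M" for n \<omega>
  proof -
    have "c n s \<omega> = s \<or> c n t \<omega> = c n s \<omega>" using cc[of n \<omega>]
    proof
      assume "\<exists>x\<ge>0. \<forall>r\<ge>0. c n r \<omega> = min r x"
      then obtain x where "c n s \<omega> = min s x" "c n t \<omega> = min t x" using s(1) t by blast
      then show ?thesis using s(2) by linarith
    qed (use s in blast)
    then have "N i (c n t \<omega>) \<omega> - N i (c n s \<omega>) \<omega> \<le> N i t \<omega> - N i s \<omega>"
      using Ninc[OF \<omega> c0(1)[OF t] c0(2)[OF t], of n] Ninc[OF \<omega> s] by auto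
    then show ?thesis unfolding G_def L_def by (rule mult_left_mono) simp
  qed
  have ev: "AE \<omega> in M. \<forall>\<^sub>F n in sequentially. c n t \<omega> = t \<and> c n s \<omega> = s"
    using localising_eventually[OF T]
  proof eventually_elim
    case (elim \<omega>)
    from elim[rule_format, of t] elim[rule_format, of s] show ?case
      by eventually_elim (auto simp: c_def)
  qed
  have Glim: "AE \<omega> in M. (\<lambda>n. G n \<omega>) \<longlonglongrightarrow> L \<omega>"
    using ev by eventually_elim (rule tendsto_eventually, erule eventually_mono, simp add: G_def L_def)
  have clim: "AE \<omega> in M. (\<lambda>n. indicator A \<omega> * (c n t \<omega> - c n s \<omega>)) \<longlonglongrightarrow> indicator A \<omega> * (t - s)"
    using ev by eventually_elim (rule tendsto_eventually, erule eventually_mono, simp)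
  have EGle: "integral\<^sup>L M (G n) \<le> t - s" for n
  proof -
    have "(LINT \<omega>|M. indicator A \<omega> * (c n t \<omega> - c n s \<omega>)) \<le> (LINT \<omega>|M. t - s)"
      using integrable_mult_indicator[OF AM intc[of n]] cst s
      by (intro integral_mono) (auto split: split_indicator)
    then show ?thesis by (simp add: EG prob_space)
  qed
  have "(\<integral>\<^sup>+\<omega>. ennreal (L \<omega>) \<partial>M) = (\<integral>\<^sup>+\<omega>. liminf (\<lambda>n. ennreal (G n \<omega>)) \<partial>M)"
  proof (rule nn_integral_cong_AE)
    show "AE \<omega> in M. ennreal (L \<omega>) = liminf (\<lambda>n. ennreal (G n \<omega>))"
      using Glim by eventually_elim (auto intro!: lim_imp_Liminf[symmetric])
  qed
  \<comment> \<open>Fatou comes first: \<open>L\<close> has to be known integrable before it can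
    serve as dominating function.\<close>
  also have "\<dots> \<le> liminf (\<lambda>n. \<integral>\<^sup>+\<omega>. ennreal (G n \<omega>) \<partial>M)"
    by (rule nn_integral_liminf) (use intG in auto)
  also have "\<dots> \<le> ennreal (t - s)"
  proof (rule Liminf_le)
    show "\<forall>\<^sub>F n in sequentially. (\<integral>\<^sup>+\<omega>. ennreal (G n \<omega>) \<partial>M) \<le> ennreal (t - s)"
    proof (intro always_eventually allI)
      fix n
      have "(\<integral>\<^sup>+\<omega>. ennreal (G n \<omega>) \<partial>M) = ennreal (integral\<^sup>L M (G n))"
        using G0 by (intro nn_integral_eq_integral[OF intG]) auto
      also have "\<dots> \<le> ennreal (t - s)" by (rule ennreal_leI[OF EGle])
      finally show "(\<integral>\<^sup>+\<omega>. ennreal (G n \<omega>) \<partial>M) \<le> ennreal (t - s)" .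
    qed
  qed simp
  finally have "integrable M L" using L0 by (intro integrableI_nonneg) (auto intro: le_less_trans)
  have 1: "(\<lambda>n. integral\<^sup>L M (G n)) \<longlonglongrightarrow> integral\<^sup>L M L"
    by (rule integral_dominated_convergence[where w = L]) (use Glim GL G0 intG \<open>integrable M L\<close> in auto)
  have 2: "(\<lambda>n. LINT \<omega>|M. indicator A \<omega> * (c n t \<omega> - c n s \<omega>)) \<longlonglongrightarrow> (LINT \<omega>|M. indicator A \<omega> * (t - s))"
    by (rule integral_dominated_convergence[where w = "\<lambda>_. t - s"]) (use clim cst s in \<open>auto split: split_indicator\<close>)
  have "integral\<^sup>L M L = (LINT \<omega>|M. indicator A \<omega> * (t - s))"
    using LIMSEQ_unique[OF 1[unfolded EG] 2] .
  also have "\<dots> = (t - s) * measure M A" by simp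
  finally have "(\<integral>\<^sup>+\<omega>. ennreal (L \<omega>) \<partial>M) = ennreal ((t - s) * measure M A)"
    using L0 by (subst nn_integral_eq_integral[OF \<open>integrable M L\<close>]) auto
  moreover have "(\<integral>\<^sup>+\<omega>. ennreal (L \<omega>) \<partial>M) = (\<integral>\<^sup>+\<omega>. indicator A \<omega> * ennreal (N i t \<omega> - N i s \<omega>) \<partial>M)"
    by (rule nn_integral_cong) (auto simp: L_def split: split_indicator)
  ultimately show ?thesis using s by (simp add: ennreal_mult emeasure_eq_measure)
qed

end

section \<open>Random measures on \<open>(0, t]\<close> and a monotone class argument\<close>

context filtered_prob_space_usual
begin

text \<open>A common form for the two sides of the compensation formula, counting measure on the
  jump times and Lebesgue measure, both on \<open>(0, t]\<close>. The underlying space may vary with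
  the sample point; its sigma-algebra only has to contain the traces of Borel sets. Measurability in
  \<open>F t\<close> is demanded for generating rectangles and propagates from there.\<close>

definition adapted_kernel :: "real \<Rightarrow> ('a \<Rightarrow> real measure) \<Rightarrow> bool" where
  "adapted_kernel t \<kappa> \<longleftrightarrow>
    (\<forall>\<omega>\<in>space M. space (\<kappa> \<omega>) \<subseteq> {0<..t} \<and> (\<forall>B\<in>sets borel. B \<inter> space (\<kappa> \<omega>) \<in> sets (\<kappa> \<omega>)) \<and>
      emeasure (\<kappa> \<omega>) (space (\<kappa> \<omega>)) < \<infinity>) \<and>
    (\<forall>a b A. 0 \<le> a \<longrightarrow> a \<le> b \<longrightarrow> b \<le> t \<longrightarrow> A \<in> sets (F a) \<longrightarrow>
      (\<lambda>\<omega>. indicator A \<omega> * emeasure (\<kappa> \<omega>) ({a<..b} \<inter> space (\<kappa> \<omega>))) \<in> borel_measurable (F t))"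

lemma kernel_space:
  assumes "adapted_kernel t \<kappa>" "\<omega> \<in> space M" "s \<in> space (\<kappa> \<omega>)"
  shows "0 < s" "s \<le> t"
proof -
  have "space (\<kappa> \<omega>) \<subseteq> {0<..t}" using assms unfolding adapted_kernel_def by blast
  then show "0 < s" "s \<le> t" using assms(3) by auto
qed

lemma kernel_sets:
  assumes "adapted_kernel t \<kappa>" "\<omega> \<in> space M" "B \<in> sets borel"
  shows "B \<inter> space (\<kappa> \<omega>) \<in> sets (\<kappa> \<omega>)"
  using assms unfolding adapted_kernel_def by blast

lemma kernel_finite:
  assumes "adapted_kernel t \<kappa>" "\<omega> \<in> space M"
  shows "emeasure (\<kappa> \<omega>) (space (\<kappa> \<omega>)) < \<infinity>"
  using assms unfolding adapted_kernel_def by blast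

lemma kernel_section:
  assumes k: "adapted_kernel t \<kappa>" and \<omega>: "\<omega> \<in> space M" and h: "h \<in> measurable P N"
  shows "(\<lambda>s. h (s, \<omega>)) \<in> measurable (\<kappa> \<omega>) N"
proof -
  have "(\<lambda>s. s) \<in> measurable (\<kappa> \<omega>) (restrict_space borel {0..})"
  proof (rule measurable_restrict_space2)
    show "(\<lambda>s. s) \<in> space (\<kappa> \<omega>) \<rightarrow> {0..}"
      using kernel_space(1)[OF k \<omega>] by (auto intro: less_imp_le)
    show "(\<lambda>s. s) \<in> borel_measurable (\<kappa> \<omega>)"
    proof (rule measurableI)
      show "(\<lambda>s. s) -` B \<inter> space (\<kappa> \<omega>) \<in> sets (\<kappa> \<omega>)" if "B \<in> sets borel" for B
        using kernel_sets[OF k \<omega> that] by simp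
    qed simp
  qed
  from measurable_compose[OF this measurable_section'[OF \<omega> h]] show ?thesis .
qed

lemma kernel_indicator:
  assumes k: "adapted_kernel t \<kappa>" and \<omega>: "\<omega> \<in> space M" and B: "B \<in> sets P"
  shows "(\<lambda>s. indicator B (s, \<omega>) :: ennreal) \<in> borel_measurable (\<kappa> \<omega>)"
  by (rule kernel_section[OF k \<omega>]) (use B in measurable)

text \<open>Seen by a kernel on \<open>(0, t]\<close>, every generator is a rectangle over some
  \<open>(a, b]\<close> with \<open>b \<le> t\<close>: sets over time 0 are not charged, and what
  lies beyond \<open>t\<close> is cut off. The rectangle is chosen before the kernel, so that two
  kernels can be compared on it.\<close>

lemma kernel_pgen:
  assumes k: "adapted_kernel t \<kappa>" and t: "0 \<le> t" and B: "B \<in> pgen"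
  shows "\<exists>a b A. 0 \<le> a \<and> a \<le> b \<and> b \<le> t \<and> A \<in> sets (F a) \<and>
    (\<forall>\<kappa>. adapted_kernel t \<kappa> \<longrightarrow> (\<forall>\<omega>\<in>space M. (\<integral>\<^sup>+s. indicator B (s, \<omega>) \<partial>\<kappa> \<omega>)
      = indicator A \<omega> * emeasure (\<kappa> \<omega>) ({a<..b} \<inter> space (\<kappa> \<omega>))))"
proof -
  have ev: "(\<integral>\<^sup>+s. indicator B (s, \<omega>) \<partial>\<kappa> \<omega>) = indicator A \<omega> * emeasure (\<kappa> \<omega>) (S \<inter> space (\<kappa> \<omega>))"
    if "B = S \<times> A" "S \<in> sets borel" "\<omega> \<in> space M" "adapted_kernel t \<kappa>" for \<kappa> A S \<omega>
  proof -
    have "(\<integral>\<^sup>+s. indicator B (s, \<omega>) \<partial>\<kappa> \<omega>) = (\<integral>\<^sup>+s. indicator A \<omega> * indicator (S \<inter> space (\<kappa> \<omega>)) s \<partial>\<kappa> \<omega>)"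
      by (intro nn_integral_cong) (auto simp: that(1) split: split_indicator)
    also have "\<dots> = indicator A \<omega> * emeasure (\<kappa> \<omega>) (S \<inter> space (\<kappa> \<omega>))"
      using that by (subst nn_integral_cmult) (auto simp: adapted_kernel_def)
    finally show ?thesis .
  qed
  have sp: "space (\<kappa> \<omega>) \<subseteq> {0<..t}" if "adapted_kernel t \<kappa>" "\<omega> \<in> space M" for \<kappa> \<omega>
    using that unfolding adapted_kernel_def by auto
  from B consider A where "B = {0} \<times> A" "A \<in> sets (F 0)"
    | s b A where "B = {s<..b} \<times> A" "0 \<le> s" "s \<le> b" "A \<in> sets (F s)"
    unfolding pgen_def by blast
  then show ?thesis
  proof cases
    case 1
    have "(\<integral>\<^sup>+s. indicator B (s, \<omega>) \<partial>\<kappa> \<omega>) = indicator A \<omega> * emeasure (\<kappa> \<omega>) ({0<..0} \<inter> space (\<kappa> \<omega>))"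
      if "adapted_kernel t \<kappa>" "\<omega> \<in> space M" for \<kappa> \<omega>
    proof -
      have "{0} \<inter> space (\<kappa> \<omega>) = {}" using sp[OF that] by auto
      then show ?thesis using ev[OF 1(1) _ that(2,1)] by simp
    qed
    then show ?thesis using 1 t by (intro exI[of _ 0] exI[of _ A]) auto
  next
    case 2
    show ?thesis
    proof (cases "s \<le> t")
      case True
      have "(\<integral>\<^sup>+s. indicator B (s, \<omega>) \<partial>\<kappa> \<omega>) = indicator A \<omega> * emeasure (\<kappa> \<omega>) ({s<..min b t} \<inter> space (\<kappa> \<omega>))"
        if "adapted_kernel t \<kappa>" "\<omega> \<in> space M" for \<kappa> \<omega>
      proof -
        have "{s<..b} \<inter> space (\<kappa> \<omega>) = {s<..min b t} \<inter> space (\<kappa> \<omega>)" using sp[OF that] by auto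
        then show ?thesis using ev[OF 2(1) _ that(2,1)] by simp
      qed
      then show ?thesis using 2 True by (intro exI[of _ s] exI[of _ "min b t"] exI[of _ A]) auto
    next
      case False
      have "(\<integral>\<^sup>+s. indicator B (s, \<omega>) \<partial>\<kappa> \<omega>) = indicator {} \<omega> * emeasure (\<kappa> \<omega>) ({0<..0} \<inter> space (\<kappa> \<omega>))"
        if "adapted_kernel t \<kappa>" "\<omega> \<in> space M" for \<kappa> \<omega>
      proof -
        have "{s<..b} \<inter> space (\<kappa> \<omega>) = {}" using sp[OF that] False by auto
        then show ?thesis using ev[OF 2(1) _ that(2,1)] by simp
      qed
      then show ?thesis using t by (intro exI[of _ 0] exI[of _ "{}"]) auto
    qed
  qed
qed

lemma kernel_total:
  assumes k: "adapted_kernel t \<kappa>" and \<omega>: "\<omega> \<in> space M"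
  shows "{0<..t} \<inter> space (\<kappa> \<omega>) = space (\<kappa> \<omega>)"
  using assms unfolding adapted_kernel_def by auto

lemma kernel_compl:
  assumes k: "adapted_kernel t \<kappa>" and \<omega>: "\<omega> \<in> space M" and B: "B \<in> sets P"
  shows "(\<integral>\<^sup>+s. indicator ({0..} \<times> space M - B) (s, \<omega>) \<partial>\<kappa> \<omega>)
    = emeasure (\<kappa> \<omega>) (space (\<kappa> \<omega>)) - (\<integral>\<^sup>+s. indicator B (s, \<omega>) \<partial>\<kappa> \<omega>)"
    and "(\<integral>\<^sup>+s. indicator B (s, \<omega>) \<partial>\<kappa> \<omega>) \<le> emeasure (\<kappa> \<omega>) (space (\<kappa> \<omega>))"
proof -
  have "(\<integral>\<^sup>+s. indicator B (s, \<omega>) \<partial>\<kappa> \<omega>) \<le> (\<integral>\<^sup>+s. 1 \<partial>\<kappa> \<omega>)"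
    by (intro nn_integral_mono) (auto split: split_indicator)
  then show le: "(\<integral>\<^sup>+s. indicator B (s, \<omega>) \<partial>\<kappa> \<omega>) \<le> emeasure (\<kappa> \<omega>) (space (\<kappa> \<omega>))" by simp
  have "(\<integral>\<^sup>+s. indicator ({0..} \<times> space M - B) (s, \<omega>) \<partial>\<kappa> \<omega>) = (\<integral>\<^sup>+s. 1 - indicator B (s, \<omega>) \<partial>\<kappa> \<omega>)"
    using kernel_space[OF k \<omega>] \<omega> by (intro nn_integral_cong) (auto split: split_indicator intro: less_imp_le)
  also have "\<dots> = (\<integral>\<^sup>+s. 1 \<partial>\<kappa> \<omega>) - (\<integral>\<^sup>+s. indicator B (s, \<omega>) \<partial>\<kappa> \<omega>)"
  proof (rule nn_integral_diff)
    show "(\<integral>\<^sup>+s. indicator B (s, \<omega>) \<partial>\<kappa> \<omega>) \<noteq> \<infinity>"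
      using le kernel_finite[OF k \<omega>] by (auto simp: top_unique)
    show "(\<lambda>s. indicator B (s, \<omega>) :: ennreal) \<in> borel_measurable (\<kappa> \<omega>)" by (rule kernel_indicator[OF k \<omega> B])
  qed (auto split: split_indicator)
  finally show "(\<integral>\<^sup>+s. indicator ({0..} \<times> space M - B) (s, \<omega>) \<partial>\<kappa> \<omega>)
    = emeasure (\<kappa> \<omega>) (space (\<kappa> \<omega>)) - (\<integral>\<^sup>+s. indicator B (s, \<omega>) \<partial>\<kappa> \<omega>)" by simp
qed

lemma kernel_union:
  assumes k: "adapted_kernel t \<kappa>" and \<omega>: "\<omega> \<in> space M" and B: "range B \<subseteq> sets P" "disjoint_family B"
  shows "(\<integral>\<^sup>+s. indicator (\<Union>n::nat. B n) (s, \<omega>) \<partial>\<kappa> \<omega>) = (\<Sum>n. \<integral>\<^sup>+s. indicator (B n) (s, \<omega>) \<partial>\<kappa> \<omega>)"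
  using B kernel_indicator[OF k \<omega>] by (subst nn_integral_suminf[symmetric]) (auto simp: suminf_indicator)

lemma kernel_total_measurable:
  assumes k: "adapted_kernel t \<kappa>" and t: "0 \<le> t"
  shows "(\<lambda>\<omega>. emeasure (\<kappa> \<omega>) (space (\<kappa> \<omega>))) \<in> borel_measurable (F t)"
proof -
  have "(\<lambda>\<omega>. indicator (space M) \<omega> * emeasure (\<kappa> \<omega>) ({0<..t} \<inter> space (\<kappa> \<omega>))) \<in> borel_measurable (F t)"
    using k t sets.top[of "F 0"] space_F[of 0] unfolding adapted_kernel_def by auto
  then show ?thesis
    by (rule measurable_congI) (simp add: space_F[OF t] kernel_total[OF k])
qed

lemma kernel_measurable_indicator:
  assumes k: "adapted_kernel t \<kappa>" and t: "0 \<le> t" and B: "B \<in> sets P"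
  shows "(\<lambda>\<omega>. \<integral>\<^sup>+s. indicator B (s, \<omega>) \<partial>\<kappa> \<omega>) \<in> borel_measurable (F t)"
  using pgen_Int_stable pgen_subset B[unfolded sets_P]
proof (induction rule: sigma_sets_induct_disjoint)
  case (basic A)
  obtain a b C where C: "0 \<le> a" "a \<le> b" "b \<le> t" "C \<in> sets (F a)"
    "\<And>\<omega>. \<omega> \<in> space M \<Longrightarrow> (\<integral>\<^sup>+s. indicator A (s, \<omega>) \<partial>\<kappa> \<omega>) = indicator C \<omega> * emeasure (\<kappa> \<omega>) ({a<..b} \<inter> space (\<kappa> \<omega>))"
    using kernel_pgen[OF k t basic] k by blast
  have "(\<lambda>\<omega>. indicator C \<omega> * emeasure (\<kappa> \<omega>) ({a<..b} \<inter> space (\<kappa> \<omega>))) \<in> borel_measurable (F t)"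
    using k C(1-4) unfolding adapted_kernel_def by blast
  then show ?case by (rule measurable_congI) (simp add: space_F[OF t] C(5))
next
  case empty
  then show ?case by simp
next
  case (compl A)
  have "(\<lambda>\<omega>. emeasure (\<kappa> \<omega>) (space (\<kappa> \<omega>)) - (\<integral>\<^sup>+s. indicator A (s, \<omega>) \<partial>\<kappa> \<omega>)) \<in> borel_measurable (F t)"
    by (intro borel_measurable_minus_ennreal kernel_total_measurable[OF k t] compl)
  then show ?case
    by (rule measurable_congI)
       (simp add: space_F[OF t] kernel_compl(1)[OF k _ compl(1)[folded sets_P]])
next
  case (union A)
  have "(\<lambda>\<omega>. \<Sum>n. \<integral>\<^sup>+s. indicator (A n) (s, \<omega>) \<partial>\<kappa> \<omega>) \<in> borel_measurable (F t)"
    by (intro borel_measurable_suminf_order union)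
  then show ?case
    by (rule measurable_congI)
       (simp add: space_F[OF t] kernel_union[OF k _ union(2)[folded sets_P] union(1)])
qed

lemma kernel_measurable:
  assumes k: "adapted_kernel t \<kappa>" and t: "0 \<le> t" and h: "h \<in> borel_measurable P"
  shows "(\<lambda>\<omega>. \<integral>\<^sup>+s. h (s, \<omega>) \<partial>\<kappa> \<omega>) \<in> borel_measurable (F t)"
  using h
proof (induction rule: borel_measurable_induct)
  case (cong f g)
  have "(\<integral>\<^sup>+s. f (s, \<omega>) \<partial>\<kappa> \<omega>) = (\<integral>\<^sup>+s. g (s, \<omega>) \<partial>\<kappa> \<omega>)" if "\<omega> \<in> space M" for \<omega>
    using kernel_space[OF k that] that by (intro nn_integral_cong cong(3)) (auto simp: space_P intro: less_imp_le)
  then show ?case by (intro measurable_congI[OF cong(4)]) (simp add: space_F[OF t])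
next
  case (set A)
  then show ?case by (rule kernel_measurable_indicator[OF k t])
next
  case (mult u c)
  have "(\<lambda>\<omega>. c * (\<integral>\<^sup>+s. u (s, \<omega>) \<partial>\<kappa> \<omega>)) \<in> borel_measurable (F t)" using mult(4) by measurable
  then show ?case
    by (rule measurable_congI)
       (simp add: space_F[OF t] nn_integral_cmult kernel_section[OF k _ mult(2)])
next
  case (add u v)
  have "(\<lambda>\<omega>. (\<integral>\<^sup>+s. v (s, \<omega>) \<partial>\<kappa> \<omega>) + (\<integral>\<^sup>+s. u (s, \<omega>) \<partial>\<kappa> \<omega>)) \<in> borel_measurable (F t)" using add(6,7) by measurable
  then show ?case
    by (rule measurable_congI)
       (simp add: space_F[OF t] nn_integral_add kernel_section[OF k _ add(1)] kernel_section[OF k _ add(3)])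
next
  case (seq U)
  have U: "(\<lambda>\<omega>. \<Squnion>i. \<integral>\<^sup>+s. U i (s, \<omega>) \<partial>\<kappa> \<omega>) \<in> borel_measurable (F t)" using seq(5) by measurable
  have "(\<integral>\<^sup>+s. (\<Squnion>i. U i (s, \<omega>)) \<partial>\<kappa> \<omega>) = (\<Squnion>i. \<integral>\<^sup>+s. U i (s, \<omega>) \<partial>\<kappa> \<omega>)" if "\<omega> \<in> space M" for \<omega>
    using seq(3) kernel_section[OF k that seq(1)]
    by (intro nn_integral_monotone_convergence_SUP) (auto simp: incseq_def le_fun_def)
  then show ?case
    by (intro measurable_congI[OF U]) (simp add: space_F[OF t] SUP_apply image_comp)
qed

text \<open>Agreement of expected masses on the intersection-stable generator passes to all
  predictable sets by Dynkin's argument, where complements need the finite total mass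
  \<open>fin\<close>, and then to functions by monotone approximation.\<close>

lemma kernel_expectation_eq:
  assumes k: "adapted_kernel t \<kappa>" and k': "adapted_kernel t \<kappa>'" and t: "0 \<le> t"
    and gen: "\<And>a b A. 0 \<le> a \<Longrightarrow> a \<le> b \<Longrightarrow> b \<le> t \<Longrightarrow> A \<in> sets (F a) \<Longrightarrow>
      (\<integral>\<^sup>+\<omega>. indicator A \<omega> * emeasure (\<kappa> \<omega>) ({a<..b} \<inter> space (\<kappa> \<omega>)) \<partial>M)
      = (\<integral>\<^sup>+\<omega>. indicator A \<omega> * emeasure (\<kappa>' \<omega>) ({a<..b} \<inter> space (\<kappa>' \<omega>)) \<partial>M)"
    and fin: "(\<integral>\<^sup>+\<omega>. emeasure (\<kappa> \<omega>) (space (\<kappa> \<omega>)) \<partial>M) < \<infinity>"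
    and h: "h \<in> borel_measurable P"
  shows "(\<integral>\<^sup>+\<omega>. (\<integral>\<^sup>+s. h (s, \<omega>) \<partial>\<kappa> \<omega>) \<partial>M) = (\<integral>\<^sup>+\<omega>. (\<integral>\<^sup>+s. h (s, \<omega>) \<partial>\<kappa>' \<omega>) \<partial>M)"
proof -
  have tot: "(\<integral>\<^sup>+\<omega>. indicator (space M) \<omega> * emeasure (\<kappa> \<omega>) ({0<..t} \<inter> space (\<kappa> \<omega>)) \<partial>M) = (\<integral>\<^sup>+\<omega>. emeasure (\<kappa> \<omega>) (space (\<kappa> \<omega>)) \<partial>M)"
    if "adapted_kernel t \<kappa>" for \<kappa>
    using that by (intro nn_integral_cong) (simp add: kernel_total)
  have T: "(\<integral>\<^sup>+\<omega>. emeasure (\<kappa> \<omega>) (space (\<kappa> \<omega>)) \<partial>M) = (\<integral>\<^sup>+\<omega>. emeasure (\<kappa>' \<omega>) (space (\<kappa>' \<omega>)) \<partial>M)"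
    using gen[of 0 t "space M"] t sets.top[of "F 0"] space_F[of 0] tot[OF k] tot[OF k'] by simp
  have Bm: "(\<lambda>\<omega>. \<integral>\<^sup>+s. indicator B (s, \<omega>) \<partial>\<kappa> \<omega>) \<in> borel_measurable M"
    if "adapted_kernel t \<kappa>" "B \<in> sets P" for \<kappa> B
    by (rule measurable_F_M[OF t kernel_measurable_indicator[OF that(1) t that(2)]])
  have Tm: "(\<lambda>\<omega>. emeasure (\<kappa> \<omega>) (space (\<kappa> \<omega>))) \<in> borel_measurable M"
    if "adapted_kernel t \<kappa>" for \<kappa>
    by (rule measurable_F_M[OF t kernel_total_measurable[OF that t]])
  have set_eq: "(\<integral>\<^sup>+\<omega>. (\<integral>\<^sup>+s. indicator B (s, \<omega>) \<partial>\<kappa> \<omega>) \<partial>M) = (\<integral>\<^sup>+\<omega>. (\<integral>\<^sup>+s. indicator B (s, \<omega>) \<partial>\<kappa>' \<omega>) \<partial>M)"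
    if B: "B \<in> sets P" for B
    using pgen_Int_stable pgen_subset B[unfolded sets_P]
  proof (induction rule: sigma_sets_induct_disjoint)
    case (basic A)
    obtain a b C where C: "0 \<le> a" "a \<le> b" "b \<le> t" "C \<in> sets (F a)"
      "\<forall>\<kappa>. adapted_kernel t \<kappa> \<longrightarrow> (\<forall>\<omega>\<in>space M. (\<integral>\<^sup>+s. indicator A (s, \<omega>) \<partial>\<kappa> \<omega>) = indicator C \<omega> * emeasure (\<kappa> \<omega>) ({a<..b} \<inter> space (\<kappa> \<omega>)))"
      using kernel_pgen[OF k t basic] by blast
    have *: "(\<integral>\<^sup>+\<omega>. (\<integral>\<^sup>+s. indicator A (s, \<omega>) \<partial>\<kappa> \<omega>) \<partial>M) = (\<integral>\<^sup>+\<omega>. indicator C \<omega> * emeasure (\<kappa> \<omega>) ({a<..b} \<inter> space (\<kappa> \<omega>)) \<partial>M)"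
      if "adapted_kernel t \<kappa>" for \<kappa>
      using C(5) that by (intro nn_integral_cong) simp
    show ?case unfolding *[OF k] *[OF k'] by (rule gen[OF C(1-4)])
  next
    case empty
    then show ?case by simp
  next
    case (compl A)
    have A: "A \<in> sets P" using compl(1) by (simp add: sets_P)
    have *: "(\<integral>\<^sup>+\<omega>. (\<integral>\<^sup>+s. indicator ({0..} \<times> space M - A) (s, \<omega>) \<partial>\<kappa> \<omega>) \<partial>M)
      = (\<integral>\<^sup>+\<omega>. emeasure (\<kappa> \<omega>) (space (\<kappa> \<omega>)) \<partial>M) - (\<integral>\<^sup>+\<omega>. (\<integral>\<^sup>+s. indicator A (s, \<omega>) \<partial>\<kappa> \<omega>) \<partial>M)"
      if q: "adapted_kernel t \<kappa>" and fin: "(\<integral>\<^sup>+\<omega>. emeasure (\<kappa> \<omega>) (space (\<kappa> \<omega>)) \<partial>M) < \<infinity>" for \<kappa>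
    proof -
      have le: "(\<integral>\<^sup>+\<omega>. (\<integral>\<^sup>+s. indicator A (s, \<omega>) \<partial>\<kappa> \<omega>) \<partial>M) \<le> (\<integral>\<^sup>+\<omega>. emeasure (\<kappa> \<omega>) (space (\<kappa> \<omega>)) \<partial>M)"
        by (intro nn_integral_mono kernel_compl(2)[OF q _ A]) auto
      have "(\<integral>\<^sup>+\<omega>. (\<integral>\<^sup>+s. indicator ({0..} \<times> space M - A) (s, \<omega>) \<partial>\<kappa> \<omega>) \<partial>M)
        = (\<integral>\<^sup>+\<omega>. emeasure (\<kappa> \<omega>) (space (\<kappa> \<omega>)) - (\<integral>\<^sup>+s. indicator A (s, \<omega>) \<partial>\<kappa> \<omega>) \<partial>M)"
        by (intro nn_integral_cong kernel_compl(1)[OF q _ A]) auto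
      also have "\<dots> = (\<integral>\<^sup>+\<omega>. emeasure (\<kappa> \<omega>) (space (\<kappa> \<omega>)) \<partial>M) - (\<integral>\<^sup>+\<omega>. (\<integral>\<^sup>+s. indicator A (s, \<omega>) \<partial>\<kappa> \<omega>) \<partial>M)"
      proof (rule nn_integral_diff[OF Tm[OF q] Bm[OF q A]])
        show "(\<integral>\<^sup>+\<omega>. (\<integral>\<^sup>+s. indicator A (s, \<omega>) \<partial>\<kappa> \<omega>) \<partial>M) \<noteq> \<infinity>" using le fin by (auto simp: top_unique)
        show "AE \<omega> in M. (\<integral>\<^sup>+s. indicator A (s, \<omega>) \<partial>\<kappa> \<omega>) \<le> emeasure (\<kappa> \<omega>) (space (\<kappa> \<omega>))"
          by (intro AE_I2 kernel_compl(2)[OF q _ A])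
      qed
      finally show ?thesis .
    qed
    show ?case unfolding *[OF k fin] *[OF k' fin[unfolded T]] T compl(2) ..
  next
    case (union A)
    have A: "range A \<subseteq> sets P" using union(2) by (simp add: sets_P)
    have *: "(\<integral>\<^sup>+\<omega>. (\<integral>\<^sup>+s. indicator (\<Union>n. A n) (s, \<omega>) \<partial>\<kappa> \<omega>) \<partial>M) = (\<Sum>n. \<integral>\<^sup>+\<omega>. (\<integral>\<^sup>+s. indicator (A n) (s, \<omega>) \<partial>\<kappa> \<omega>) \<partial>M)"
      if q: "adapted_kernel t \<kappa>" for \<kappa>
    proof -
      have "(\<integral>\<^sup>+\<omega>. (\<integral>\<^sup>+s. indicator (\<Union>n. A n) (s, \<omega>) \<partial>\<kappa> \<omega>) \<partial>M) = (\<integral>\<^sup>+\<omega>. (\<Sum>n. \<integral>\<^sup>+s. indicator (A n) (s, \<omega>) \<partial>\<kappa> \<omega>) \<partial>M)"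
        by (intro nn_integral_cong kernel_union[OF q _ A union(1)])
      also have "\<dots> = (\<Sum>n. \<integral>\<^sup>+\<omega>. (\<integral>\<^sup>+s. indicator (A n) (s, \<omega>) \<partial>\<kappa> \<omega>) \<partial>M)"
        using A by (intro nn_integral_suminf Bm[OF q]) auto
      finally show ?thesis .
    qed
    show ?case unfolding *[OF k] *[OF k'] by (simp add: union(3))
  qed
  have Hm: "(\<lambda>\<omega>. \<integral>\<^sup>+s. u (s, \<omega>) \<partial>\<kappa> \<omega>) \<in> borel_measurable M"
    if "adapted_kernel t \<kappa>" "u \<in> borel_measurable P" for u \<kappa>
    by (rule measurable_F_M[OF t kernel_measurable[OF that(1) t that(2)]])
  show ?thesis using h
  proof (induction rule: borel_measurable_induct)
    case (cong f g)
    have fg: "(\<integral>\<^sup>+s. f (s, \<omega>) \<partial>\<kappa> \<omega>) = (\<integral>\<^sup>+s. g (s, \<omega>) \<partial>\<kappa> \<omega>)" if "\<omega> \<in> space M" "adapted_kernel t \<kappa>" for \<omega> \<kappa>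
      using kernel_space[OF that(2,1)] that(1) by (intro nn_integral_cong cong(3)) (auto simp: space_P intro: less_imp_le)
    then have "(\<integral>\<^sup>+\<omega>. (\<integral>\<^sup>+s. f (s, \<omega>) \<partial>\<kappa> \<omega>) \<partial>M) = (\<integral>\<^sup>+\<omega>. (\<integral>\<^sup>+s. g (s, \<omega>) \<partial>\<kappa> \<omega>) \<partial>M)" if "adapted_kernel t \<kappa>" for \<kappa>
      by (rule nn_integral_cong) (assumption, rule that)
    from this[OF k] this[OF k'] show ?case using cong(4) by simp
  next
    case (set A)
    then show ?case by (rule set_eq)
  next
    case (mult u c)
    have "(\<integral>\<^sup>+\<omega>. (\<integral>\<^sup>+s. c * u (s, \<omega>) \<partial>\<kappa> \<omega>) \<partial>M) = c * (\<integral>\<^sup>+\<omega>. (\<integral>\<^sup>+s. u (s, \<omega>) \<partial>\<kappa> \<omega>) \<partial>M)" if q: "adapted_kernel t \<kappa>" for \<kappa>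
    proof -
      have "(\<integral>\<^sup>+\<omega>. (\<integral>\<^sup>+s. c * u (s, \<omega>) \<partial>\<kappa> \<omega>) \<partial>M) = (\<integral>\<^sup>+\<omega>. c * (\<integral>\<^sup>+s. u (s, \<omega>) \<partial>\<kappa> \<omega>) \<partial>M)"
        by (intro nn_integral_cong nn_integral_cmult kernel_section[OF q _ mult(2)])
      then show ?thesis by (simp only: nn_integral_cmult[OF Hm[OF q mult(2)]])
    qed
    from this[OF k] this[OF k'] show ?case using mult(4) by simp
  next
    case (add u v)
    have "(\<integral>\<^sup>+\<omega>. (\<integral>\<^sup>+s. v (s, \<omega>) + u (s, \<omega>) \<partial>\<kappa> \<omega>) \<partial>M)
      = (\<integral>\<^sup>+\<omega>. (\<integral>\<^sup>+s. v (s, \<omega>) \<partial>\<kappa> \<omega>) \<partial>M) + (\<integral>\<^sup>+\<omega>. (\<integral>\<^sup>+s. u (s, \<omega>) \<partial>\<kappa> \<omega>) \<partial>M)" if q: "adapted_kernel t \<kappa>" for \<kappa>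
    proof -
      have "(\<integral>\<^sup>+\<omega>. (\<integral>\<^sup>+s. v (s, \<omega>) + u (s, \<omega>) \<partial>\<kappa> \<omega>) \<partial>M) = (\<integral>\<^sup>+\<omega>. (\<integral>\<^sup>+s. v (s, \<omega>) \<partial>\<kappa> \<omega>) + (\<integral>\<^sup>+s. u (s, \<omega>) \<partial>\<kappa> \<omega>) \<partial>M)"
        by (intro nn_integral_cong nn_integral_add kernel_section[OF q _ add(1)] kernel_section[OF q _ add(3)])
      then show ?thesis by (simp only: nn_integral_add[OF Hm[OF q add(3)] Hm[OF q add(1)]])
    qed
    from this[OF k] this[OF k'] show ?case using add(6,7) by simp
  next
    case (seq U)
    have "(\<integral>\<^sup>+\<omega>. (\<integral>\<^sup>+s. (\<Squnion>i. U i (s, \<omega>)) \<partial>\<kappa> \<omega>) \<partial>M) = (\<Squnion>i. \<integral>\<^sup>+\<omega>. (\<integral>\<^sup>+s. U i (s, \<omega>) \<partial>\<kappa> \<omega>) \<partial>M)" if q: "adapted_kernel t \<kappa>" for \<kappa>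
    proof -
      have "(\<integral>\<^sup>+\<omega>. (\<integral>\<^sup>+s. (\<Squnion>i. U i (s, \<omega>)) \<partial>\<kappa> \<omega>) \<partial>M) = (\<integral>\<^sup>+\<omega>. (\<Squnion>i. \<integral>\<^sup>+s. U i (s, \<omega>) \<partial>\<kappa> \<omega>) \<partial>M)"
        using seq(3) kernel_section[OF q _ seq(1)]
        by (intro nn_integral_cong nn_integral_monotone_convergence_SUP) (auto simp: incseq_def le_fun_def)
      also have "\<dots> = (\<Squnion>i. \<integral>\<^sup>+\<omega>. (\<integral>\<^sup>+s. U i (s, \<omega>) \<partial>\<kappa> \<omega>) \<partial>M)"
        using seq(3) Hm[OF q seq(1)]
        by (intro nn_integral_monotone_convergence_SUP) (auto simp: incseq_def le_fun_def intro!: nn_integral_mono)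
      finally show ?thesis .
    qed
    from this[OF k] this[OF k'] show ?case using seq(5) by (simp add: SUP_apply image_comp)
  qed
qed

lemma kernel_real_measurable:
  fixes g :: "real \<times> 'a \<Rightarrow> real"
  assumes k: "adapted_kernel t \<kappa>" and t: "0 \<le> t" and g[measurable]: "g \<in> borel_measurable P"
    and int: "\<And>\<omega>. \<omega> \<in> space M \<Longrightarrow> integrable (\<kappa> \<omega>) (\<lambda>s. g (s, \<omega>))"
  shows "(\<lambda>\<omega>. LINT s|\<kappa> \<omega>. g (s, \<omega>)) \<in> borel_measurable (F t)"
proof -
  have "(\<lambda>\<omega>. enn2real (\<integral>\<^sup>+s. ennreal (g (s, \<omega>)) \<partial>\<kappa> \<omega>) - enn2real (\<integral>\<^sup>+s. ennreal (- g (s, \<omega>)) \<partial>\<kappa> \<omega>)) \<in> borel_measurable (F t)"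
    using kernel_measurable[OF k t, of "\<lambda>w. ennreal (g w)"] kernel_measurable[OF k t, of "\<lambda>w. ennreal (- g w)"]
    by measurable
  then show ?thesis
    by (rule measurable_congI) (simp add: space_F[OF t] real_lebesgue_integral_def int)
qed

text \<open>Expresses the expectation through two nonnegative integrals, to each of which
  \<open>kernel_expectation_eq\<close> applies.\<close>

lemma kernel_real_expectation:
  fixes g :: "real \<times> 'a \<Rightarrow> real"
  assumes k: "adapted_kernel t \<kappa>" and t: "0 \<le> t" and g[measurable]: "g \<in> borel_measurable P"
    and int: "\<And>\<omega>. \<omega> \<in> space M \<Longrightarrow> integrable (\<kappa> \<omega>) (\<lambda>s. g (s, \<omega>))"
    and fin: "(\<integral>\<^sup>+\<omega>. (\<integral>\<^sup>+s. ennreal \<bar>g (s, \<omega>)\<bar> \<partial>\<kappa> \<omega>) \<partial>M) < \<infinity>"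
  shows "integrable M (\<lambda>\<omega>. LINT s|\<kappa> \<omega>. g (s, \<omega>))"
    and "(LINT \<omega>|M. (LINT s|\<kappa> \<omega>. g (s, \<omega>)))
      = enn2real (\<integral>\<^sup>+\<omega>. (\<integral>\<^sup>+s. ennreal (g (s, \<omega>)) \<partial>\<kappa> \<omega>) \<partial>M) - enn2real (\<integral>\<^sup>+\<omega>. (\<integral>\<^sup>+s. ennreal (- g (s, \<omega>)) \<partial>\<kappa> \<omega>) \<partial>M)"
proof -
  let ?p = "\<lambda>\<omega>. \<integral>\<^sup>+s. ennreal (g (s, \<omega>)) \<partial>\<kappa> \<omega>" and ?n = "\<lambda>\<omega>. \<integral>\<^sup>+s. ennreal (- g (s, \<omega>)) \<partial>\<kappa> \<omega>"
  have m: "?p \<in> borel_measurable M" "?n \<in> borel_measurable M"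
    using kernel_measurable[OF k t, of "\<lambda>w. ennreal (g w)"] kernel_measurable[OF k t, of "\<lambda>w. ennreal (- g w)"]
    by (auto intro: measurable_F_M[OF t])
  have "integral\<^sup>N M ?p \<le> (\<integral>\<^sup>+\<omega>. (\<integral>\<^sup>+s. ennreal \<bar>g (s, \<omega>)\<bar> \<partial>\<kappa> \<omega>) \<partial>M)"
    "integral\<^sup>N M ?n \<le> (\<integral>\<^sup>+\<omega>. (\<integral>\<^sup>+s. ennreal \<bar>g (s, \<omega>)\<bar> \<partial>\<kappa> \<omega>) \<partial>M)"
    by (intro nn_integral_mono ennreal_leI; simp)+
  then have f: "integral\<^sup>N M ?p < \<infinity>" "integral\<^sup>N M ?n < \<infinity>" using fin by (auto intro: le_less_trans)
  have fp: "?p \<omega> < \<infinity>" "?n \<omega> < \<infinity>" if "\<omega> \<in> space M" for \<omega>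
    using int[OF that] by (auto simp: real_integrable_def less_top)
  have R: "integrable M (\<lambda>\<omega>. enn2real (q \<omega>)) \<and> (LINT \<omega>|M. enn2real (q \<omega>)) = enn2real (integral\<^sup>N M q)"
    if q: "q \<in> borel_measurable M" "integral\<^sup>N M q < \<infinity>" "\<And>\<omega>. \<omega> \<in> space M \<Longrightarrow> q \<omega> < \<infinity>" for q
  proof -
    have eq: "(\<integral>\<^sup>+\<omega>. ennreal (enn2real (q \<omega>)) \<partial>M) = integral\<^sup>N M q"
      using q(3) by (intro nn_integral_cong) (simp add: ennreal_enn2real less_top)
    have "integrable M (\<lambda>\<omega>. enn2real (q \<omega>))"
      using q eq by (intro integrableI_nonneg) auto
    moreover have "(LINT \<omega>|M. enn2real (q \<omega>)) = enn2real (\<integral>\<^sup>+\<omega>. ennreal (enn2real (q \<omega>)) \<partial>M)"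
      using q(1) by (intro integral_eq_nn_integral) auto
    ultimately show ?thesis using eq by simp
  qed
  note Rp = R[OF m(1) f(1) fp(1)] and Rn = R[OF m(2) f(2) fp(2)]
  have eq: "(LINT s|\<kappa> \<omega>. g (s, \<omega>)) = enn2real (?p \<omega>) - enn2real (?n \<omega>)" if "\<omega> \<in> space M" for \<omega>
    by (simp add: real_lebesgue_integral_def int[OF that])
  have "integrable M (\<lambda>\<omega>. enn2real (?p \<omega>) - enn2real (?n \<omega>))" using Rp Rn by simp
  then show "integrable M (\<lambda>\<omega>. LINT s|\<kappa> \<omega>. g (s, \<omega>))"
    by (rule Bochner_Integration.integrable_cong[THEN iffD2, rotated 2]) (simp_all add: eq)
  have "(LINT \<omega>|M. (LINT s|\<kappa> \<omega>. g (s, \<omega>))) = (LINT \<omega>|M. enn2real (?p \<omega>) - enn2real (?n \<omega>))"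
    by (rule Bochner_Integration.integral_cong[OF refl eq])
  also have "\<dots> = (LINT \<omega>|M. enn2real (?p \<omega>)) - (LINT \<omega>|M. enn2real (?n \<omega>))"
    using Rp Rn by (intro Bochner_Integration.integral_diff) auto
  finally show "(LINT \<omega>|M. (LINT s|\<kappa> \<omega>. g (s, \<omega>))) = enn2real (integral\<^sup>N M ?p) - enn2real (integral\<^sup>N M ?n)"
    using Rp Rn by simp
qed

lemma lebesgue_kernel: "0 \<le> t \<Longrightarrow> adapted_kernel t (\<lambda>\<omega>. restrict_space lborel {0<..t})"
proof -
  assume t: "0 \<le> t"
  have "emeasure (restrict_space lborel {0<..t}) ({a<..b} \<inter> {0<..t}) = ennreal (b - a)"
    if "0 \<le> a" "a \<le> b" "b \<le> t" for a b
  proof -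
    have "{a<..b} \<inter> {0<..t} = {a<..b}" using that by auto
    then show ?thesis using that by (subst emeasure_restrict_space) (auto simp: space_restrict_space)
  qed
  then show ?thesis using t unfolding adapted_kernel_def
    by (auto simp: space_restrict_space sets_restrict_space emeasure_restrict_space
        intro!: borel_measurable_times_ennreal borel_measurable_indicator intro: sets_F_mono)
qed

end

section \<open>The jump measure and Lebesgue measure as kernels with equal expectations\<close>

context unit_intensity
begin

lemma emeasure_jump_kernel:
  assumes \<omega>: "\<omega> \<in> space M" and ab: "0 \<le> a" "a \<le> b" "b \<le> t"
  shows "emeasure (count_space (J i \<omega> \<inter> {0<..t})) ({a<..b} \<inter> (J i \<omega> \<inter> {0<..t})) = ennreal (N i b \<omega> - N i a \<omega>)"
proof -
  have *: "{a<..b} \<inter> (J i \<omega> \<inter> {0<..t}) = J i \<omega> \<inter> {a<..b}" using ab by auto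
  have "J i \<omega> \<inter> {a<..b} \<subseteq> J i \<omega> \<inter> {0<..t}" using ab by auto
  then show ?thesis unfolding *
    using J_finite_Ioc[OF \<omega>, of i a b] N_increment[OF \<omega> ab(1,2), of i]
    by (simp add: emeasure_count_space ennreal_of_nat_eq_real_of_nat)
qed

text \<open>The mass of \<open>(a, b]\<close> is an increment of the adapted process
  \<open>N i\<close>.\<close>

lemma jump_kernel: "0 \<le> t \<Longrightarrow> adapted_kernel t (\<lambda>\<omega>. count_space (J i \<omega> \<inter> {0<..t}))"
  unfolding adapted_kernel_def
proof (intro conjI ballI allI impI)
  fix a b A assume t: "0 \<le> t" and ab: "0 \<le> a" "a \<le> b" "b \<le> t" and A: "A \<in> sets (F a)"
  have [measurable]: "A \<in> sets (F t)" using sets_F_mono[OF ab(1) _ A, of t] ab by simp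
  have [measurable]: "N i a \<in> borel_measurable (F t)" "N i b \<in> borel_measurable (F t)"
    using measurable_F_mono[OF _ _ N_adapted[of a i], of t] measurable_F_mono[OF _ _ N_adapted[of b i], of t] ab by auto
  have "(\<lambda>\<omega>. indicator A \<omega> * ennreal (N i b \<omega> - N i a \<omega>)) \<in> borel_measurable (F t)" by measurable
  then show "(\<lambda>\<omega>. indicator A \<omega> * emeasure (count_space (J i \<omega> \<inter> {0<..t})) ({a<..b} \<inter> space (count_space (J i \<omega> \<inter> {0<..t})))) \<in> borel_measurable (F t)"
    by (rule measurable_congI) (simp add: space_F[OF t] emeasure_jump_kernel[OF _ ab])
next
  fix \<omega> assume "\<omega> \<in> space M"
  then show "emeasure (count_space (J i \<omega> \<inter> {0<..t})) (space (count_space (J i \<omega> \<inter> {0<..t}))) < \<infinity>"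
    by (simp add: emeasure_count_space J_finite_Ioc ennreal_of_nat_eq_real_of_nat)
qed auto

lemma integrable_jump_kernel:
  fixes g :: "real \<Rightarrow> real"
  assumes "\<omega> \<in> space M"
  shows "integrable (count_space (J i \<omega> \<inter> {0<..t})) g"
    and "(LINT s|count_space (J i \<omega> \<inter> {0<..t}). g s) = (\<Sum>s\<in>J i \<omega> \<inter> {0<..t}. g s)"
  using J_finite_Ioc[OF assms] by (auto intro: integrable_count_space lebesgue_integral_count_space_finite)

lemma adapted_jump_sum:
  fixes g :: "real \<times> 'a \<Rightarrow> real"
  assumes "0 \<le> t" "g \<in> borel_measurable P"
  shows "(\<lambda>\<omega>. \<Sum>r\<in>J i \<omega> \<inter> {0<..t}. g (r, \<omega>)) \<in> borel_measurable (F t)"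
  by (rule measurable_congI[OF kernel_real_measurable[OF jump_kernel[OF assms(1)] assms]])
     (simp_all add: integrable_jump_kernel space_F assms(1))

lemma path_integrable:
  fixes g :: "real \<times> 'a \<Rightarrow> real"
  assumes t: "0 \<le> t" and g: "g \<in> borel_measurable P" and \<omega>: "\<omega> \<in> space M"
    and K: "\<And>s. 0 < s \<Longrightarrow> s \<le> t \<Longrightarrow> \<bar>g (s, \<omega>)\<bar> \<le> K"
  shows "set_integrable lborel {0<..t} (\<lambda>s. g (s, \<omega>))"
proof (rule set_integrable_bounded_interval)
  have "(\<lambda>s. g (s, \<omega>)) \<in> borel_measurable (restrict_space lborel {0<..t})"
    using kernel_section[OF lebesgue_kernel[OF t] \<omega> g] .
  then have "set_borel_measurable lborel {0<..t} (\<lambda>s. g (s, \<omega>))"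
    unfolding set_borel_measurable_def by (subst (asm) borel_measurable_restrict_space_iff) auto
  then show "set_borel_measurable borel {0<..t} (\<lambda>s. g (s, \<omega>))" by (simp add: set_borel_measurable_def)
qed (use K in auto)

lemma adapted_integral:
  fixes g :: "real \<times> 'a \<Rightarrow> real"
  assumes t: "0 \<le> t" and g: "g \<in> borel_measurable P"
    and K: "\<And>\<omega>. \<omega> \<in> space M \<Longrightarrow> \<exists>K. \<forall>s. 0 < s \<longrightarrow> s \<le> t \<longrightarrow> \<bar>g (s, \<omega>)\<bar> \<le> K"
  shows "(\<lambda>\<omega>. LBINT s:{0<..t}. g (s, \<omega>)) \<in> borel_measurable (F t)"
proof -
  have "integrable (restrict_space lborel {0<..t}) (\<lambda>s. g (s, \<omega>))" if \<omega>: "\<omega> \<in> space M" for \<omega>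
    using path_integrable[OF t g \<omega>] K[OF \<omega>]
    by (subst integrable_restrict_space) (auto simp: set_integrable_def)
  from kernel_real_measurable[OF lebesgue_kernel[OF t] t g this] show ?thesis
    by (simp add: set_lebesgue_integral_def integral_restrict_space)
qed

text \<open>Both kernels have the same expected mass on generating rectangles by
  \<open>N_expected_increment\<close>, so \<open>kernel_expectation_eq\<close> applies to the
  positive and the negative part of \<open>g\<close>. The bound \<open>D\<close>, uniform in time,
  makes the Lebesgue side integrable, and the jump side inherits this from the equality for
  \<open>\<bar>g\<bar>\<close>.\<close>

lemma compensation:
  fixes g :: "real \<times> 'a \<Rightarrow> real"
  assumes t: "0 \<le> t" and g[measurable]: "g \<in> borel_measurable P" and D: "integrable M D"
    and K: "\<And>\<omega> s. \<omega> \<in> space M \<Longrightarrow> 0 < s \<Longrightarrow> s \<le> t \<Longrightarrow> \<bar>g (s, \<omega>)\<bar> \<le> D \<omega>"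
  shows "integrable M (\<lambda>\<omega>. \<Sum>r\<in>J i \<omega> \<inter> {0<..t}. g (r, \<omega>))"
    and "integrable M (\<lambda>\<omega>. LBINT s:{0<..t}. g (s, \<omega>))"
    and "(LINT \<omega>|M. (\<Sum>r\<in>J i \<omega> \<inter> {0<..t}. g (r, \<omega>))) = (LINT \<omega>|M. (LBINT s:{0<..t}. g (s, \<omega>)))"
proof -
  let ?\<kappa> = "\<lambda>\<omega>. count_space (J i \<omega> \<inter> {0<..t})" and ?L = "\<lambda>\<omega>::'a. restrict_space lborel {0<..t}"
  note k = jump_kernel[OF t, of i] and l = lebesgue_kernel[OF t]
  have gen: "(\<integral>\<^sup>+\<omega>. indicator A \<omega> * emeasure (?\<kappa> \<omega>) ({a<..b} \<inter> space (?\<kappa> \<omega>)) \<partial>M)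
      = (\<integral>\<^sup>+\<omega>. indicator A \<omega> * emeasure (?L \<omega>) ({a<..b} \<inter> space (?L \<omega>)) \<partial>M)"
    if ab: "0 \<le> a" "a \<le> b" "b \<le> t" and A: "A \<in> sets (F a)" for a b A
  proof -
    have "{a<..b} \<inter> {0<..t} = {a<..b}" using ab by auto
    then have "emeasure (restrict_space lborel {0<..t}) ({a<..b} \<inter> {0<..t}) = ennreal (b - a)"
      using ab by (subst emeasure_restrict_space) (auto simp: space_restrict_space)
    then have "(\<integral>\<^sup>+\<omega>. indicator A \<omega> * emeasure (?L \<omega>) ({a<..b} \<inter> space (?L \<omega>)) \<partial>M) = ennreal (b - a) * emeasure M A"
      using sets_F[OF ab(1) A] by (simp add: space_restrict_space nn_integral_multc) (rule mult.commute)
    also have "\<dots> = (\<integral>\<^sup>+\<omega>. indicator A \<omega> * ennreal (N i b \<omega> - N i a \<omega>) \<partial>M)"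
      by (rule N_expected_increment[OF ab(1,2) A, symmetric])
    also have "\<dots> = (\<integral>\<^sup>+\<omega>. indicator A \<omega> * emeasure (?\<kappa> \<omega>) ({a<..b} \<inter> space (?\<kappa> \<omega>)) \<partial>M)"
      by (intro nn_integral_cong) (simp add: emeasure_jump_kernel[OF _ ab])
    finally show ?thesis ..
  qed
  have "(\<integral>\<^sup>+\<omega>. emeasure (?\<kappa> \<omega>) (space (?\<kappa> \<omega>)) \<partial>M) = (\<integral>\<^sup>+\<omega>. indicator (space M) \<omega> * emeasure (?\<kappa> \<omega>) ({0<..t} \<inter> space (?\<kappa> \<omega>)) \<partial>M)"
    by (intro nn_integral_cong) (simp add: Int_absorb1)
  also have "\<dots> = (\<integral>\<^sup>+\<omega>. indicator (space M) \<omega> * emeasure (?L \<omega>) ({0<..t} \<inter> space (?L \<omega>)) \<partial>M)"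
    using t sets.top[of "F 0"] space_F[of 0] by (intro gen) auto
  also have "\<dots> \<le> (\<integral>\<^sup>+\<omega>. ennreal t \<partial>M)"
    using t by (intro nn_integral_mono) (simp add: space_restrict_space emeasure_restrict_space)
  also have "\<dots> < \<infinity>" by (simp add: emeasure_space_1)
  finally have fin: "(\<integral>\<^sup>+\<omega>. emeasure (?\<kappa> \<omega>) (space (?\<kappa> \<omega>)) \<partial>M) < \<infinity>" .
  have eq: "(\<integral>\<^sup>+\<omega>. (\<integral>\<^sup>+s. h (s, \<omega>) \<partial>?\<kappa> \<omega>) \<partial>M) = (\<integral>\<^sup>+\<omega>. (\<integral>\<^sup>+s. h (s, \<omega>) \<partial>?L \<omega>) \<partial>M)"
    if "h \<in> borel_measurable P" for h
    by (rule kernel_expectation_eq[OF k l t _ fin that]) (rule gen)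
  have D0: "0 \<le> D \<omega>" if "\<omega> \<in> space M" "0 < t" for \<omega> using K[OF that(1), of t] that(2) by (auto intro: order_trans[OF abs_ge_zero])
  have fl: "(\<integral>\<^sup>+\<omega>. (\<integral>\<^sup>+s. ennreal \<bar>g (s, \<omega>)\<bar> \<partial>?L \<omega>) \<partial>M) < \<infinity>"
  proof -
    have "(\<integral>\<^sup>+\<omega>. (\<integral>\<^sup>+s. ennreal \<bar>g (s, \<omega>)\<bar> \<partial>?L \<omega>) \<partial>M) \<le> (\<integral>\<^sup>+\<omega>. (\<integral>\<^sup>+s. ennreal (D \<omega>) \<partial>?L \<omega>) \<partial>M)"
      using K by (intro nn_integral_mono ennreal_leI) (auto simp: space_restrict_space)
    also have "\<dots> = (\<integral>\<^sup>+\<omega>. ennreal t * ennreal (D \<omega>) \<partial>M)"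
    proof (rule nn_integral_cong)
      fix \<omega>
      have "emeasure (?L \<omega>) (space (?L \<omega>)) = ennreal t"
        using t by (simp add: space_restrict_space emeasure_restrict_space)
      then show "(\<integral>\<^sup>+s. ennreal (D \<omega>) \<partial>?L \<omega>) = ennreal t * ennreal (D \<omega>)"
        by (simp only: nn_integral_const) (rule mult.commute)
    qed
    also have "\<dots> = ennreal t * (\<integral>\<^sup>+\<omega>. ennreal (D \<omega>) \<partial>M)"
      using D by (intro nn_integral_cmult) auto
    also have "\<dots> < \<infinity>"
      using D by (auto simp: real_integrable_def ennreal_mult_less_top less_top)
    finally show ?thesis .
  qed
  have m: "(\<lambda>w. ennreal \<bar>g w\<bar>) \<in> borel_measurable P" "(\<lambda>w. ennreal (g w)) \<in> borel_measurable P"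
    "(\<lambda>w. ennreal (- g w)) \<in> borel_measurable P" by measurable
  have fk: "(\<integral>\<^sup>+\<omega>. (\<integral>\<^sup>+s. ennreal \<bar>g (s, \<omega>)\<bar> \<partial>?\<kappa> \<omega>) \<partial>M) < \<infinity>"
    unfolding eq[OF m(1)] by (rule fl)
  have il: "integrable (?L \<omega>) (\<lambda>s. g (s, \<omega>))" if \<omega>: "\<omega> \<in> space M" for \<omega>
  proof -
    have "set_integrable lborel {0<..t} (\<lambda>s. g (s, \<omega>))" by (rule path_integrable[OF t g \<omega>, of "D \<omega>"]) (rule K[OF \<omega>])
    then show ?thesis by (subst integrable_restrict_space) (auto simp: set_integrable_def)
  qed
  have ik: "integrable (?\<kappa> \<omega>) (\<lambda>s. g (s, \<omega>))" if \<omega>: "\<omega> \<in> space M" for \<omega>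
    by (rule integrable_jump_kernel(1)[OF \<omega>])
  note EK = kernel_real_expectation[OF k t g _ fk, OF ik] and EL = kernel_real_expectation[OF l t g _ fl, OF il]
  have sum: "(LINT s|?\<kappa> \<omega>. g (s, \<omega>)) = (\<Sum>r\<in>J i \<omega> \<inter> {0<..t}. g (r, \<omega>))" if "\<omega> \<in> space M" for \<omega>
    by (rule integrable_jump_kernel(2)[OF that])
  have set: "(LINT s|?L \<omega>. g (s, \<omega>)) = (LBINT s:{0<..t}. g (s, \<omega>))" for \<omega>
    by (simp add: set_lebesgue_integral_def integral_restrict_space)
  have "integrable M (\<lambda>\<omega>. \<Sum>r\<in>J i \<omega> \<inter> {0<..t}. g (r, \<omega>)) \<longleftrightarrow> integrable M (\<lambda>\<omega>. LINT s|?\<kappa> \<omega>. g (s, \<omega>))"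
    by (rule Bochner_Integration.integrable_cong) (simp_all only: sum)
  then show "integrable M (\<lambda>\<omega>. \<Sum>r\<in>J i \<omega> \<inter> {0<..t}. g (r, \<omega>))" using EK(1) by blast
  show "integrable M (\<lambda>\<omega>. LBINT s:{0<..t}. g (s, \<omega>))" using EL(1) by (simp only: set)
  have "(LINT \<omega>|M. (\<Sum>r\<in>J i \<omega> \<inter> {0<..t}. g (r, \<omega>))) = (LINT \<omega>|M. (LINT s|?\<kappa> \<omega>. g (s, \<omega>)))"
    by (rule Bochner_Integration.integral_cong) (simp_all only: sum)
  also have "\<dots> = (LINT \<omega>|M. (LINT s|?L \<omega>. g (s, \<omega>)))"
    using EK(2) EL(2) by (simp only: eq[OF m(2)] eq[OF m(3)])
  finally show "(LINT \<omega>|M. (\<Sum>r\<in>J i \<omega> \<inter> {0<..t}. g (r, \<omega>))) = (LINT \<omega>|M. (LBINT s:{0<..t}. g (s, \<omega>)))"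
    by (simp only: set)
qed

end

section \<open>Bounds and factorisation for the exponential of a path\<close>

context marked_path
begin

lemma expo_left_nonneg: "0 \<le> expo_left J v t"
  unfolding expo_left_def by (intro mult_nonneg_nonneg prod_nonneg) (auto intro: v_nonneg)

lemma expo_left_0: "expo_left J v 0 = 1"
  by (simp add: expo_left_def set_lebesgue_integral_def)

lemma drift_set_integrable: "set_integrable lborel {s<..t} (drift v)"
proof -
  obtain B where B: "\<And>s. s \<le> t \<Longrightarrow> \<bar>drift v s\<bar> \<le> B" using drift_bounded by blast
  show ?thesis
    by (rule set_integrable_bounded_interval[of _ _ _ B]) (use B in \<open>auto simp: set_borel_measurable_def\<close>)
qed

lemma drift_ge: "- real CARD('d) \<le> drift v s"
proof -
  have "(\<Sum>i\<in>(UNIV::'d set). - 1) \<le> drift v s"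
    unfolding drift_def using v_nonneg by (intro sum_mono) simp
  then show ?thesis by simp
qed

lemma drift_integral_ge: "0 \<le> t \<Longrightarrow> - (real CARD('d) * t) \<le> (LBINT s:{0<..t}. drift v s)"
proof -
  assume t: "0 \<le> t"
  have i: "set_integrable lborel {0<..t} (\<lambda>_. - real CARD('d))"
    by (rule set_integrable_bounded_interval[of _ _ _ "real CARD('d)"]) (auto simp: set_borel_measurable_def)
  have "(LBINT s:{0<..t}. - real CARD('d)) \<le> (LBINT s:{0<..t}. drift v s)"
    by (rule set_integral_mono[OF i drift_set_integrable drift_ge])
  then show ?thesis using t by (simp add: set_lebesgue_integral_def mult.commute)
qed

text \<open>A bound for \<open>expo\<close> up to time \<open>t\<close>: with
  \<open>d = CARD('d)\<close> the drift is at least \<open>- d\<close>, whence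
  \<open>exp (d * t)\<close>, and factors below 1 are raised to 1, which makes the product
  nondecreasing in time.\<close>

definition envelope :: "real \<Rightarrow> real" where
  "envelope t = exp (real CARD('d) * t) * (\<Prod>i\<in>UNIV. \<Prod>r\<in>J i \<inter> {0<..t}. max 1 (v i r))"

lemma prod_le_prod_max:
  assumes "finite B" "A \<subseteq> B"
  shows "(\<Prod>r\<in>A. v i r) \<le> (\<Prod>r\<in>B. max 1 (v i r))"
proof -
  have "(\<Prod>r\<in>A. v i r) \<le> (\<Prod>r\<in>A. max 1 (v i r))" by (intro prod_mono) (simp add: v_nonneg)
  also have "\<dots> \<le> (\<Prod>r\<in>B. max 1 (v i r))" using assms by (intro prod_mono2) (auto intro: order_trans[OF zero_le_one])
  finally show ?thesis .
qed

lemma expo_le_envelope: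
  assumes "0 \<le> s" "s \<le> t"
  shows "expo J v s \<le> envelope t" "expo_left J v s \<le> envelope t"
proof -
  have "- (LBINT r:{0<..s}. drift v r) \<le> real CARD('d) * s" using drift_integral_ge[OF assms(1)] by simp
  also have "\<dots> \<le> real CARD('d) * t" using assms by (intro mult_left_mono) auto
  finally have e: "exp (- (LBINT r:{0<..s}. drift v r)) \<le> exp (real CARD('d) * t)" by simp
  have p: "(\<Prod>i\<in>UNIV. \<Prod>r\<in>J i \<inter> S. v i r) \<le> (\<Prod>i\<in>UNIV. \<Prod>r\<in>J i \<inter> {0<..t}. max 1 (v i r))" if "S \<subseteq> {0<..t}" for S
    by (intro prod_mono conjI prod_nonneg prod_le_prod_max J_finite') (use that v_nonneg in auto)
  show "expo J v s \<le> envelope t" unfolding expo_def envelope_def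
    by (intro mult_mono e p) (use assms in \<open>auto intro!: prod_nonneg simp: v_nonneg\<close>)
  show "expo_left J v s \<le> envelope t" unfolding expo_left_def envelope_def
    by (intro mult_mono e p) (use assms in \<open>auto intro!: prod_nonneg simp: v_nonneg\<close>)
qed

text \<open>\<open>expo_equation\<close> at both ends, subtracted. The restriction to times after
  \<open>u\<close> is put into the integrand, so that the terms live on \<open>(0, t]\<close>, the
  form needed by \<open>compensation\<close>.\<close>

lemma expo_increment:
  assumes ut: "0 \<le> u" "u \<le> t"
  shows "expo J v t - expo J v u = (\<Sum>i\<in>UNIV. (\<Sum>r\<in>J i \<inter> {0<..t}. if u < r then expo_left J v r * (v i r - 1) else 0)
    - (LBINT s:{0<..t}. if u < s then expo_left J v s * (v i s - 1) else 0))"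
proof -
  let ?g = "\<lambda>i s. expo_left J v s * (v i s - 1)"
  have t: "0 \<le> t" using ut by simp
  obtain K where K: "\<And>s. s \<in> {0<..t} \<Longrightarrow> \<bar>expo_left J v s\<bar> \<le> K" using expo_left_bounded by blast
  obtain L where L: "0 \<le> L" "\<And>i s. s \<le> t \<Longrightarrow> v i s \<le> L" using v_bounded' by blast
  have gi: "set_integrable lborel {0<..t} (?g i)" for i
  proof (rule set_integrable_bounded_interval)
    have "(\<lambda>s. indicator {0<..t} s *\<^sub>R expo_left J v s * (v i s - 1)) \<in> borel_measurable borel"
      using expo_left_measurable[of t] unfolding set_borel_measurable_def by measurable
    then show "set_borel_measurable borel {0<..t} (?g i)"
      unfolding set_borel_measurable_def by (simp add: mult.assoc)
    show "\<bar>?g i s\<bar> \<le> K * (L + 1)" if "s \<in> {0<..t}" for s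
    proof -
      have "\<bar>v i s - 1\<bar> \<le> L + 1" using L(2)[of s i] that v_nonneg[of i s] by (auto simp: abs_if)
      then show ?thesis unfolding abs_mult using K[OF that] by (intro mult_mono) (auto intro: order_trans[OF abs_ge_zero])
    qed
  qed
  have eq: "expo J v s - 1 = (\<Sum>i\<in>UNIV. (\<Sum>r\<in>J i \<inter> {0<..s}. ?g i r) - (LBINT r:{0<..s}. ?g i r))" if s: "0 \<le> s" "s \<le> t" for s
  proof -
    have gs: "set_integrable lborel {0<..s} (?g i)" for i
      by (rule set_integrable_subset[OF gi]) (use s in auto)
    have "(LBINT r:{0<..s}. expo_left J v r * drift v r) = (LBINT r:{0<..s}. \<Sum>i\<in>UNIV. ?g i r)"
      by (rule set_lebesgue_integral_cong) (auto simp: drift_def sum_distrib_left)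
    also have "\<dots> = (\<Sum>i\<in>UNIV. (LBINT r:{0<..s}. ?g i r))" by (rule set_integral_sum(2)[OF gs])
    finally show ?thesis using expo_equation[OF s(1)] by (simp add: sum_subtractf)
  qed
  have jump: "(\<Sum>r\<in>J i \<inter> {0<..t}. if u < r then ?g i r else 0) = (\<Sum>r\<in>J i \<inter> {0<..t}. ?g i r) - (\<Sum>r\<in>J i \<inter> {0<..u}. ?g i r)" for i
  proof -
    have "(\<Sum>r\<in>J i \<inter> {0<..t}. ?g i r) = (\<Sum>r\<in>J i \<inter> {0<..t} - J i \<inter> {0<..u}. ?g i r) + (\<Sum>r\<in>J i \<inter> {0<..u}. ?g i r)"
      by (rule sum.subset_diff) (use ut J_finite' in auto)
    moreover have "(\<Sum>r\<in>J i \<inter> {0<..t}. if u < r then ?g i r else 0) = (\<Sum>r\<in>J i \<inter> {0<..t} - J i \<inter> {0<..u}. ?g i r)"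
      by (rule sum.mono_neutral_cong_right) (use J_finite' in auto)
    ultimately show ?thesis by simp
  qed
  have int: "(LBINT s:{0<..t}. if u < s then ?g i s else 0) = (LBINT s:{0<..t}. ?g i s) - (LBINT s:{0<..u}. ?g i s)" for i
  proof -
    have "(LBINT s:{0<..t}. if u < s then ?g i s else 0) = (LBINT s:{u<..t}. ?g i s)"
      unfolding set_lebesgue_integral_def using ut
      by (intro Bochner_Integration.integral_cong) (auto split: split_indicator)
    then show ?thesis using set_integral_Ioc_split[OF gi ut] by simp
  qed
  have "expo J v t - expo J v u = (expo J v t - 1) - (expo J v u - 1)" by simp
  also have "\<dots> = (\<Sum>i\<in>UNIV. (\<Sum>r\<in>J i \<inter> {0<..t}. ?g i r) - (LBINT r:{0<..t}. ?g i r) - ((\<Sum>r\<in>J i \<inter> {0<..u}. ?g i r) - (LBINT r:{0<..u}. ?g i r)))"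
    unfolding eq[OF t order_refl] eq[OF ut] by (simp add: sum_subtractf)
  finally show ?thesis by (simp add: jump int algebra_simps)
qed

text \<open>A rate equal to 1 has no drift and contributes the factor 1 at its jumps, so the second
  exponential starts afresh at \<open>u\<close>.\<close>

lemma expo_multiplicative:
  assumes ut: "0 \<le> u" "u \<le> t"
  shows "expo J v t = expo J v u * expo J (\<lambda>i s. if u < s then v i s else 1) t"
proof -
  let ?w = "\<lambda>i s. if u < s then v i s else 1"
  have "(LBINT s:{0<..t}. drift ?w s) = (LBINT s:{u<..t}. drift v s)"
    unfolding set_lebesgue_integral_def using ut
    by (intro Bochner_Integration.integral_cong) (auto simp: drift_def split: split_indicator)
  then have 1: "(LBINT s:{0<..t}. drift v s) = (LBINT s:{0<..u}. drift v s) + (LBINT s:{0<..t}. drift ?w s)"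
    using set_integral_Ioc_split[OF drift_set_integrable ut] by simp
  have 2: "(\<Prod>r\<in>J i \<inter> {0<..t}. v i r) = (\<Prod>r\<in>J i \<inter> {0<..u}. v i r) * (\<Prod>r\<in>J i \<inter> {0<..t}. ?w i r)" for i
  proof -
    have "(\<Prod>r\<in>J i \<inter> {0<..t}. v i r) = (\<Prod>r\<in>J i \<inter> {0<..t} - J i \<inter> {0<..u}. v i r) * (\<Prod>r\<in>J i \<inter> {0<..u}. v i r)"
      by (rule prod.subset_diff) (use ut J_finite' in auto)
    moreover have "(\<Prod>r\<in>J i \<inter> {0<..t}. ?w i r) = (\<Prod>r\<in>J i \<inter> {0<..t} - J i \<inter> {0<..u}. v i r)"
      by (rule prod.mono_neutral_cong_right) (use J_finite' in auto)
    ultimately show ?thesis by simp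
  qed
  show ?thesis unfolding expo_def 1 2 by (simp add: prod.distrib exp_add[symmetric])
qed

end

lemma expo_cong:
  assumes "\<And>i s. 0 < s \<Longrightarrow> s \<le> t \<Longrightarrow> v i s = w i s"
  shows "expo J v t = expo J w t"
proof -
  have "(LBINT s:{0<..t}. drift v s) = (LBINT s:{0<..t}. drift w s)"
    by (rule set_lebesgue_integral_cong) (auto simp: drift_def assms)
  moreover have "(\<Prod>r\<in>J i \<inter> {0<..t}. v i r) = (\<Prod>r\<in>J i \<inter> {0<..t}. w i r)" for i
    by (rule prod.cong) (auto simp: assms)
  ultimately show ?thesis by (simp add: expo_def)
qed

lemma expo_trivial: "(\<And>i s. 0 < s \<Longrightarrow> s \<le> t \<Longrightarrow> v i s = 1) \<Longrightarrow> expo J v t = 1"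
  by (subst expo_cong[of t v "\<lambda>i s. 1"]) (auto simp: expo_def drift_def)

text \<open>Rewrites a product over jump times through sums, whose adaptedness is available from
  \<open>adapted_jump_sum\<close>. Zero factors are counted separately, since the exponential of a
  sum of logarithms is never 0.\<close>

lemma prod_eq_exp_sum_ln:
  fixes f :: "'b \<Rightarrow> real"
  assumes "finite S" "\<And>r. r \<in> S \<Longrightarrow> 0 \<le> f r"
  shows "(\<Prod>r\<in>S. f r) = (if (\<Sum>r\<in>S. if f r = 0 then 1 else 0) = (0 :: real) then exp (\<Sum>r\<in>S. ln (f r)) else 0)"
proof (cases "\<exists>r\<in>S. f r = 0")
  case True
  then obtain r where r: "r \<in> S" "f r = 0" by blast
  then have "(\<Prod>r\<in>S. f r) = 0" using assms(1) by (auto simp: prod_zero_iff)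
  moreover have "(1::real) \<le> (\<Sum>r\<in>S. if f r = 0 then 1 else 0)"
    using member_le_sum[of r S "\<lambda>r. if f r = 0 then 1 else (0::real)"] r assms(1) by simp
  ultimately show ?thesis by simp
next
  case False
  then have "(\<Prod>r\<in>S. f r) = (\<Prod>r\<in>S. exp (ln (f r)))"
    using assms(2) by (intro prod.cong) (auto simp: order.strict_iff_order)
  then show ?thesis using False assms(1) by (auto simp: exp_sum)
qed

context unit_intensity
begin

section \<open>Exponential processes\<close>

text \<open>
  The value \<open>1\<close> at times \<open>s \<le> 0\<close> is a convention: it makes the paths Borel on the whole line.
\<close>

definition rate :: "('d \<Rightarrow> 'a process) \<Rightarrow> bool" where
  "rate v \<longleftrightarrow> (\<forall>i. (\<lambda>w. v i (fst w) (snd w)) \<in> borel_measurable P) \<and> (\<forall>i s. \<forall>\<omega>\<in>space M. 0 \<le> v i s \<omega>) \<and>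
    (\<forall>i s. \<forall>\<omega>\<in>space M. s \<le> 0 \<longrightarrow> v i s \<omega> = 1) \<and> (\<forall>\<omega>\<in>space M. \<forall>t. \<exists>K. \<forall>i. \<forall>s\<le>t. v i s \<omega> \<le> K)"

lemma rateD:
  assumes "rate v"
  shows rate_predictable: "(\<lambda>w. v i (fst w) (snd w)) \<in> borel_measurable P"
    and rate_nonneg: "\<omega> \<in> space M \<Longrightarrow> 0 \<le> v i s \<omega>"
    and rate_past: "\<omega> \<in> space M \<Longrightarrow> s \<le> 0 \<Longrightarrow> v i s \<omega> = 1"
    and rate_bounded: "\<omega> \<in> space M \<Longrightarrow> \<exists>K. \<forall>i. \<forall>s\<le>t. v i s \<omega> \<le> K"
  using assms unfolding rate_def by blast+

lemma rate_marked_path: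
  assumes v: "rate v" and \<omega>: "\<omega> \<in> space M"
  shows "marked_path (\<lambda>i. J i \<omega>) (\<lambda>i s. v i s \<omega>)"
proof
  fix i t
  have "(\<lambda>s. v i s \<omega>) \<in> borel_measurable (restrict_space borel {0..})"
    using measurable_section'[OF \<omega> rate_predictable[OF v, of i]] by simp
  then have "(\<lambda>s. indicator {0..} s *\<^sub>R v i s \<omega>) \<in> borel_measurable borel"
    by (subst (asm) borel_measurable_restrict_space_iff) auto
  then have "(\<lambda>s. if 0 \<le> s then indicator {0..} s *\<^sub>R v i s \<omega> else 1) \<in> borel_measurable borel" by measurable
  then show "(\<lambda>s. v i s \<omega>) \<in> borel_measurable borel"
    by (rule measurable_congI) (auto simp: rate_past[OF v \<omega>])
  show "finite (J i \<omega> \<inter> {..t})" by (rule J_finite[OF \<omega>])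
  show "0 \<le> v i s \<omega>" for s by (rule rate_nonneg[OF v \<omega>])
  show "\<exists>K. \<forall>i. \<forall>s\<le>t. v i s \<omega> \<le> K" by (rule rate_bounded[OF v \<omega>])
qed (rule J_disjoint[OF \<omega>])

definition Z :: "('d \<Rightarrow> 'a process) \<Rightarrow> 'a process" where
  "Z v t \<omega> = expo (\<lambda>i. J i \<omega>) (\<lambda>i s. v i s \<omega>) t"

definition Z_left :: "('d \<Rightarrow> 'a process) \<Rightarrow> 'a process" where
  "Z_left v t \<omega> = expo_left (\<lambda>i. J i \<omega>) (\<lambda>i s. v i s \<omega>) t"

lemma Z_nonneg: "rate v \<Longrightarrow> \<omega> \<in> space M \<Longrightarrow> 0 \<le> Z v t \<omega>"
  unfolding Z_def by (rule marked_path.expo_nonneg[OF rate_marked_path])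

lemma cadlag_Z: "rate v \<Longrightarrow> \<omega> \<in> space M \<Longrightarrow> cadlag (\<lambda>t. Z v t \<omega>)"
  unfolding Z_def by (rule marked_path.cadlag_expo[OF rate_marked_path])

lemma drift_predictable: "rate v \<Longrightarrow> (\<lambda>w. drift (\<lambda>i s. v i s (snd w)) (fst w)) \<in> borel_measurable P"
proof -
  assume v: "rate v"
  note rate_predictable[OF v, measurable]
  show ?thesis unfolding drift_def by measurable
qed

lemma adapted_drift_integral:
  assumes v: "rate v" and t: "0 \<le> t"
  shows "(\<lambda>\<omega>. LBINT s:{0<..t}. drift (\<lambda>i s. v i s \<omega>) s) \<in> borel_measurable (F t)"
proof -
  have "\<exists>K. \<forall>s. 0 < s \<longrightarrow> s \<le> t \<longrightarrow> \<bar>drift (\<lambda>i s. v i s (snd (s, \<omega>))) (fst (s, \<omega>))\<bar> \<le> K" if \<omega>: "\<omega> \<in> space M" for \<omega>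
  proof -
    obtain B where "\<And>s. s \<le> t \<Longrightarrow> \<bar>drift (\<lambda>i s. v i s \<omega>) s\<bar> \<le> B"
      using marked_path.drift_bounded[OF rate_marked_path[OF v \<omega>]] by blast
    then show ?thesis by (intro exI[of _ B]) simp
  qed
  then have "(\<lambda>\<omega>. LBINT s:{0<..t}. (\<lambda>w. drift (\<lambda>i s. v i s (snd w)) (fst w)) (s, \<omega>)) \<in> borel_measurable (F t)"
    by (intro adapted_integral[OF t drift_predictable[OF v]]) simp
  then show ?thesis by simp
qed

lemma adapted_Z:
  assumes v: "rate v" and t: "0 \<le> t"
  shows "Z v t \<in> borel_measurable (F t)"
proof -
  note rate_predictable[OF v, measurable]
  have g: "(\<lambda>w. if v i (fst w) (snd w) = 0 then 1 else (0::real)) \<in> borel_measurable P"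
    "(\<lambda>w. ln (v i (fst w) (snd w))) \<in> borel_measurable P" for i by measurable
  note [measurable] = adapted_jump_sum[OF t g(1)] adapted_jump_sum[OF t g(2)] adapted_drift_integral[OF v t]
  let ?f = "\<lambda>\<omega>. exp (- (LBINT s:{0<..t}. drift (\<lambda>i s. v i s \<omega>) s)) *
    (\<Prod>i\<in>UNIV. if (\<Sum>r\<in>J i \<omega> \<inter> {0<..t}. if v i (fst (r, \<omega>)) (snd (r, \<omega>)) = 0 then 1 else 0) = (0::real)
      then exp (\<Sum>r\<in>J i \<omega> \<inter> {0<..t}. ln (v i (fst (r, \<omega>)) (snd (r, \<omega>)))) else 0)"
  have "?f \<in> borel_measurable (F t)" by measurable
  then show ?thesis
  proof (rule measurable_congI)
    fix \<omega> assume "\<omega> \<in> space (F t)"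
    then have \<omega>: "\<omega> \<in> space M" using space_F[OF t] by simp
    have "(\<Prod>r\<in>J i \<omega> \<inter> {0<..t}. v i r \<omega>) = (if (\<Sum>r\<in>J i \<omega> \<inter> {0<..t}. if v i r \<omega> = 0 then 1 else 0) = (0::real)
      then exp (\<Sum>r\<in>J i \<omega> \<inter> {0<..t}. ln (v i r \<omega>)) else 0)" for i
      by (rule prod_eq_exp_sum_ln[OF J_finite_Ioc[OF \<omega>] rate_nonneg[OF v \<omega>]])
    then show "?f \<omega> = Z v t \<omega>" unfolding Z_def expo_def fst_conv snd_conv by (simp only:)
  qed
qed

lemma Z_measurable: "rate v \<Longrightarrow> 0 \<le> t \<Longrightarrow> Z v t \<in> borel_measurable M"
  by (rule measurable_F_M[OF _ adapted_Z])

lemma predictable_Z_left: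
  assumes v: "rate v"
  shows "(\<lambda>w. Z_left v (fst w) (snd w)) \<in> borel_measurable P"
proof -
  have "adapted F (Z v)" unfolding adapted_def using adapted_Z[OF v] by blast
  \<comment> \<open>The default 1 is the value of \<open>Z_left\<close> at time 0.\<close>
  from predictable_left_limit[OF this cadlag_Z[OF v], of 1] show ?thesis
  proof (rule measurable_congI)
    fix w assume w: "w \<in> space P"
    then have \<omega>: "snd w \<in> space M" by (auto simp: space_P)
    show "(if 0 < fst w then left_limit (\<lambda>t. Z v t (snd w)) (fst w) else 1) = Z_left v (fst w) (snd w)"
      using w marked_path.left_limit_expo[OF rate_marked_path[OF v \<omega>], of "fst w"] marked_path.expo_left_0[OF rate_marked_path[OF v \<omega>]]
      by (cases "fst w = 0") (auto simp: Z_def Z_left_def space_P)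
  qed
qed

text \<open>With \<open>g i\<close> equal to \<open>Z_left * (v i - 1)\<close> on \<open>A\<close>
  after time \<open>u\<close>, the increment of \<open>Z\<close> is the sum over \<open>i\<close> of
  the jump sum of \<open>g i\<close> minus its time integral, and these have equal expectation by
  \<open>compensation\<close>. The bound \<open>K\<close> on the rate and the bound \<open>D\<close>
  on \<open>Z_left\<close> together dominate \<open>g\<close>.\<close>

lemma Z_expected_increment:
  assumes v: "rate v" and K: "\<And>i s \<omega>. \<omega> \<in> space M \<Longrightarrow> v i s \<omega> \<le> K"
    and D: "integrable M D" "\<And>\<omega> s. \<omega> \<in> space M \<Longrightarrow> 0 < s \<Longrightarrow> s \<le> t \<Longrightarrow> Z_left v s \<omega> \<le> D \<omega>"
    and ut: "0 \<le> u" "u \<le> t" and A: "A \<in> sets (F u)"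
  shows "integrable M (\<lambda>\<omega>. indicator A \<omega> * (Z v t \<omega> - Z v u \<omega>))"
    and "(LINT \<omega>|M. indicator A \<omega> * (Z v t \<omega> - Z v u \<omega>)) = 0"
proof -
  have t: "0 \<le> t" using ut by simp
  define g where "g = (\<lambda>i w. if u < fst w \<and> snd w \<in> A then Z_left v (fst w) (snd w) * (v i (fst w) (snd w) - 1) else 0)"
  have g[measurable]: "g i \<in> borel_measurable P" for i
    unfolding g_def using predictable_after[OF ut(1) A] predictable_Z_left[OF v] rate_predictable[OF v, of i]
    by measurable
  have D': "integrable M (\<lambda>\<omega>. D \<omega> * (K + 1))" using D by simp
  have gb: "\<bar>g i (s, \<omega>)\<bar> \<le> D \<omega> * (K + 1)" if \<omega>: "\<omega> \<in> space M" and s: "0 < s" "s \<le> t" for i s \<omega>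
  proof -
    have z: "0 \<le> Z_left v s \<omega>" unfolding Z_left_def by (rule marked_path.expo_left_nonneg[OF rate_marked_path[OF v \<omega>]])
    have "\<bar>v i s \<omega> - 1\<bar> \<le> K + 1" using K[OF \<omega>, of i s] rate_nonneg[OF v \<omega>, of i s] by (auto simp: abs_if)
    then have "Z_left v s \<omega> * \<bar>v i s \<omega> - 1\<bar> \<le> D \<omega> * (K + 1)"
      using D(2)[OF \<omega> s] z by (intro mult_mono) auto
    moreover have "0 \<le> Z_left v s \<omega> * \<bar>v i s \<omega> - 1\<bar>" using z by simp
    ultimately show ?thesis using z order_trans[of 0 "Z_left v s \<omega> * \<bar>v i s \<omega> - 1\<bar>" "D \<omega> * (K + 1)"]
      by (auto simp: g_def abs_mult)
  qed
  note C = compensation[OF t g D' gb]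
  have eq: "indicator A \<omega> * (Z v t \<omega> - Z v u \<omega>) = (\<Sum>i\<in>UNIV. (\<Sum>r\<in>J i \<omega> \<inter> {0<..t}. g i (r, \<omega>)) - (LBINT s:{0<..t}. g i (s, \<omega>)))"
    if \<omega>: "\<omega> \<in> space M" for \<omega>
    unfolding Z_def marked_path.expo_increment[OF rate_marked_path[OF v \<omega>] ut]
    by (cases "\<omega> \<in> A") (simp_all add: g_def Z_left_def set_lebesgue_integral_def cong: if_cong)
  have I: "integrable M (\<lambda>\<omega>. \<Sum>i\<in>UNIV. (\<Sum>r\<in>J i \<omega> \<inter> {0<..t}. g i (r, \<omega>)) - (LBINT s:{0<..t}. g i (s, \<omega>)))"
    by (intro Bochner_Integration.integrable_sum Bochner_Integration.integrable_diff C(1,2))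
  have "integrable M (\<lambda>\<omega>. indicator A \<omega> * (Z v t \<omega> - Z v u \<omega>)) \<longleftrightarrow> integrable M (\<lambda>\<omega>. \<Sum>i\<in>UNIV. (\<Sum>r\<in>J i \<omega> \<inter> {0<..t}. g i (r, \<omega>)) - (LBINT s:{0<..t}. g i (s, \<omega>)))"
    by (rule Bochner_Integration.integrable_cong[OF refl eq])
  then show "integrable M (\<lambda>\<omega>. indicator A \<omega> * (Z v t \<omega> - Z v u \<omega>))" using I by blast
  have "(LINT \<omega>|M. indicator A \<omega> * (Z v t \<omega> - Z v u \<omega>)) = (LINT \<omega>|M. (\<Sum>i\<in>UNIV. (\<Sum>r\<in>J i \<omega> \<inter> {0<..t}. g i (r, \<omega>)) - (LBINT s:{0<..t}. g i (s, \<omega>))))"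
    by (rule Bochner_Integration.integral_cong[OF refl eq])
  also have "\<dots> = (\<Sum>i\<in>UNIV. (LINT \<omega>|M. (\<Sum>r\<in>J i \<omega> \<inter> {0<..t}. g i (r, \<omega>))) - (LINT \<omega>|M. (LBINT s:{0<..t}. g i (s, \<omega>))))"
    using C(1,2) by (simp add: Bochner_Integration.integral_sum Bochner_Integration.integral_diff)
  also have "\<dots> = 0" by (simp add: C(3))
  finally show "(LINT \<omega>|M. indicator A \<omega> * (Z v t \<omega> - Z v u \<omega>)) = 0" .
qed

text \<open>Since \<open>v\<close> equals 1 up to \<open>u\<close>, the exponential is still 1 at
  \<open>u\<close>, and only the increment after \<open>u\<close> has to be integrated over
  \<open>A\<close>.\<close>

lemma Z_expectation_dominated:
  assumes v: "rate v" and K: "\<And>i s \<omega>. \<omega> \<in> space M \<Longrightarrow> v i s \<omega> \<le> K"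
    and D: "integrable M D" "\<And>\<omega> s. \<omega> \<in> space M \<Longrightarrow> 0 < s \<Longrightarrow> s \<le> t \<Longrightarrow> Z_left v s \<omega> \<le> D \<omega>"
    and ut: "0 \<le> u" "u \<le> t" and A: "A \<in> sets (F u)"
    and v1: "\<And>i s \<omega>. \<omega> \<in> space M \<Longrightarrow> s \<le> u \<Longrightarrow> v i s \<omega> = 1"
  shows "integrable M (Z v t)" and "(\<integral>\<^sup>+\<omega>. indicator A \<omega> * ennreal (Z v t \<omega>) \<partial>M) = emeasure M A"
proof -
  have AM[measurable]: "A \<in> sets M" by (rule sets_F[OF ut(1) A])
  have Zu: "Z v u \<omega> = 1" if "\<omega> \<in> space M" for \<omega>
    unfolding Z_def by (rule expo_trivial) (use v1[OF that] in auto)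
  have I: "integrable M (\<lambda>\<omega>. indicator B \<omega> * Z v t \<omega>) \<and> (LINT \<omega>|M. indicator B \<omega> * Z v t \<omega>) = measure M B"
    if B: "B \<in> sets (F u)" for B
  proof -
    have BM: "B \<in> sets M" by (rule sets_F[OF ut(1) B])
    note E = Z_expected_increment[OF v K D ut B]
    have eq: "indicator B \<omega> * Z v t \<omega> = indicator B \<omega> * (Z v t \<omega> - Z v u \<omega>) + indicator B \<omega>" if "\<omega> \<in> space M" for \<omega>
      using Zu[OF that] by (simp add: algebra_simps)
    have ind: "integrable M (indicator B :: 'a \<Rightarrow> real)" using BM by (simp add: less_top[symmetric])
    have "integrable M (\<lambda>\<omega>. indicator B \<omega> * Z v t \<omega>) \<longleftrightarrow> integrable M (\<lambda>\<omega>. indicator B \<omega> * (Z v t \<omega> - Z v u \<omega>) + indicator B \<omega>)"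
      by (rule Bochner_Integration.integrable_cong[OF refl eq])
    moreover have "(LINT \<omega>|M. indicator B \<omega> * Z v t \<omega>) = (LINT \<omega>|M. indicator B \<omega> * (Z v t \<omega> - Z v u \<omega>) + indicator B \<omega>)"
      by (rule Bochner_Integration.integral_cong[OF refl eq])
    ultimately show ?thesis using E ind BM by (simp add: Bochner_Integration.integral_add)
  qed
  have "space M \<in> sets (F u)" using sets.top[of "F u"] space_F[OF ut(1)] by simp
  from I[OF this] have "integrable M (\<lambda>\<omega>. indicator (space M) \<omega> * Z v t \<omega>)" by blast
  then show "integrable M (Z v t)"
    by (rule Bochner_Integration.integrable_cong[THEN iffD1, rotated 2]) auto
  have "(\<integral>\<^sup>+\<omega>. ennreal (indicator A \<omega> * Z v t \<omega>) \<partial>M) = ennreal (measure M A)"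
    using I[OF A] Z_nonneg[OF v] by (subst nn_integral_eq_integral) (auto split: split_indicator)
  moreover have "(\<integral>\<^sup>+\<omega>. ennreal (indicator A \<omega> * Z v t \<omega>) \<partial>M) = (\<integral>\<^sup>+\<omega>. indicator A \<omega> * ennreal (Z v t \<omega>) \<partial>M)"
    by (rule nn_integral_cong) (auto split: split_indicator)
  ultimately show "(\<integral>\<^sup>+\<omega>. indicator A \<omega> * ennreal (Z v t \<omega>) \<partial>M) = emeasure M A" by (simp add: emeasure_eq_measure)
qed

end

section \<open>Expectations of exponentials: truncated, general and bounded rates\<close>

lemma card_small_rank_le:
  assumes S: "finite (S :: 'b::linorder set)"
  shows "card {r\<in>S. card {q\<in>S. q < r} < n} \<le> n"
proof -
  let ?T = "{r\<in>S. card {q\<in>S. q < r} < n}"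
  \<comment> \<open>The number of smaller elements determines the element.\<close>
  have "inj_on (\<lambda>r. card {q\<in>S. q < r}) ?T"
  proof (rule linorder_inj_onI)
    fix x y assume xy: "x < y" "x \<in> ?T" "y \<in> ?T"
    have "{q\<in>S. q < x} \<subset> {q\<in>S. q < y}" using xy by auto
    then have "card {q\<in>S. q < x} < card {q\<in>S. q < y}" using S by (intro psubset_card_mono) auto
    then show "card {q\<in>S. q < x} \<noteq> card {q\<in>S. q < y}" by simp
  qed auto
  then have "card ?T \<le> card {..<n}" by (rule card_inj_on_le) auto
  then show ?thesis by simp
qed

context unit_intensity
begin

text \<open>A jump at \<open>s\<close> itself does not count, which makes this the left limit of an
  adapted path and hence predictable.\<close>

definition jumps_before :: "'d \<Rightarrow> 'a process" where
  "jumps_before i s \<omega> = real (card (J i \<omega> \<inter> {0<..<s}))"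

lemma rate_one: "rate (\<lambda>i s \<omega>. 1)"
  unfolding rate_def by (auto intro: exI[of _ 1])

lemma predictable_jumps_before: "(\<lambda>w. jumps_before i (fst w) (snd w)) \<in> borel_measurable P"
proof -
  let ?C = "\<lambda>t \<omega>. N i t \<omega> - N i 0 \<omega>"
  have ad: "adapted F ?C" unfolding adapted_def
    using N_adapted measurable_F_mono[OF order_refl _ N_adapted[OF order_refl, of i]]
    by (auto intro!: borel_measurable_diff)
  have lim: "((\<lambda>t. ?C t \<omega>) \<longlongrightarrow> jumps_before i s \<omega>) (at_left s)" if \<omega>: "\<omega> \<in> space M" and s: "0 < s" for s \<omega>
  proof (rule tendsto_eventually)
    interpret marked_path "\<lambda>i. J i \<omega>" "\<lambda>i s. 1" by (rule rate_marked_path[OF rate_one \<omega>])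
    have "\<forall>\<^sub>F r in at_left s. 0 < r" using s by (auto simp: eventually_at_left_field)
    then show "\<forall>\<^sub>F r in at_left s. ?C r \<omega> = jumps_before i s \<omega>"
      using jumps_eventually_at_left[OF s]
    proof eventually_elim
      case (elim r)
      then have "card (J i \<omega> \<inter> {0<..r}) = card (J i \<omega> \<inter> {0<..<s})" by simp
      then show ?case using N_increment[OF \<omega>, of 0 r i] elim(1) by (simp add: jumps_before_def)
    qed
  qed
  have cad: "cadlag (\<lambda>t. ?C t \<omega>)" if \<omega>: "\<omega> \<in> space M" for \<omega>
    unfolding cadlag_def
  proof (intro conjI allI impI)
    have "cadlag (\<lambda>t. N i t \<omega>)" using counting \<omega> unfolding counting_process_def by blast
    then show "((\<lambda>t. ?C t \<omega>) \<longlongrightarrow> ?C t \<omega>) (at_right t)" if "0 \<le> t" for t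
      using that unfolding cadlag_def by (intro tendsto_diff tendsto_const) blast
    show "\<exists>l. ((\<lambda>t. ?C t \<omega>) \<longlongrightarrow> l) (at_left t)" if "0 < t" for t using lim[OF \<omega> that] by blast
  qed
  from predictable_left_limit[OF ad cad, of 0] show ?thesis
  proof (rule measurable_congI)
    fix w assume w: "w \<in> space P"
    show "(if 0 < fst w then left_limit (\<lambda>t. ?C t (snd w)) (fst w) else 0) = jumps_before i (fst w) (snd w)"
    proof (cases "0 < fst w")
      case True
      then show ?thesis using left_limit_eqI[OF lim, of "snd w" "fst w"] w by (auto simp: space_P)
    next
      case False
      then have "{0<..<fst w} = {}" by auto
      then show ?thesis using False by (simp add: jumps_before_def)
    qed
  qed
qed

text \<open>Only the first \<open>n\<close> jumps of each coordinate count, each by a factor at most \<open>n + 1\<close>, so the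
  exponential of the truncated rate is bounded on compact time intervals.\<close>

definition truncate :: "nat \<Rightarrow> ('d \<Rightarrow> 'a process) \<Rightarrow> 'd \<Rightarrow> 'a process" where
  "truncate n v i s \<omega> = (if v i s \<omega> \<le> real (Suc n) \<and> jumps_before i s \<omega> < real n then v i s \<omega> else 1)"

lemma rate_truncate:
  assumes v: "rate v"
  shows "rate (truncate n v)"
  unfolding rate_def
proof (intro conjI allI ballI impI)
  fix i s t \<omega>
  note rate_predictable[OF v, measurable] predictable_jumps_before[measurable]
  show "(\<lambda>w. truncate n v i (fst w) (snd w)) \<in> borel_measurable P" unfolding truncate_def by measurable
  assume \<omega>: "\<omega> \<in> space M"
  show "0 \<le> truncate n v i s \<omega>" using rate_nonneg[OF v \<omega>] by (simp add: truncate_def)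
  show "truncate n v i s \<omega> = 1" if "s \<le> 0" using rate_past[OF v \<omega> that] by (simp add: truncate_def)
  show "\<exists>K. \<forall>i. \<forall>s\<le>t. truncate n v i s \<omega> \<le> K"
    by (rule exI[of _ "real (Suc n)"]) (auto simp: truncate_def)
qed

lemma envelope_truncate:
  assumes v: "rate v" and \<omega>: "\<omega> \<in> space M" and s: "0 < s" "s \<le> t"
  shows "Z_left (truncate n v) s \<omega> \<le> exp (real CARD('d) * t) * (real (Suc n) ^ n) ^ CARD('d)"
proof -
  interpret marked_path "\<lambda>i. J i \<omega>" "\<lambda>i s. truncate n v i s \<omega>" by (rule rate_marked_path[OF rate_truncate[OF v] \<omega>])
  have p: "(\<Prod>r\<in>J i \<omega> \<inter> {0<..t}. max 1 (truncate n v i r \<omega>)) \<le> real (Suc n) ^ n" for i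
  proof -
    let ?S = "J i \<omega> \<inter> {0<..t}"
    \<comment> \<open>The jumps with fewer than \<open>n\<close> predecessors; at all later ones the
      truncated rate is 1. By \<open>card_small_rank_le\<close> at most \<open>n\<close> factors
      remain.\<close>
    let ?T = "{r\<in>?S. card {q\<in>?S. q < r} < n}"
    have fin: "finite ?S" by (rule J_finite_Ioc[OF \<omega>])
    have one: "max 1 (truncate n v i r \<omega>) = 1" if "r \<in> ?S - ?T" for r
    proof -
      have "J i \<omega> \<inter> {0<..<r} = {q\<in>?S. q < r}" using that by auto
      then have "\<not> jumps_before i r \<omega> < real n" using that by (simp add: jumps_before_def)
      then show ?thesis by (simp add: truncate_def)
    qed
    have "(\<Prod>r\<in>?S. max 1 (truncate n v i r \<omega>)) = (\<Prod>r\<in>?T. max 1 (truncate n v i r \<omega>))"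
      by (rule prod.mono_neutral_right[OF fin]) (use one in auto)
    also have "\<dots> \<le> (\<Prod>r\<in>?T. real (Suc n))" by (intro prod_mono) (auto simp: truncate_def)
    also have "\<dots> = real (Suc n) ^ card ?T" by simp
    also have "\<dots> \<le> real (Suc n) ^ n" by (rule power_increasing[OF card_small_rank_le[OF fin]]) simp
    finally show ?thesis .
  qed
  have "Z_left (truncate n v) s \<omega> \<le> envelope t"
    unfolding Z_left_def using expo_le_envelope(2)[of s t] s by simp
  also have "\<dots> \<le> exp (real CARD('d) * t) * (\<Prod>i\<in>(UNIV::'d set). real (Suc n) ^ n)"
    unfolding envelope_def by (intro mult_left_mono prod_mono conjI p prod_nonneg) auto
  finally show ?thesis by simp
qed

lemma truncate_eventually:
  assumes v: "rate v" and \<omega>: "\<omega> \<in> space M"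
  shows "\<forall>\<^sub>F n in sequentially. Z (truncate n v) t \<omega> = Z v t \<omega>"
proof -
  obtain K where K: "\<And>i s. s \<le> t \<Longrightarrow> v i s \<omega> \<le> K" using rate_bounded[OF v \<omega>, of t] by blast
  \<comment> \<open>The sum over the coordinates bounds the number of jumps of each, so one
    \<open>n0\<close> serves all of them.\<close>
  obtain n0 where n0: "max K (\<Sum>i\<in>UNIV. real (card (J i \<omega> \<inter> {0<..t}))) < real n0"
    using reals_Archimedean2 by blast
  have "Z (truncate n v) t \<omega> = Z v t \<omega>" if n: "n0 \<le> n" for n
    unfolding Z_def
  proof (rule expo_cong)
    fix i s assume s: "0 < s" "s \<le> t"
    have "jumps_before i s \<omega> \<le> real (card (J i \<omega> \<inter> {0<..t}))"
      unfolding jumps_before_def using s by (intro of_nat_mono card_mono J_finite_Ioc[OF \<omega>]) auto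
    also have "\<dots> \<le> (\<Sum>i\<in>UNIV. real (card (J i \<omega> \<inter> {0<..t})))" by (rule member_le_sum) auto
    also have "\<dots> < real n" using n0 n by linarith
    finally have "jumps_before i s \<omega> < real n" .
    moreover have "v i s \<omega> \<le> real (Suc n)" using K[OF s(2), of i] n0 n by linarith
    ultimately show "truncate n v i s \<omega> = v i s \<omega>" by (simp add: truncate_def)
  qed
  then show ?thesis unfolding eventually_sequentially by blast
qed

text \<open>For truncated rates there is equality by \<open>Z_expectation_dominated\<close>, with a
  constant as dominating variable. For a fixed sample point the truncation has no effect up to
  \<open>t\<close> once \<open>n\<close> is large, and Fatou's lemma leaves the inequality.\<close>

lemma Z_supermartingale:
  assumes v: "rate v" and ut: "0 \<le> u" "u \<le> t" and A: "A \<in> sets (F u)"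
    and v1: "\<And>i s \<omega>. \<omega> \<in> space M \<Longrightarrow> s \<le> u \<Longrightarrow> v i s \<omega> = 1"
  shows "(\<integral>\<^sup>+\<omega>. indicator A \<omega> * ennreal (Z v t \<omega>) \<partial>M) \<le> emeasure M A"
proof -
  have t: "0 \<le> t" using ut by simp
  have AM[measurable]: "A \<in> sets M" by (rule sets_F[OF ut(1) A])
  note [measurable] = Z_measurable[OF rate_truncate[OF v] t]
  have E: "(\<integral>\<^sup>+\<omega>. indicator A \<omega> * ennreal (Z (truncate n v) t \<omega>) \<partial>M) = emeasure M A" for n
  proof (rule Z_expectation_dominated(2)[OF rate_truncate[OF v] _ _ _ ut A])
    show "truncate n v i s \<omega> \<le> real (Suc n)" for i s \<omega> by (simp add: truncate_def)
    show "integrable M (\<lambda>\<omega>. exp (real CARD('d) * t) * (real (Suc n) ^ n) ^ CARD('d))" by simp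
    show "truncate n v i s \<omega> = 1" if "\<omega> \<in> space M" "s \<le> u" for i s \<omega>
      using v1[OF that] by (simp add: truncate_def)
  qed (rule envelope_truncate[OF v])
  have "(\<integral>\<^sup>+\<omega>. indicator A \<omega> * ennreal (Z v t \<omega>) \<partial>M) = (\<integral>\<^sup>+\<omega>. liminf (\<lambda>n. indicator A \<omega> * ennreal (Z (truncate n v) t \<omega>)) \<partial>M)"
  proof (rule nn_integral_cong)
    fix \<omega> assume "\<omega> \<in> space M"
    then have "(\<lambda>n. indicator A \<omega> * ennreal (Z (truncate n v) t \<omega>)) \<longlonglongrightarrow> indicator A \<omega> * ennreal (Z v t \<omega>)"
      using truncate_eventually[OF v, of \<omega> t] by (intro tendsto_eventually) (auto elim: eventually_mono)
    then show "indicator A \<omega> * ennreal (Z v t \<omega>) = liminf (\<lambda>n. indicator A \<omega> * ennreal (Z (truncate n v) t \<omega>))"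
      by (intro lim_imp_Liminf[symmetric]) auto
  qed
  also have "\<dots> \<le> liminf (\<lambda>n. \<integral>\<^sup>+\<omega>. indicator A \<omega> * ennreal (Z (truncate n v) t \<omega>) \<partial>M)"
    by (rule nn_integral_liminf) measurable
  also have "\<dots> = emeasure M A" by (simp add: E Liminf_const)
  finally show ?thesis .
qed

lemma Z_expectation_le_1:
  assumes v: "rate v" and t: "0 \<le> t"
  shows "(\<integral>\<^sup>+\<omega>. ennreal (Z v t \<omega>) \<partial>M) \<le> 1" "integrable M (Z v t)"
proof -
  have "space M \<in> sets (F 0)" using sets.top[of "F 0"] space_F[of 0] by simp
  from Z_supermartingale[OF v order_refl t this] rate_past[OF v]
  have "(\<integral>\<^sup>+\<omega>. indicator (space M) \<omega> * ennreal (Z v t \<omega>) \<partial>M) \<le> 1" by (simp add: emeasure_space_1)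
  also have "(\<integral>\<^sup>+\<omega>. indicator (space M) \<omega> * ennreal (Z v t \<omega>) \<partial>M) = (\<integral>\<^sup>+\<omega>. ennreal (Z v t \<omega>) \<partial>M)"
    by (rule nn_integral_cong) simp
  finally show le: "(\<integral>\<^sup>+\<omega>. ennreal (Z v t \<omega>) \<partial>M) \<le> 1" .
  show "integrable M (Z v t)"
    by (rule integrableI_nonneg[OF Z_measurable[OF v t]]) (use Z_nonneg[OF v] le in \<open>auto intro: le_less_trans\<close>)
qed

lemma rate_constant:
  assumes K: "1 \<le> K"
  shows "rate (\<lambda>i s \<omega>. if 0 < s then K else 1)"
  unfolding rate_def
proof (intro conjI allI ballI impI)
  show "(\<lambda>w. if 0 < fst w then K else 1) \<in> borel_measurable P" by measurable
  show "\<exists>L. \<forall>i::'d. \<forall>s\<le>t. (if 0 < s then K else 1) \<le> L" for t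
    using K by (intro exI[of _ K]) auto
qed (use K in auto)

text \<open>The envelope is at most a constant times \<open>K\<close> to the number of jumps, and
  this power is a multiple of the exponential of the constant rate \<open>K\<close>, integrable by
  \<open>Z_expectation_le_1\<close>.\<close>

lemma Z_expectation_bounded:
  assumes v: "rate v" and K: "1 \<le> K" "\<And>i s \<omega>. \<omega> \<in> space M \<Longrightarrow> v i s \<omega> \<le> K"
    and ut: "0 \<le> u" "u \<le> t" and A: "A \<in> sets (F u)"
    and v1: "\<And>i s \<omega>. \<omega> \<in> space M \<Longrightarrow> s \<le> u \<Longrightarrow> v i s \<omega> = 1"
  shows "(\<integral>\<^sup>+\<omega>. indicator A \<omega> * ennreal (Z v t \<omega>) \<partial>M) = emeasure M A"
proof -
  have t: "0 \<le> t" using ut by simp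
  let ?k = "\<lambda>(i::'d) s (\<omega>::'a). if 0 < s then K else 1"
  have k: "rate ?k" by (rule rate_constant[OF K(1)])
  \<comment> \<open>The first factor is that of \<open>envelope\<close>; the second undoes the drift
    discount in the exponential of the constant rate \<open>K\<close>.\<close>
  let ?C = "exp (real CARD('d) * t) * exp (real CARD('d) * (K - 1) * t)"
  have zk: "exp (real CARD('d) * (K - 1) * t) * Z ?k t \<omega> = (\<Prod>i\<in>UNIV. \<Prod>r\<in>J i \<omega> \<inter> {0<..t}. K)" for \<omega>
  proof -
    have "(LBINT s:{0<..t}. drift (\<lambda>(i::'d) s. if 0 < s then K else 1) s) = (LBINT s:{0<..t}. real CARD('d) * (K - 1))"
      by (rule set_lebesgue_integral_cong) (auto simp: drift_def)
    also have "\<dots> = real CARD('d) * (K - 1) * t" using t by (simp add: set_lebesgue_integral_def)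
    finally have "Z ?k t \<omega> = exp (- (real CARD('d) * (K - 1) * t)) * (\<Prod>i\<in>UNIV. \<Prod>r\<in>J i \<omega> \<inter> {0<..t}. if 0 < r then K else 1)"
      unfolding Z_def expo_def by simp
    also have "(\<Prod>i\<in>UNIV. \<Prod>r\<in>J i \<omega> \<inter> {0<..t}. if 0 < r then K else 1) = (\<Prod>i\<in>UNIV. \<Prod>r\<in>J i \<omega> \<inter> {0<..t}. K)"
      by (intro prod.cong) auto
    finally show ?thesis by (simp add: mult.assoc[symmetric] exp_minus)
  qed
  show ?thesis
  proof (rule Z_expectation_dominated(2)[OF v K(2) _ _ ut A v1])
    show "integrable M (\<lambda>\<omega>. ?C * Z ?k t \<omega>)" using Z_expectation_le_1(2)[OF k t] by simp
    fix \<omega> s assume \<omega>: "\<omega> \<in> space M" and s: "0 < s" "s \<le> t"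
    interpret marked_path "\<lambda>i. J i \<omega>" "\<lambda>i s. v i s \<omega>" by (rule rate_marked_path[OF v \<omega>])
    have "Z_left v s \<omega> \<le> envelope t" unfolding Z_left_def using expo_le_envelope(2)[of s t] s by simp
    also have "\<dots> \<le> exp (real CARD('d) * t) * (\<Prod>i\<in>UNIV. \<Prod>r\<in>J i \<omega> \<inter> {0<..t}. K)"
      unfolding envelope_def using K \<omega> by (intro mult_left_mono prod_mono conjI prod_nonneg) auto
    also have "\<dots> = ?C * Z ?k t \<omega>" by (simp only: zk[symmetric] mult.assoc)
    finally show "Z_left v s \<omega> \<le> ?C * Z ?k t \<omega>" .
  qed auto
qed

end

section \<open>The entropy estimate along a single path\<close>

lemma log_plus_eq: "log_plus x = ln (max 1 x)"
  by (auto simp: log_plus_def max_def)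

lemma log_plus_nonneg: "0 \<le> log_plus x"
  by (simp add: log_plus_eq)

lemma log_plus_measurable[measurable]: "log_plus \<in> borel_measurable borel"
  unfolding log_plus_eq[abs_def] by measurable

lemma exp_log_plus: "exp (log_plus x) = max 1 x"
  by (simp add: log_plus_eq)

lemma log_plus_mono: "x \<le> y \<Longrightarrow> log_plus x \<le> log_plus y"
  by (auto simp: log_plus_eq)

lemma log_plus_one[simp]: "log_plus 1 = 0"
  by (simp add: log_plus_eq)

text \<open>For \<open>x \<ge> 1\<close> this is the expansion of \<open>x\<close> to the power
  \<open>1 + \<theta>\<close> to first order in \<open>\<theta>\<close>; for
  \<open>x \<le> 1\<close> the left side is 0. The quadratic remainder is
  \<open>x * (\<theta> * l)\<^sup>2\<close> with \<open>l \<le> ln K\<close>, and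
  \<open>\<theta>\<close> is so small that this is at most \<open>\<theta> * x / 2\<close>. Any
  constant below 1 in place of 1/2 would leave part of the total rate in
  \<open>entropy_inequality\<close>.\<close>

lemma entropy_power_bound:
  assumes K: "1 \<le> (K::real)"
  obtains \<theta> where "0 < \<theta>"
    "\<And>x. 0 \<le> x \<Longrightarrow> x \<le> K \<Longrightarrow> x * exp (\<theta> * log_plus x) - x \<le> \<theta> * (x * log_plus x + x / 2)"
proof -
  define L where "L = ln K"
  have L: "0 \<le> L" using K by (simp add: L_def)
  \<comment> \<open>Gives both \<open>\<theta> * l \<le> 1\<close>, the range of
    \<open>exp_bound\<close>, and \<open>\<theta> * l\<^sup>2 \<le> 1 / 2\<close>. Adding 1 to
    \<open>L\<close> avoids a division by 0 when \<open>K = 1\<close> and ensures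
    \<open>l \<le> (1 + L)\<^sup>2\<close>.\<close>
  define \<theta> where "\<theta> = 1 / (2 * (1 + L)\<^sup>2)"
  have th: "0 < \<theta>" using L by (simp add: \<theta>_def)
  show ?thesis
  proof (rule that[OF th])
    fix x assume x: "0 \<le> x" "x \<le> K"
    define l where "l = log_plus x"
    have l: "0 \<le> l" "l \<le> L"
      using x K log_plus_mono[OF x(2)] log_plus_nonneg[of x] by (auto simp: l_def L_def log_plus_eq)
    have sq: "l\<^sup>2 \<le> (1 + L)\<^sup>2" "l \<le> (1 + L)\<^sup>2"
    proof -
      show "l\<^sup>2 \<le> (1 + L)\<^sup>2" using l by (intro power_mono) auto
      have "l \<le> 1 + L" using l by simp
      also have "\<dots> \<le> (1 + L)\<^sup>2" using L by (intro self_le_power) auto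
      finally show "l \<le> (1 + L)\<^sup>2" .
    qed
    have pos: "0 < (1 + L)\<^sup>2" using L by simp
    have y: "0 \<le> \<theta> * l" "\<theta> * l \<le> 1" "\<theta> * l\<^sup>2 \<le> 1 / 2"
      using l th sq pos by (auto simp: \<theta>_def divide_simps)
    have "exp (\<theta> * l) \<le> 1 + \<theta> * l + (\<theta> * l)\<^sup>2" by (rule exp_bound[OF y(1,2)])
    also have "(\<theta> * l)\<^sup>2 = \<theta> * (\<theta> * l\<^sup>2)" by (simp add: power2_eq_square)
    also have "\<dots> \<le> \<theta> * (1 / 2)" using y(3) th by (intro mult_left_mono) auto
    finally have "x * exp (\<theta> * l) \<le> x * (1 + \<theta> * l + \<theta> * (1 / 2))" using x by (intro mult_left_mono) auto
    then show "x * exp (\<theta> * log_plus x) - x \<le> \<theta> * (x * log_plus x + x / 2)"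
      by (simp add: l_def[symmetric] algebra_simps)
  qed
qed

context marked_path
begin

definition total :: "real \<Rightarrow> real" where
  "total t = (LBINT s:{0<..t}. \<Sum>i\<in>UNIV. v i s)"

lemma sum_v_integrable: "set_integrable lborel {s<..t} (\<lambda>s. \<Sum>i\<in>UNIV. v i s)"
  by (rule set_integral_sum(1)) (rule set_integrable_v)

lemma drift_integral_eq: "0 \<le> t \<Longrightarrow> (LBINT s:{0<..t}. drift v s) = total t - real CARD('d) * t"
proof -
  assume t: "0 \<le> t"
  have i: "set_integrable lborel {0<..t} (\<lambda>_. real CARD('d))"
    by (rule set_integrable_bounded_interval[of _ _ _ "real CARD('d)"]) (auto simp: set_borel_measurable_def)
  have "(LBINT s:{0<..t}. drift v s) = (LBINT s:{0<..t}. (\<Sum>i\<in>UNIV. v i s) - real CARD('d))"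
    by (rule set_lebesgue_integral_cong) (auto simp: drift_def sum_subtractf)
  also have "\<dots> = total t - (LBINT s:{0<..t}. real CARD('d))"
    unfolding total_def by (rule set_integral_diff[OF sum_v_integrable i])
  finally show ?thesis using t by (simp add: set_lebesgue_integral_def mult.commute)
qed

lemma total_mono: "0 \<le> s \<Longrightarrow> s \<le> t \<Longrightarrow> total s \<le> total t"
proof -
  assume s: "0 \<le> s" "s \<le> t"
  have "0 \<le> (LBINT s:{s<..t}. \<Sum>i\<in>UNIV. v i s)"
    unfolding set_lebesgue_integral_def
    by (intro integral_nonneg_AE AE_I2) (auto intro!: mult_nonneg_nonneg sum_nonneg simp: v_nonneg)
  then show ?thesis using set_integral_Ioc_split[OF sum_v_integrable s] by (simp add: total_def)
qed

lemma total_0: "total 0 = 0"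
  by (simp add: total_def set_lebesgue_integral_def)

lemma total_nonneg: "0 \<le> t \<Longrightarrow> 0 \<le> total t"
  using total_mono[of 0 t] total_0 by simp

lemma continuous_on_total: "continuous_on {0..} total"
proof -
  have "continuous_on {0..} (\<lambda>t. LBINT s:{0<..t}. drift v s)"
    unfolding continuous_on_eq_continuous_within using drift_integral_continuous by auto
  then have "continuous_on {0..} (\<lambda>t. (LBINT s:{0<..t}. drift v s) + real CARD('d) * t)"
    by (intro continuous_intros)
  then show ?thesis
    by (rule continuous_on_cong[THEN iffD1, rotated 2]) (auto simp: drift_integral_eq)
qed

text \<open>\<open>total\<close> is continuous and nondecreasing, so the times with
  \<open>total s \<le> n\<close> form an initial interval \<open>[0, \<sigma>]\<close>, and the
  integral over it is \<open>total \<sigma>\<close>.\<close>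

lemma total_truncated_le:
  assumes t: "0 \<le> t" and n: "0 \<le> n"
  shows "set_integrable lborel {0<..t} (\<lambda>s. if total s \<le> n then \<Sum>i\<in>UNIV. v i s else 0)"
    and "(LBINT s:{0<..t}. if total s \<le> n then \<Sum>i\<in>UNIV. v i s else 0) \<le> n"
proof -
  let ?S = "{s \<in> {0..t}. total s \<le> n}"
  have cont: "continuous_on {0..t} total" by (rule continuous_on_subset[OF continuous_on_total]) auto
  have "closed ?S" by (rule continuous_on_closed_Collect_le[OF cont]) auto
  moreover have "bounded ?S" by (rule bounded_subset[of "{0..t}"]) auto
  ultimately have "compact ?S" by (simp add: compact_eq_bounded_closed)
  moreover have "?S \<noteq> {}" using t n total_0 by force
  ultimately obtain \<sigma> where \<sigma>: "\<sigma> \<in> ?S" "\<And>s. s \<in> ?S \<Longrightarrow> s \<le> \<sigma>"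
    using compact_attains_sup[of ?S] by blast
  have le: "total s \<le> n \<longleftrightarrow> s \<le> \<sigma>" if "s \<in> {0<..t}" for s
  proof
    assume "s \<le> \<sigma>"
    then have "total s \<le> total \<sigma>" using that by (intro total_mono) auto
    then show "total s \<le> n" using \<sigma>(1) by simp
  qed (use \<sigma>(2) that in auto)
  have eq: "(\<lambda>s. indicator {0<..t} s *\<^sub>R (if total s \<le> n then \<Sum>i\<in>UNIV. v i s else 0)) = (\<lambda>s. indicator {0<..\<sigma>} s *\<^sub>R (\<Sum>i\<in>UNIV. v i s))"
    using le \<sigma>(1) by (auto simp: fun_eq_iff split: split_indicator)
  show "set_integrable lborel {0<..t} (\<lambda>s. if total s \<le> n then \<Sum>i\<in>UNIV. v i s else 0)"
    using sum_v_integrable[of 0 \<sigma>] unfolding set_integrable_def eq .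
  have "(LBINT s:{0<..t}. if total s \<le> n then \<Sum>i\<in>UNIV. v i s else 0) = (LBINT s:{0<..\<sigma>}. \<Sum>i\<in>UNIV. v i s)"
    unfolding set_lebesgue_integral_def eq ..
  also have "\<dots> = total \<sigma>" by (simp only: total_def)
  finally have "(LBINT s:{0<..t}. if total s \<le> n then \<Sum>i\<in>UNIV. v i s else 0) = total \<sigma>" .
  then show "(LBINT s:{0<..t}. if total s \<le> n then \<Sum>i\<in>UNIV. v i s else 0) \<le> n" using \<sigma>(1) by simp
qed

lemma entropy_integrable: "set_integrable lborel {0<..t} (\<lambda>s. \<Sum>i\<in>UNIV. v i s * log_plus (v i s))"
proof -
  obtain K where K: "0 \<le> K" "\<And>i s. s \<le> t \<Longrightarrow> v i s \<le> K" using v_bounded' by blast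
  show ?thesis
  proof (rule set_integral_sum(1), rule set_integrable_bounded_interval)
    show "set_borel_measurable borel {0<..t} (\<lambda>s. v i s * log_plus (v i s))" for i
      unfolding set_borel_measurable_def by measurable
    show "\<bar>v i s * log_plus (v i s)\<bar> \<le> K * log_plus K" if "s \<in> {0<..t}" for i s
      using K(2)[of s i] that v_nonneg[of i s] log_plus_nonneg log_plus_mono[of "v i s" K]
      by (simp add: abs_mult mult_mono K(1))
  qed
qed

lemma prod_exp_log_plus:
  "(\<Prod>i\<in>UNIV. \<Prod>r\<in>J i \<inter> {0<..t}. exp (c * log_plus (v i r))) = exp (c * (\<Sum>i\<in>UNIV. \<Sum>r\<in>J i \<inter> {0<..t}. log_plus (v i r)))"
  by (simp add: exp_sum[symmetric] J_finite' sum_distrib_left)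

lemma envelope_eq: "envelope t = exp (real CARD('d) * t) * exp (\<Sum>i\<in>UNIV. \<Sum>r\<in>J i \<inter> {0<..t}. log_plus (v i r))"
  using prod_exp_log_plus[where c = 1 and t = t] by (simp add: envelope_def exp_log_plus)

text \<open>The first two terms on the right come from \<open>exp x \<ge> 1 + x\<close>, applied to the logarithms of the
  ratios of \<open>expo J (\<dots>) t\<close> and of \<open>exp Y\<close> to \<open>expo J v t\<close>; the jump terms cancel in the sum.\<close>

lemma entropy_inequality:
  assumes t: "0 \<le> t" and th: "0 < \<theta>"
    and \<theta>: "\<And>i s. v i s * exp (\<theta> * log_plus (v i s)) - v i s \<le> \<theta> * (v i s * log_plus (v i s) + v i s / 2)"
    and Y: "(LBINT s:{0<..t}. \<Sum>i\<in>UNIV. v i s * log_plus (v i s)) \<le> Y"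
  shows "expo J v t * total t \<le> 2 * (expo J (\<lambda>i s. v i s * exp (\<theta> * log_plus (v i s))) t / \<theta> + exp Y
    + real CARD('d) * t * expo J v t - expo J v t / \<theta>)"
proof -
  let ?w = "\<lambda>i s. v i s * exp (\<theta> * log_plus (v i s))"
  let ?X = "LBINT s:{0<..t}. drift v s" and ?X' = "LBINT s:{0<..t}. drift ?w s"
  let ?L = "\<Sum>i\<in>UNIV. \<Sum>r\<in>J i \<inter> {0<..t}. log_plus (v i r)"
  let ?E = "LBINT s:{0<..t}. \<Sum>i\<in>UNIV. v i s * log_plus (v i s)"
  let ?z = "expo J v t"
  have z: "0 \<le> ?z" by (rule expo_nonneg)
  interpret w: marked_path J ?w
  proof
    show "?w i \<in> borel_measurable borel" for i by measurable
    show "\<exists>K. \<forall>i. \<forall>s\<le>t. ?w i s \<le> K" for t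
    proof -
      obtain K where K: "0 \<le> K" "\<And>i s. s \<le> t \<Longrightarrow> v i s \<le> K" using v_bounded' by blast
      have "?w i s \<le> K * exp (\<theta> * log_plus K)" if "s \<le> t" for i s
        using K(2)[OF that, of i] K(1) th v_nonneg[of i s] by (intro mult_mono) (auto intro!: log_plus_mono)
      then show ?thesis by blast
    qed
  qed (auto simp: J_finite J_disjoint v_nonneg)
  have zw: "expo J ?w t = ?z * exp (\<theta> * ?L - (?X' - ?X))"
    by (simp add: expo_def prod.distrib prod_exp_log_plus exp_diff exp_minus exp_add field_simps)
  have 1: "?z * (1 + (\<theta> * ?L - (?X' - ?X))) \<le> expo J ?w t"
    unfolding zw by (intro mult_left_mono exp_ge_add_one_self z)
  have 2: "?z * (1 + Y + ?X - ?L) \<le> exp Y"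
  \<comment> \<open>If some jump factor vanishes, \<open>ln ?z\<close> is of no use, but then the
    left side is 0.\<close>
  proof (cases "?z = 0")
    case False
    then have zp: "0 < ?z" using z by simp
    have vp: "0 < v i r" if "r \<in> J i \<inter> {0<..t}" for i r
    proof -
      have "(\<Prod>i\<in>UNIV. \<Prod>r\<in>J i \<inter> {0<..t}. v i r) \<noteq> 0" using False by (simp add: expo_def)
      then have "v i r \<noteq> 0" using that by (auto simp: prod_zero_iff J_finite')
      then show ?thesis using v_nonneg[of i r] by simp
    qed
    \<comment> \<open>Only an inequality: passing from \<open>ln\<close> to \<open>log_plus\<close>
      discards the jumps with a factor below 1.\<close>
    have "(\<Prod>i\<in>UNIV. \<Prod>r\<in>J i \<inter> {0<..t}. v i r) \<le> (\<Prod>i\<in>UNIV. \<Prod>r\<in>J i \<inter> {0<..t}. exp (1 * log_plus (v i r)))"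
      by (intro prod_mono conjI prod_nonneg) (auto simp: v_nonneg exp_log_plus)
    then have "?z \<le> exp (- ?X) * exp ?L"
      unfolding expo_def prod_exp_log_plus by (intro mult_left_mono) auto
    then have "?z \<le> exp (?L - ?X)" by (simp add: exp_add[symmetric])
    then have ln: "ln ?z \<le> ?L - ?X" using zp by (metis exp_gt_zero ln_exp ln_le_cancel_iff)
    have "?z * (1 + Y + ?X - ?L) \<le> ?z * (1 + (Y - ln ?z))" using z ln by (intro mult_left_mono) auto
    also have "\<dots> \<le> ?z * exp (Y - ln ?z)" by (intro mult_left_mono exp_ge_add_one_self z)
    also have "\<dots> = exp Y" using zp by (simp add: exp_diff)
    finally show ?thesis .
  qed simp
  have 3: "?X' - ?X \<le> \<theta> * (?E + total t / 2)"
  proof -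
    have "?X' - ?X = (LBINT s:{0<..t}. drift ?w s - drift v s)"
      by (rule set_integral_diff(2)[OF w.drift_set_integrable drift_set_integrable, symmetric])
    also have "\<dots> \<le> (LBINT s:{0<..t}. \<theta> * ((\<Sum>i\<in>UNIV. v i s * log_plus (v i s)) + (\<Sum>i\<in>UNIV. v i s) / 2))"
    proof (rule set_integral_mono)
      show "set_integrable lborel {0<..t} (\<lambda>s. drift ?w s - drift v s)"
        by (intro set_integral_diff(1) w.drift_set_integrable drift_set_integrable)
      show "set_integrable lborel {0<..t} (\<lambda>s. \<theta> * ((\<Sum>i\<in>UNIV. v i s * log_plus (v i s)) + (\<Sum>i\<in>UNIV. v i s) / 2))"
        by (intro set_integrable_mult_right set_integral_add(1) entropy_integrable set_integrable_divide sum_v_integrable)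
      show "drift ?w s - drift v s \<le> \<theta> * ((\<Sum>i\<in>UNIV. v i s * log_plus (v i s)) + (\<Sum>i\<in>UNIV. v i s) / 2)" for s
      proof -
        have "drift ?w s - drift v s = (\<Sum>i\<in>UNIV. ?w i s - v i s)" by (simp add: drift_def sum_subtractf)
        also have "\<dots> \<le> (\<Sum>i\<in>UNIV. \<theta> * (v i s * log_plus (v i s) + v i s / 2))" by (intro sum_mono \<theta>)
        also have "\<dots> = \<theta> * ((\<Sum>i\<in>UNIV. v i s * log_plus (v i s)) + (\<Sum>i\<in>UNIV. v i s) / 2)"
          by (simp add: sum_distrib_left[symmetric] sum.distrib sum_divide_distrib)
        finally show ?thesis .
      qed
    qed
    also have "\<dots> = \<theta> * (?E + total t / 2)"
      unfolding total_def using entropy_integrable[of t] sum_v_integrable[of 0 t]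
      by (simp add: set_integral_add(2) set_integrable_divide)
    finally show ?thesis .
  qed
  \<comment> \<open>The first inequality divided by \<open>\<theta>\<close> brings \<open>?L\<close>
    and at worst \<open>- ?E - total t / 2\<close>; the second brings \<open>Y - ?L\<close> and
    \<open>?X\<close>, which is \<open>total t\<close> minus the dimension times \<open>t\<close>.
    The jump sums cancel, \<open>?E \<le> Y\<close>, and \<open>total t / 2\<close> survives, whence
    the factor 2 in the conclusion.\<close>
  have "?z * (1 / \<theta> + 1 + total t / 2 - real CARD('d) * t) \<le> ?z * ((1 + (\<theta> * ?L - (?X' - ?X))) / \<theta> + (1 + Y + ?X - ?L))"
  proof (rule mult_left_mono[OF _ z])
    have "(?X' - ?X) / \<theta> \<le> ?E + total t / 2" using 3 th by (simp add: divide_le_eq mult.commute)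
    moreover have "?X = total t - real CARD('d) * t" by (rule drift_integral_eq[OF t])
    moreover have "(1 + (\<theta> * ?L - (?X' - ?X))) / \<theta> = 1 / \<theta> + ?L - (?X' - ?X) / \<theta>"
      using th by (simp add: add_divide_distrib diff_divide_distrib)
    ultimately show "1 / \<theta> + 1 + total t / 2 - real CARD('d) * t \<le> (1 + (\<theta> * ?L - (?X' - ?X))) / \<theta> + (1 + Y + ?X - ?L)"
      using Y by linarith
  qed
  also have "\<dots> = ?z * (1 + (\<theta> * ?L - (?X' - ?X))) / \<theta> + ?z * (1 + Y + ?X - ?L)"
    by (simp add: distrib_left)
  also have "\<dots> \<le> expo J ?w t / \<theta> + exp Y"
    using 1 2 th by (intro add_mono divide_right_mono) auto
  finally have "?z * (1 / \<theta> + 1 + total t / 2 - real CARD('d) * t) \<le> expo J ?w t / \<theta> + exp Y" .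
  then show ?thesis using z by (simp add: algebra_simps)
qed

end

section \<open>The entropy estimate in expectation, and rates that are switched off\<close>

context unit_intensity
begin

definition V :: "('d \<Rightarrow> 'a process) \<Rightarrow> 'a process" where
  "V v t \<omega> = (LBINT s:{0<..t}. \<Sum>i\<in>UNIV. v i s \<omega>)"

lemma V_eq_total: "rate v \<Longrightarrow> \<omega> \<in> space M \<Longrightarrow> V v t \<omega> = marked_path.total (\<lambda>i s. v i s \<omega>) t"
  by (simp add: V_def marked_path.total_def[OF rate_marked_path])

lemma adapted_V:
  assumes v: "rate v" and t: "0 \<le> t"
  shows "V v t \<in> borel_measurable (F t)"
proof -
  have "(\<lambda>\<omega>. (LBINT s:{0<..t}. drift (\<lambda>i s. v i s \<omega>) s) + real CARD('d) * t) \<in> borel_measurable (F t)"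
    by (intro borel_measurable_add adapted_drift_integral[OF v t]) simp
  then show ?thesis
    by (rule measurable_congI)
       (simp add: V_eq_total[OF v] marked_path.drift_integral_eq[OF rate_marked_path[OF v] t] space_F[OF t])
qed

text \<open>A continuous adapted process is its own left limit.\<close>

lemma predictable_V:
  assumes v: "rate v"
  shows "(\<lambda>w. V v (fst w) (snd w)) \<in> borel_measurable P"
proof -
  have ad: "adapted F (V v)" unfolding adapted_def using adapted_V[OF v] by blast
  have cont: "continuous_on {0..} (\<lambda>t. V v t \<omega>)" if "\<omega> \<in> space M" for \<omega>
    unfolding V_eq_total[OF v that] using marked_path.continuous_on_total[OF rate_marked_path[OF v that]] .
  have lim: "((\<lambda>t. V v t \<omega>) \<longlongrightarrow> V v s \<omega>) (at s within S)" if "\<omega> \<in> space M" "0 \<le> s" "S \<subseteq> {0..}" for s S \<omega>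
  proof -
    have "((\<lambda>t. V v t \<omega>) \<longlongrightarrow> V v s \<omega>) (at s within {0..})"
      using cont[OF that(1)] that(2) unfolding continuous_on_def by auto
    then show ?thesis using that(3) by (rule tendsto_within_subset)
  qed
  have left: "((\<lambda>t. V v t \<omega>) \<longlongrightarrow> V v s \<omega>) (at_left s)" if "\<omega> \<in> space M" "0 < s" for s \<omega>
  proof -
    have "at s within {0..<s} = at_left s"
      by (rule at_within_nhd[of _ "{0<..}"]) (use that in auto)
    moreover have "((\<lambda>t. V v t \<omega>) \<longlongrightarrow> V v s \<omega>) (at s within {0..<s})"
      by (rule lim) (use that in auto)
    ultimately show ?thesis by simp
  qed
  have cad: "cadlag (\<lambda>t. V v t \<omega>)" if "\<omega> \<in> space M" for \<omega>
    unfolding cadlag_def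
  proof (intro conjI allI impI)
    show "((\<lambda>t. V v t \<omega>) \<longlongrightarrow> V v t \<omega>) (at_right t)" if "0 \<le> t" for t
      by (rule lim) (use that \<open>\<omega> \<in> space M\<close> in auto)
    show "\<exists>l. ((\<lambda>t. V v t \<omega>) \<longlongrightarrow> l) (at_left t)" if "0 < t" for t
      using left[OF \<open>\<omega> \<in> space M\<close> that] by blast
  qed
  from predictable_left_limit[OF ad cad, of 0] show ?thesis
  proof (rule measurable_congI)
    fix w assume w: "w \<in> space P"
    show "(if 0 < fst w then left_limit (\<lambda>t. V v t (snd w)) (fst w) else 0) = V v (fst w) (snd w)"
    proof (cases "0 < fst w")
      case True
      then show ?thesis using left_limit_eqI[OF left, of "snd w" "fst w"] w by (auto simp: space_P)
    next
      case False
      then have "{0<..fst w} = {}" by auto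
      then show ?thesis using False by (simp add: V_def set_lebesgue_integral_def)
    qed
  qed
qed

lemma V_mono: "rate v \<Longrightarrow> \<omega> \<in> space M \<Longrightarrow> 0 \<le> s \<Longrightarrow> s \<le> t \<Longrightarrow> V v s \<omega> \<le> V v t \<omega>"
  unfolding V_eq_total by (rule marked_path.total_mono[OF rate_marked_path])

lemma V_nonneg: "rate v \<Longrightarrow> \<omega> \<in> space M \<Longrightarrow> 0 \<le> t \<Longrightarrow> 0 \<le> V v t \<omega>"
  unfolding V_eq_total by (rule marked_path.total_nonneg[OF rate_marked_path])

text \<open>Expectations in \<open>entropy_inequality\<close>: the exponential of the perturbed rate
  has expectation at most 1 and that of the bounded rate \<open>v\<close> exactly 1, which disposes
  of both terms with \<open>1 / \<theta>\<close>. No trace of \<open>K\<close> is left, so one bound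
  serves all localised rates.\<close>

lemma Z_entropy_bound:
  assumes v: "rate v" and K: "1 \<le> K" "\<And>i s \<omega>. \<omega> \<in> space M \<Longrightarrow> v i s \<omega> \<le> K" and t: "0 \<le> t"
    and Y: "integrable M (\<lambda>\<omega>. exp (Y \<omega>))"
      "\<And>\<omega>. \<omega> \<in> space M \<Longrightarrow> (LBINT s:{0<..t}. \<Sum>i\<in>UNIV. v i s \<omega> * log_plus (v i s \<omega>)) \<le> Y \<omega>"
  shows "integrable M (\<lambda>\<omega>. Z v t \<omega> * V v t \<omega>)"
    and "(LINT \<omega>|M. Z v t \<omega> * V v t \<omega>) \<le> 2 * ((LINT \<omega>|M. exp (Y \<omega>)) + real CARD('d) * t)"
proof -
  obtain \<theta> where th: "0 < \<theta>" and
    \<theta>: "\<And>x. 0 \<le> x \<Longrightarrow> x \<le> K \<Longrightarrow> x * exp (\<theta> * log_plus x) - x \<le> \<theta> * (x * log_plus x + x / 2)"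
    using entropy_power_bound[OF K(1)] by blast
  let ?w = "\<lambda>i s \<omega>. v i s \<omega> * exp (\<theta> * log_plus (v i s \<omega>))"
  have w: "rate ?w" unfolding rate_def
  proof (intro conjI allI ballI impI)
    note rate_predictable[OF v, measurable]
    show "(\<lambda>w. ?w i (fst w) (snd w)) \<in> borel_measurable P" for i by measurable
    fix \<omega> assume \<omega>: "\<omega> \<in> space M"
    show "0 \<le> ?w i s \<omega>" for i s using rate_nonneg[OF v \<omega>] by simp
    show "?w i s \<omega> = 1" if "s \<le> 0" for i s using rate_past[OF v \<omega> that] by simp
    have "?w i s \<omega> \<le> K * exp (\<theta> * log_plus K)" for i s
      using K(2)[OF \<omega>, of i s] K(1) th rate_nonneg[OF v \<omega>, of i s]
      by (intro mult_mono) (auto intro!: log_plus_mono)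
    then show "\<exists>K. \<forall>i. \<forall>s\<le>t. ?w i s \<omega> \<le> K" for t by blast
  qed
  let ?R = "\<lambda>\<omega>. 2 * (Z ?w t \<omega> / \<theta> + exp (Y \<omega>) + real CARD('d) * t * Z v t \<omega> - Z v t \<omega> / \<theta>)"
  have le: "Z v t \<omega> * V v t \<omega> \<le> ?R \<omega>" if \<omega>: "\<omega> \<in> space M" for \<omega>
    unfolding Z_def V_eq_total[OF v \<omega>]
    by (rule marked_path.entropy_inequality[OF rate_marked_path[OF v \<omega>] t th])
       (use Y(2)[OF \<omega>] \<theta> rate_nonneg[OF v \<omega>] K(2)[OF \<omega>] in blast)+
  have pos: "0 \<le> Z v t \<omega> * V v t \<omega>" if \<omega>: "\<omega> \<in> space M" for \<omega>
    by (intro mult_nonneg_nonneg Z_nonneg[OF v \<omega>] V_nonneg[OF v \<omega> t])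
  note iv = Z_expectation_le_1(2)[OF v t] and iw = Z_expectation_le_1(2)[OF w t]
  have iR: "integrable M ?R" using iv iw Y(1) by simp
  have Vm: "V v t \<in> borel_measurable M" by (rule measurable_F_M[OF t adapted_V[OF v t]])
  show int: "integrable M (\<lambda>\<omega>. Z v t \<omega> * V v t \<omega>)"
  proof (rule Bochner_Integration.integrable_bound[OF iR])
    show "(\<lambda>\<omega>. Z v t \<omega> * V v t \<omega>) \<in> borel_measurable M"
      using Z_measurable[OF v t] Vm by measurable
    show "AE \<omega> in M. norm (Z v t \<omega> * V v t \<omega>) \<le> norm (?R \<omega>)"
    proof (rule AE_I2)
      fix \<omega> assume \<omega>: "\<omega> \<in> space M"
      have "norm (Z v t \<omega> * V v t \<omega>) = Z v t \<omega> * V v t \<omega>" using pos[OF \<omega>] by (simp only: real_norm_def abs_of_nonneg)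
      also have "\<dots> \<le> ?R \<omega>" by (rule le[OF \<omega>])
      also have "\<dots> \<le> norm (?R \<omega>)" unfolding real_norm_def by (rule abs_ge_self)
      finally show "norm (Z v t \<omega> * V v t \<omega>) \<le> norm (?R \<omega>)" .
    qed
  qed
  have "space M \<in> sets (F 0)" using sets.top[of "F 0"] space_F[of 0] by simp
  from Z_expectation_bounded[OF v K order_refl t this] rate_past[OF v]
  have "(\<integral>\<^sup>+\<omega>. indicator (space M) \<omega> * ennreal (Z v t \<omega>) \<partial>M) = 1" by (simp add: emeasure_space_1)
  then have "(\<integral>\<^sup>+\<omega>. ennreal (Z v t \<omega>) \<partial>M) = 1"
    by (subst nn_integral_cong[where v = "\<lambda>\<omega>. indicator (space M) \<omega> * ennreal (Z v t \<omega>)"]) auto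
  then have Ev: "(LINT \<omega>|M. Z v t \<omega>) = 1"
    using iv Z_nonneg[OF v] by (subst integral_eq_nn_integral) auto
  have Ew: "(LINT \<omega>|M. Z ?w t \<omega>) \<le> 1"
  proof -
    have "ennreal (LINT \<omega>|M. Z ?w t \<omega>) = (\<integral>\<^sup>+\<omega>. ennreal (Z ?w t \<omega>) \<partial>M)"
      using Z_nonneg[OF w] by (intro nn_integral_eq_integral[symmetric] iw) auto
    also have "\<dots> \<le> 1" by (rule Z_expectation_le_1(1)[OF w t])
    finally show ?thesis by (simp only: ennreal_le_1)
  qed
  have "(LINT \<omega>|M. Z v t \<omega> * V v t \<omega>) \<le> integral\<^sup>L M ?R"
    by (rule integral_mono[OF int iR le])
  also have "\<dots> = 2 * ((LINT \<omega>|M. Z ?w t \<omega>) / \<theta> + (LINT \<omega>|M. exp (Y \<omega>)) + real CARD('d) * t * (LINT \<omega>|M. Z v t \<omega>) - (LINT \<omega>|M. Z v t \<omega>) / \<theta>)"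
    using iv iw Y(1) by simp
  also have "\<dots> \<le> 2 * ((LINT \<omega>|M. exp (Y \<omega>)) + real CARD('d) * t)"
    using Ew th by (simp add: Ev divide_right_mono)
  finally show "(LINT \<omega>|M. Z v t \<omega> * V v t \<omega>) \<le> 2 * ((LINT \<omega>|M. exp (Y \<omega>)) + real CARD('d) * t)" .
qed

text \<open>Replacing a rate by 1 switches it off: no drift, no effect of jumps. This and the next
  two definitions differ in when that happens: up to \<open>u\<close>, after \<open>S\<close>, and
  once \<open>V\<close> has exceeded \<open>n\<close>.\<close>

definition after :: "real \<Rightarrow> ('d \<Rightarrow> 'a process) \<Rightarrow> 'd \<Rightarrow> 'a process" where
  "after u v i s \<omega> = (if u < s then v i s \<omega> else 1)"

definition upto :: "('a \<Rightarrow> ennreal) \<Rightarrow> ('d \<Rightarrow> 'a process) \<Rightarrow> 'd \<Rightarrow> 'a process" where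
  "upto S v i s \<omega> = (if ennreal s \<le> S \<omega> then v i s \<omega> else 1)"

text \<open>Switching off depends on \<open>V\<close> of the rate before localisation, so it is the
  same for every localising time. Raising the rate to at least 1 lets each jump factor dominate the
  corresponding one of the localised rates.\<close>

definition cut :: "real \<Rightarrow> ('d \<Rightarrow> 'a process) \<Rightarrow> 'd \<Rightarrow> 'a process" where
  "cut n v i s \<omega> = (if V v s \<omega> \<le> n then max 1 (v i s \<omega>) else 1)"

lemma rate_after:
  assumes v: "rate v" and u: "0 \<le> u"
  shows "rate (after u v)"
  unfolding rate_def
proof (intro conjI allI ballI impI)
  note rate_predictable[OF v, measurable]
  show "(\<lambda>w. after u v i (fst w) (snd w)) \<in> borel_measurable P" for i unfolding after_def by measurable
  fix \<omega> assume \<omega>: "\<omega> \<in> space M"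
  show "0 \<le> after u v i s \<omega>" for i s using rate_nonneg[OF v \<omega>] by (simp add: after_def)
  show "after u v i s \<omega> = 1" if "s \<le> 0" for i s using that u by (simp add: after_def)
  show "\<exists>K. \<forall>i. \<forall>s\<le>t. after u v i s \<omega> \<le> K" for t
  proof -
    obtain L where L: "\<And>i s. s \<le> t \<Longrightarrow> v i s \<omega> \<le> L" using rate_bounded[OF v \<omega>, of t] by blast
    show ?thesis by (rule exI[of _ "max L 1"]) (auto simp: le_max_iff_disj after_def L)
  qed
qed

lemma rate_upto:
  assumes v: "rate v" and S: "ext_stopping_time M F S"
  shows "rate (upto S v)" unfolding rate_def
proof (intro conjI allI ballI impI)
  note rate_predictable[OF v, measurable] predictable_stopping[OF S, measurable]
  fix i
  have "(\<lambda>w. if 0 < fst w \<and> ennreal (fst w) \<le> S (snd w) then v i (fst w) (snd w) else 1) \<in> borel_measurable P" by measurable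
  then show "(\<lambda>w. upto S v i (fst w) (snd w)) \<in> borel_measurable P"
    by (rule measurable_congI) (auto simp: upto_def space_P rate_past[OF v])
next
  fix \<omega> assume \<omega>: "\<omega> \<in> space M"
  show "0 \<le> upto S v i s \<omega>" for i s using rate_nonneg[OF v \<omega>] by (simp add: upto_def)
  show "upto S v i s \<omega> = 1" if "s \<le> 0" for i s using rate_past[OF v \<omega> that] by (simp add: upto_def)
  show "\<exists>K. \<forall>i. \<forall>s\<le>t. upto S v i s \<omega> \<le> K" for t
  proof -
    obtain L where L: "\<And>i s. s \<le> t \<Longrightarrow> v i s \<omega> \<le> L" using rate_bounded[OF v \<omega>, of t] by blast
    show ?thesis by (rule exI[of _ "max L 1"]) (auto simp: le_max_iff_disj upto_def L)
  qed
qed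

lemma rate_cut:
  assumes v: "rate v"
  shows "rate (cut n v)" unfolding rate_def
proof (intro conjI allI ballI impI)
  note rate_predictable[OF v, measurable] predictable_V[OF v, measurable]
  show "(\<lambda>w. cut n v i (fst w) (snd w)) \<in> borel_measurable P" for i unfolding cut_def by measurable
  fix \<omega> assume \<omega>: "\<omega> \<in> space M"
  show "0 \<le> cut n v i s \<omega>" for i s by (simp add: cut_def le_max_iff_disj)
  show "cut n v i s \<omega> = 1" if "s \<le> 0" for i s using rate_past[OF v \<omega> that] by (simp add: cut_def)
  show "\<exists>K. \<forall>i. \<forall>s\<le>t. cut n v i s \<omega> \<le> K" for t
  proof -
    obtain L where L: "\<And>i s. s \<le> t \<Longrightarrow> v i s \<omega> \<le> L" using rate_bounded[OF v \<omega>, of t] by blast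
    have "cut n v i s \<omega> \<le> max 1 L" if "s \<le> t" for i s using L[OF that, of i] by (auto simp: cut_def max_def)
    then show ?thesis by blast
  qed
qed

text \<open>The exponential \<open>Z (cut n v)\<close> discounts its jump factors by at most \<open>exp (- n)\<close>, since the
  integral of \<open>cut n v - 1\<close> is at most \<open>n\<close>; this yields an integrable bound that does not depend on \<open>S\<close>.\<close>

lemma Z_upto_le_cut:
  assumes v: "rate v" and S: "ext_stopping_time M F S" and \<omega>: "\<omega> \<in> space M" and t: "0 \<le> t"
    and n: "0 \<le> n" "V (upto S v) t \<omega> \<le> n"
  shows "Z (upto S v) t \<omega> \<le> exp (real CARD('d) * t) * exp n * Z (cut n v) t \<omega>"
proof -
  note c = rate_cut[OF v, of n] and s = rate_upto[OF v S]
  interpret v: marked_path "\<lambda>i. J i \<omega>" "\<lambda>i s. v i s \<omega>" by (rule rate_marked_path[OF v \<omega>])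
  interpret c: marked_path "\<lambda>i. J i \<omega>" "\<lambda>i s. cut n v i s \<omega>" by (rule rate_marked_path[OF c \<omega>])
  interpret s: marked_path "\<lambda>i. J i \<omega>" "\<lambda>i s. upto S v i s \<omega>" by (rule rate_marked_path[OF s \<omega>])
  \<comment> \<open>Termwise \<open>max 1 x - 1 \<le> x\<close> for \<open>x \<ge> 0\<close>, and
    the switched-off rate has drift 0.\<close>
  have "(LBINT r:{0<..t}. drift (\<lambda>i s. cut n v i s \<omega>) r) \<le> (LBINT r:{0<..t}. if v.total r \<le> n then \<Sum>i\<in>UNIV. v i r \<omega> else 0)"
  proof (rule set_integral_mono[OF c.drift_set_integrable v.total_truncated_le(1)[OF t n(1)]])
    fix r
    have "drift (\<lambda>i s. cut n v i s \<omega>) r \<le> (\<Sum>i\<in>UNIV. if v.total r \<le> n then v i r \<omega> else 0)"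
      unfolding drift_def
      by (rule sum_mono) (use rate_nonneg[OF v \<omega>] in \<open>auto simp: cut_def V_eq_total[OF v \<omega>] max_def\<close>)
    then show "drift (\<lambda>i s. cut n v i s \<omega>) r \<le> (if v.total r \<le> n then \<Sum>i\<in>UNIV. v i r \<omega> else 0)" by (auto split: if_splits)
  qed
  also have "\<dots> \<le> n" by (rule v.total_truncated_le(2)[OF t n(1)])
  finally have e: "1 \<le> exp n * exp (- (LBINT r:{0<..t}. drift (\<lambda>i s. cut n v i s \<omega>) r))"
    by (simp add: exp_add[symmetric])
  \<comment> \<open>Up to \<open>S\<close> the rates \<open>v\<close> and \<open>upto S v\<close>
    agree, so \<open>V v r \<le> n\<close> follows from the bound at time \<open>t\<close> and
    \<open>cut\<close> is still active; after \<open>S\<close> the left side is 1.\<close>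
  have le: "max 1 (upto S v i r \<omega>) \<le> cut n v i r \<omega>" if r: "0 < r" "r \<le> t" for i r
  proof (cases "ennreal r \<le> S \<omega>")
    case True
    have "V v r \<omega> = V (upto S v) r \<omega>"
      unfolding V_def
    proof (rule set_lebesgue_integral_cong)
      have "ennreal x \<le> S \<omega>" if "x \<le> r" for x using ennreal_leI[OF that] True by (rule order_trans)
      then show "\<forall>x. x \<in> {0<..r} \<longrightarrow> (\<Sum>i\<in>UNIV. v i x \<omega>) = (\<Sum>i\<in>UNIV. upto S v i x \<omega>)" by (simp add: upto_def)
    qed simp
    also have "\<dots> \<le> V (upto S v) t \<omega>" by (rule V_mono[OF s \<omega>]) (use r in auto)
    finally have "V v r \<omega> \<le> n" using n by simp
    then show ?thesis by (simp add: cut_def upto_def)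
  qed (simp add: upto_def cut_def)
  have "(\<Prod>i\<in>UNIV. \<Prod>r\<in>J i \<omega> \<inter> {0<..t}. max 1 (upto S v i r \<omega>)) \<le> (\<Prod>i\<in>UNIV. \<Prod>r\<in>J i \<omega> \<inter> {0<..t}. cut n v i r \<omega>)" (is "?P \<le> ?C")
    by (intro prod_mono conjI prod_nonneg le) (auto simp: le_max_iff_disj)
  moreover have "0 \<le> ?C" by (intro prod_nonneg) (auto simp: cut_def le_max_iff_disj)
  ultimately have "?P \<le> (exp n * exp (- (LBINT r:{0<..t}. drift (\<lambda>i s. cut n v i s \<omega>) r))) * ?C"
    using mult_right_mono[OF e, of ?C] by linarith
  then have "exp (real CARD('d) * t) * ?P \<le> exp (real CARD('d) * t) * (exp n * Z (cut n v) t \<omega>)"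
    by (intro mult_left_mono) (simp_all add: Z_def expo_def mult.assoc)
  moreover have "Z (upto S v) t \<omega> \<le> exp (real CARD('d) * t) * ?P"
    using s.expo_le_envelope(1)[OF t order_refl] by (simp add: Z_def s.envelope_def)
  ultimately show ?thesis unfolding mult.assoc by (rule order_trans[rotated])
qed

text \<open>The localised exponentials have expectation 1 and are almost surely eventually equal to
  \<open>Z v t\<close>; what has to be excluded is loss of mass. In the second alternative they have
  a common integrable bound. In the first, the mass off \<open>{t < S k}\<close> is split according
  to whether \<open>V\<close> exceeds a level.\<close>

lemma Z_expectation_1:
  assumes v: "rate v" and t: "0 \<le> t"
    and S: "\<And>k. ext_stopping_time M F (S k)" "AE \<omega> in M. \<forall>\<^sub>F k in sequentially. ennreal t < S k \<omega>"
    and K: "\<And>k. \<exists>K. \<forall>i s. \<forall>\<omega>\<in>space M. 0 < s \<longrightarrow> ennreal s \<le> S k \<omega> \<longrightarrow> v i s \<omega> \<le> K"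
    and cond: "integrable M (\<lambda>\<omega>. exp (LBINT s:{0<..t}. \<Sum>i\<in>UNIV. v i s \<omega> * log_plus (v i s \<omega>))) \<or>
      integrable M (\<lambda>\<omega>. exp (\<Sum>i\<in>UNIV. \<Sum>r\<in>J i \<omega> \<inter> {0<..t}. log_plus (v i r \<omega>)))"
  shows "(LINT \<omega>|M. Z v t \<omega>) = 1"
proof -
  let ?v = "\<lambda>k. upto (S k) v"
  have rk: "rate (?v k)" for k by (rule rate_upto[OF v S(1)])
  have Kk: "\<exists>K. 1 \<le> K \<and> (\<forall>i s. \<forall>\<omega>\<in>space M. ?v k i s \<omega> \<le> K)" for k
  proof -
    obtain L where L: "\<And>i s \<omega>. \<omega> \<in> space M \<Longrightarrow> 0 < s \<Longrightarrow> ennreal s \<le> S k \<omega> \<Longrightarrow> v i s \<omega> \<le> L" using K[of k] by blast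
    have "?v k i s \<omega> \<le> max 1 L" if "\<omega> \<in> space M" for i s \<omega>
      using L[OF that, of s i] rate_past[OF v that, of s i] by (cases "0 < s") (auto simp: upto_def le_max_iff_disj)
    then show ?thesis by (intro exI[of _ "max 1 L"]) auto
  qed
  have sp: "space M \<in> sets (F 0)" using sets.top[of "F 0"] space_F[of 0] by simp
  have E1: "(LINT \<omega>|M. Z (?v k) t \<omega>) = 1" for k
  proof -
    obtain L where L: "1 \<le> L" "\<And>i s \<omega>. \<omega> \<in> space M \<Longrightarrow> ?v k i s \<omega> \<le> L" using Kk[of k] by blast
    from Z_expectation_bounded[OF rk L order_refl t sp] rate_past[OF rk]
    have "(\<integral>\<^sup>+\<omega>. indicator (space M) \<omega> * ennreal (Z (?v k) t \<omega>) \<partial>M) = 1" by (simp add: emeasure_space_1)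
    then have "(\<integral>\<^sup>+\<omega>. ennreal (Z (?v k) t \<omega>) \<partial>M) = 1"
      by (subst nn_integral_cong[where v = "\<lambda>\<omega>. indicator (space M) \<omega> * ennreal (Z (?v k) t \<omega>)"]) auto
    then show ?thesis
      using Z_expectation_le_1(2)[OF rk t] Z_nonneg[OF rk] by (subst integral_eq_nn_integral) auto
  qed
  note iZ = Z_expectation_le_1(2)[OF v t] and iZk = Z_expectation_le_1(2)[OF rk t]
  have eq: "Z (?v k) t \<omega> = Z v t \<omega>" if "ennreal t < S k \<omega>" for k \<omega>
    unfolding Z_def
  proof (rule expo_cong)
    fix i s assume "0 < s" "s \<le> t"
    then have "ennreal s \<le> S k \<omega>" using that ennreal_leI[of s t] by (meson less_imp_le order_trans)
    then show "?v k i s \<omega> = v i s \<omega>" by (simp add: upto_def)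
  qed
  have lim: "AE \<omega> in M. (\<lambda>k. Z (?v k) t \<omega>) \<longlonglongrightarrow> Z v t \<omega>"
    using S(2) by eventually_elim (rule tendsto_eventually, erule eventually_mono, rule eq)
  from cond show ?thesis
  proof
    assume D: "integrable M (\<lambda>\<omega>. exp (\<Sum>i\<in>UNIV. \<Sum>r\<in>J i \<omega> \<inter> {0<..t}. log_plus (v i r \<omega>)))"
    have dom: "norm (Z (?v k) t \<omega>) \<le> exp (real CARD('d) * t) * exp (\<Sum>i\<in>UNIV. \<Sum>r\<in>J i \<omega> \<inter> {0<..t}. log_plus (v i r \<omega>))"
      if \<omega>: "\<omega> \<in> space M" for k \<omega>
    proof -
      interpret s: marked_path "\<lambda>i. J i \<omega>" "\<lambda>i s. ?v k i s \<omega>" by (rule rate_marked_path[OF rk \<omega>])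
      have "Z (?v k) t \<omega> \<le> exp (real CARD('d) * t) * exp (\<Sum>i\<in>UNIV. \<Sum>r\<in>J i \<omega> \<inter> {0<..t}. log_plus (?v k i r \<omega>))"
        using s.expo_le_envelope(1)[OF t order_refl] by (simp add: Z_def s.envelope_eq)
      also have "\<dots> \<le> exp (real CARD('d) * t) * exp (\<Sum>i\<in>UNIV. \<Sum>r\<in>J i \<omega> \<inter> {0<..t}. log_plus (v i r \<omega>))"
        by (auto simp: upto_def log_plus_nonneg intro!: sum_mono)
      finally show ?thesis using Z_nonneg[OF rk \<omega>] by simp
    qed
    have "(\<lambda>k. LINT \<omega>|M. Z (?v k) t \<omega>) \<longlonglongrightarrow> (LINT \<omega>|M. Z v t \<omega>)"
    proof (rule integral_dominated_convergence)
      show "integrable M (\<lambda>\<omega>. exp (real CARD('d) * t) * exp (\<Sum>i\<in>UNIV. \<Sum>r\<in>J i \<omega> \<inter> {0<..t}. log_plus (v i r \<omega>)))" using D by simp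
      show "AE \<omega> in M. norm (Z (?v k) t \<omega>) \<le> exp (real CARD('d) * t) * exp (\<Sum>i\<in>UNIV. \<Sum>r\<in>J i \<omega> \<inter> {0<..t}. log_plus (v i r \<omega>))" for k
        by (rule AE_I2[OF dom])
    qed (use iZ iZk lim in auto)
    then have "(\<lambda>k::nat. 1 :: real) \<longlonglongrightarrow> (LINT \<omega>|M. Z v t \<omega>)" by (simp only: E1)
    then show ?thesis by (rule LIMSEQ_unique[OF _ tendsto_const])
  next
    let ?Y = "\<lambda>\<omega>. LBINT s:{0<..t}. \<Sum>i\<in>UNIV. v i s \<omega> * log_plus (v i s \<omega>)"
    assume Y: "integrable M (\<lambda>\<omega>. exp (?Y \<omega>))"
    have Yk: "(LBINT s:{0<..t}. \<Sum>i\<in>UNIV. ?v k i s \<omega> * log_plus (?v k i s \<omega>)) \<le> ?Y \<omega>" if \<omega>: "\<omega> \<in> space M" for k \<omega>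
    proof (rule set_integral_mono)
      show "set_integrable lborel {0<..t} (\<lambda>s. \<Sum>i\<in>UNIV. ?v k i s \<omega> * log_plus (?v k i s \<omega>))"
        by (rule marked_path.entropy_integrable[OF rate_marked_path[OF rk \<omega>]])
      show "set_integrable lborel {0<..t} (\<lambda>s. \<Sum>i\<in>UNIV. v i s \<omega> * log_plus (v i s \<omega>))"
        by (rule marked_path.entropy_integrable[OF rate_marked_path[OF v \<omega>]])
      show "(\<Sum>i\<in>UNIV. ?v k i s \<omega> * log_plus (?v k i s \<omega>)) \<le> (\<Sum>i\<in>UNIV. v i s \<omega> * log_plus (v i s \<omega>))" for s
        using rate_nonneg[OF v \<omega>] log_plus_nonneg by (intro sum_mono) (auto simp: upto_def)
    qed
    define C where "C = 2 * ((LINT \<omega>|M. exp (?Y \<omega>)) + real CARD('d) * t)"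
    have ZV: "integrable M (\<lambda>\<omega>. Z (?v k) t \<omega> * V (?v k) t \<omega>)" "(LINT \<omega>|M. Z (?v k) t \<omega> * V (?v k) t \<omega>) \<le> C" for k
    proof -
      obtain L where L: "1 \<le> L" "\<And>i s \<omega>. \<omega> \<in> space M \<Longrightarrow> ?v k i s \<omega> \<le> L" using Kk[of k] by blast
      show "integrable M (\<lambda>\<omega>. Z (?v k) t \<omega> * V (?v k) t \<omega>)" "(LINT \<omega>|M. Z (?v k) t \<omega> * V (?v k) t \<omega>) \<le> C"
        unfolding C_def by (rule Z_entropy_bound[OF rk L t Y Yk]; assumption)+
    qed
    \<comment> \<open>For a fixed level first \<open>k\<close> tends to infinity, which removes the
      part on \<open>B k\<close>; the error \<open>C / real (Suc n)\<close> is removed afterwards by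
      raising the level.\<close>
    have main: "1 \<le> (LINT \<omega>|M. Z v t \<omega>) + C / real (Suc n)" for n
    proof -
      let ?n = "real (Suc n)"
      define D where "D = (\<lambda>\<omega>. exp (real CARD('d) * t) * exp ?n * Z (cut ?n v) t \<omega>)"
      have D: "integrable M D" unfolding D_def using Z_expectation_le_1(2)[OF rate_cut[OF v] t] by simp
      have D0: "0 \<le> D \<omega>" if "\<omega> \<in> space M" for \<omega> unfolding D_def using Z_nonneg[OF rate_cut[OF v] that] by simp
      define B where "B = (\<lambda>k. {\<omega> \<in> space M. \<not> ennreal t < S k \<omega>})"
      have [measurable]: "S k \<in> borel_measurable M" for k by (rule measurable_ext_stopping_time[OF S(1)])
      have B[measurable]: "B k \<in> sets M" for k unfolding B_def by measurable
      have iD: "integrable M (\<lambda>\<omega>. indicator (B k) \<omega> * D \<omega>)" for k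
        using integrable_mult_indicator[OF B D] by simp
      \<comment> \<open>Before the localising time nothing has changed. After it, with
        \<open>V\<close> at most the level, \<open>Z_upto_le_cut\<close> gives the bound
        \<open>D\<close>, which does not depend on \<open>k\<close>. With \<open>V\<close> above the
        level, Markov's inequality is used pointwise: \<open>z \<le> z * V / n\<close>.\<close>
      have pt: "Z (?v k) t \<omega> \<le> Z v t \<omega> + Z (?v k) t \<omega> * V (?v k) t \<omega> / ?n + indicator (B k) \<omega> * D \<omega>"
        if \<omega>: "\<omega> \<in> space M" for k \<omega>
      proof -
        have z: "0 \<le> Z v t \<omega>" "0 \<le> Z (?v k) t \<omega>" "0 \<le> V (?v k) t \<omega>"
          by (rule Z_nonneg[OF v \<omega>], rule Z_nonneg[OF rk \<omega>], rule V_nonneg[OF rk \<omega> t])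
        then have zv: "0 \<le> Z (?v k) t \<omega> * V (?v k) t \<omega> / ?n" by simp
        consider "ennreal t < S k \<omega>" | "\<not> ennreal t < S k \<omega>" "V (?v k) t \<omega> \<le> ?n" | "?n < V (?v k) t \<omega>" by linarith
        then show ?thesis
        proof cases
          case 1
          then show ?thesis using eq[OF 1] zv by (simp add: B_def)
        next
          case 2
          have "Z (?v k) t \<omega> \<le> D \<omega>" unfolding D_def by (rule Z_upto_le_cut[OF v S(1) \<omega> t _ 2(2)]) simp
          moreover have "indicator (B k) \<omega> * D \<omega> = D \<omega>" using 2(1) \<omega> by (simp add: B_def)
          ultimately show ?thesis using z(1) zv by linarith
        next
          case 3
          have "Z (?v k) t \<omega> * ?n \<le> Z (?v k) t \<omega> * V (?v k) t \<omega>" using 3 z(2) by (intro mult_left_mono) auto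
          then have "Z (?v k) t \<omega> \<le> Z (?v k) t \<omega> * V (?v k) t \<omega> / ?n" by (simp add: pos_le_divide_eq del: of_nat_Suc)
          moreover have "0 \<le> indicator (B k) \<omega> * D \<omega>" using D0[OF \<omega>] by simp
          ultimately show ?thesis using z(1) by linarith
        qed
      qed
      have le: "1 \<le> (LINT \<omega>|M. Z v t \<omega>) + C / ?n + (LINT \<omega>|M. indicator (B k) \<omega> * D \<omega>)" for k
      proof -
        have i2: "integrable M (\<lambda>\<omega>. Z (?v k) t \<omega> * V (?v k) t \<omega> / ?n)" using ZV(1)[of k] by simp
        have "1 = (LINT \<omega>|M. Z (?v k) t \<omega>)" by (rule E1[symmetric])
        also have "\<dots> \<le> (LINT \<omega>|M. Z v t \<omega> + Z (?v k) t \<omega> * V (?v k) t \<omega> / ?n + indicator (B k) \<omega> * D \<omega>)"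
          by (rule integral_mono[OF iZk _ pt]) (intro Bochner_Integration.integrable_add iZ i2 iD)
        also have "\<dots> = (LINT \<omega>|M. Z v t \<omega>) + (LINT \<omega>|M. Z (?v k) t \<omega> * V (?v k) t \<omega>) / ?n + (LINT \<omega>|M. indicator (B k) \<omega> * D \<omega>)"
          using iZ i2 iD[of k] by (simp add: Bochner_Integration.integral_add del: of_nat_Suc)
        also have "\<dots> \<le> (LINT \<omega>|M. Z v t \<omega>) + C / ?n + (LINT \<omega>|M. indicator (B k) \<omega> * D \<omega>)"
          using ZV(2)[of k] by (intro add_mono divide_right_mono) auto
        finally show ?thesis .
      qed
      have "(\<lambda>k. LINT \<omega>|M. indicator (B k) \<omega> * D \<omega>) \<longlonglongrightarrow> (LINT \<omega>|M. 0)"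
      proof (rule integral_dominated_convergence[where w = D])
        show "AE \<omega> in M. (\<lambda>k. indicator (B k) \<omega> * D \<omega>) \<longlonglongrightarrow> 0"
          using S(2) by eventually_elim (rule tendsto_eventually, erule eventually_mono, simp add: B_def)
        show "AE \<omega> in M. norm (indicator (B k) \<omega> * D \<omega>) \<le> D \<omega>" for k
          using D0 by (intro AE_I2) (auto split: split_indicator)
      qed (use D iD in auto)
      then have "(\<lambda>k. (LINT \<omega>|M. Z v t \<omega>) + C / ?n + (LINT \<omega>|M. indicator (B k) \<omega> * D \<omega>)) \<longlonglongrightarrow> (LINT \<omega>|M. Z v t \<omega>) + C / ?n + 0"
        by (intro tendsto_intros) simp
      then have "1 \<le> (LINT \<omega>|M. Z v t \<omega>) + C / ?n + 0"
        by (rule LIMSEQ_le_const) (use le in auto)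
      then show ?thesis by simp
    qed
    have "(\<lambda>n. (LINT \<omega>|M. Z v t \<omega>) + C / real (Suc n)) \<longlonglongrightarrow> (LINT \<omega>|M. Z v t \<omega>) + 0"
      by (intro tendsto_intros LIMSEQ_Suc[OF lim_const_over_n])
    then have "1 \<le> (LINT \<omega>|M. Z v t \<omega>) + 0" by (rule LIMSEQ_le_const) (use main in auto)
    moreover have "(LINT \<omega>|M. Z v t \<omega>) \<le> 1"
    proof -
      have "ennreal (LINT \<omega>|M. Z v t \<omega>) = (\<integral>\<^sup>+\<omega>. ennreal (Z v t \<omega>) \<partial>M)"
        using Z_nonneg[OF v] by (intro nn_integral_eq_integral[symmetric] iZ) auto
      also have "\<dots> \<le> 1" by (rule Z_expectation_le_1(1)[OF v t])
      finally show ?thesis by (simp only: ennreal_le_1)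
    qed
    ultimately show ?thesis by simp
  qed
qed

section \<open>The martingale criterion\<close>

text \<open>A supermartingale step that preserves total mass is a martingale step: the inequalities
  of \<open>Z_supermartingale\<close> for \<open>A\<close> and for its complement add up to an
  equality, so each is one. Hence the conditional expectation of \<open>Z v t\<close> given
  \<open>F u\<close> is 1, and the weight \<open>f\<close> factors out; as it takes values in
  \<open>ennreal\<close>, no integrability is at stake.\<close>

lemma Z_conditional_expectation:
  assumes v: "rate v" and ut: "0 \<le> u" "u \<le> t"
    and v1: "\<And>i s \<omega>. \<omega> \<in> space M \<Longrightarrow> s \<le> u \<Longrightarrow> v i s \<omega> = 1"
    and E: "(LINT \<omega>|M. Z v t \<omega>) = 1" and f: "f \<in> borel_measurable (F u)"
  shows "(\<integral>\<^sup>+\<omega>. f \<omega> * ennreal (Z v t \<omega>) \<partial>M) = (\<integral>\<^sup>+\<omega>. f \<omega> \<partial>M)"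
proof -
  have t: "0 \<le> t" using ut by simp
  note iZ = Z_expectation_le_1(2)[OF v t] and mZ[measurable] = Z_measurable[OF v t]
  interpret Fu: finite_measure_subalgebra M "F u" by unfold_locales (rule subalg[OF ut(1)])
  have iB: "integrable M (\<lambda>\<omega>. indicator B \<omega> * Z v t \<omega>)" if "B \<in> sets M" for B
    using integrable_mult_indicator[OF that iZ] by simp
  have nn: "(\<integral>\<^sup>+\<omega>. indicator B \<omega> * ennreal (Z v t \<omega>) \<partial>M) = ennreal (LINT \<omega>|M. indicator B \<omega> * Z v t \<omega>)" if B: "B \<in> sets M" for B
  proof -
    have "(\<integral>\<^sup>+\<omega>. indicator B \<omega> * ennreal (Z v t \<omega>) \<partial>M) = (\<integral>\<^sup>+\<omega>. ennreal (indicator B \<omega> * Z v t \<omega>) \<partial>M)"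
      by (rule nn_integral_cong) (auto split: split_indicator)
    also have "\<dots> = ennreal (LINT \<omega>|M. indicator B \<omega> * Z v t \<omega>)"
      using Z_nonneg[OF v] by (intro nn_integral_eq_integral iB B) auto
    finally show ?thesis .
  qed
  have le: "(LINT \<omega>|M. indicator B \<omega> * Z v t \<omega>) \<le> measure M B" if B: "B \<in> sets (F u)" for B
  proof -
    have "ennreal (LINT \<omega>|M. indicator B \<omega> * Z v t \<omega>) \<le> ennreal (measure M B)"
      using Z_supermartingale[OF v ut B v1] nn[OF sets_F[OF ut(1) B]] by (simp add: emeasure_eq_measure)
    then show ?thesis by (simp add: ennreal_le_iff)
  qed
  have eq: "(LINT \<omega>|M. indicator A \<omega> * Z v t \<omega>) = measure M A" if A: "A \<in> sets (F u)" for A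
  proof -
    have AM: "A \<in> sets M" by (rule sets_F[OF ut(1) A])
    have Ac: "space M - A \<in> sets (F u)" using sets.compl_sets[OF A] space_F[OF ut(1)] by simp
    have "1 = (LINT \<omega>|M. indicator A \<omega> * Z v t \<omega> + indicator (space M - A) \<omega> * Z v t \<omega>)"
      unfolding E[symmetric] by (rule Bochner_Integration.integral_cong) (auto split: split_indicator)
    also have "\<dots> = (LINT \<omega>|M. indicator A \<omega> * Z v t \<omega>) + (LINT \<omega>|M. indicator (space M - A) \<omega> * Z v t \<omega>)"
      using AM by (intro Bochner_Integration.integral_add iB) auto
    finally have "1 = (LINT \<omega>|M. indicator A \<omega> * Z v t \<omega>) + (LINT \<omega>|M. indicator (space M - A) \<omega> * Z v t \<omega>)" .
    then show ?thesis using le[OF A] le[OF Ac] prob_compl[OF AM] by linarith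
  qed
  have "AE \<omega> in M. 1 = nn_cond_exp M (F u) (\<lambda>\<omega>. ennreal (Z v t \<omega>)) \<omega>"
  proof (rule Fu.nn_cond_exp_charact)
    fix A assume A: "A \<in> sets (F u)"
    have AM: "A \<in> sets M" by (rule sets_F[OF ut(1) A])
    have "(\<integral>\<^sup>+\<omega>\<in>A. ennreal (Z v t \<omega>) \<partial>M) = emeasure M A"
      using nn[OF AM] eq[OF A] by (simp add: emeasure_eq_measure mult.commute)
    then show "(\<integral>\<^sup>+\<omega>\<in>A. ennreal (Z v t \<omega>) \<partial>M) = (\<integral>\<^sup>+\<omega>\<in>A. 1 \<partial>M)" using AM by simp
  qed auto
  then have "(\<integral>\<^sup>+\<omega>. f \<omega> * nn_cond_exp M (F u) (\<lambda>\<omega>. ennreal (Z v t \<omega>)) \<omega> \<partial>M) = (\<integral>\<^sup>+\<omega>. f \<omega> \<partial>M)"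
    by (intro nn_integral_cong_AE) (auto elim!: eventually_mono)
  then show ?thesis using Fu.nn_cond_exp_intg[OF f, of "\<lambda>\<omega>. ennreal (Z v t \<omega>)"] by simp
qed

text \<open>Walk back from \<open>t\<close> to \<open>s\<close> in steps of length at most
  \<open>\<epsilon>\<close>: by \<open>expo_multiplicative\<close> each step splits off a factor
  \<open>Z (after u v) t\<close>, whose conditional expectation given \<open>F u\<close> is
  1.\<close>

lemma Z_martingale:
  assumes v: "rate v" and eps: "0 < \<epsilon>"
    and E: "\<And>u t. 0 \<le> u \<Longrightarrow> u \<le> t \<Longrightarrow> t - u \<le> \<epsilon> \<Longrightarrow> (LINT \<omega>|M. Z (after u v) t \<omega>) = 1"
    and st: "0 \<le> s" "s \<le> t" and A: "A \<in> sets (F s)"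
  shows "(\<integral>\<^sup>+\<omega>. indicator A \<omega> * ennreal (Z v t \<omega>) \<partial>M) = (\<integral>\<^sup>+\<omega>. indicator A \<omega> * ennreal (Z v s \<omega>) \<partial>M)"
proof -
  have step: "(\<integral>\<^sup>+\<omega>. indicator A \<omega> * ennreal (Z v t \<omega>) \<partial>M) = (\<integral>\<^sup>+\<omega>. indicator A \<omega> * ennreal (Z v u \<omega>) \<partial>M)"
    if u: "s \<le> u" "u \<le> t" "t - u \<le> \<epsilon>" for u t
  proof -
    have u0: "0 \<le> u" using u st by simp
    have a: "rate (after u v)" by (rule rate_after[OF v u0])
    have [measurable]: "A \<in> sets (F u)" by (rule sets_F_mono[OF st(1) u(1) A])
    note [measurable] = adapted_Z[OF v u0]
    have "(\<integral>\<^sup>+\<omega>. indicator A \<omega> * ennreal (Z v t \<omega>) \<partial>M)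
      = (\<integral>\<^sup>+\<omega>. (indicator A \<omega> * ennreal (Z v u \<omega>)) * ennreal (Z (after u v) t \<omega>) \<partial>M)"
    proof (rule nn_integral_cong)
      fix \<omega> assume \<omega>: "\<omega> \<in> space M"
      have "Z v t \<omega> = Z v u \<omega> * Z (after u v) t \<omega>"
        unfolding Z_def after_def by (rule marked_path.expo_multiplicative[OF rate_marked_path[OF v \<omega>] u0 u(2)])
      then show "indicator A \<omega> * ennreal (Z v t \<omega>) = indicator A \<omega> * ennreal (Z v u \<omega>) * ennreal (Z (after u v) t \<omega>)"
        using Z_nonneg[OF v \<omega>] Z_nonneg[OF a \<omega>] by (simp add: ennreal_mult mult.assoc)
    qed
    also have "\<dots> = (\<integral>\<^sup>+\<omega>. indicator A \<omega> * ennreal (Z v u \<omega>) \<partial>M)"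
    proof (rule Z_conditional_expectation[OF a u0 u(2) _ E[OF u0 u(2,3)]])
      show "(\<lambda>\<omega>. indicator A \<omega> * ennreal (Z v u \<omega>)) \<in> borel_measurable (F u)" by measurable
    qed (simp add: after_def)
    finally show ?thesis .
  qed
  have "(\<integral>\<^sup>+\<omega>. indicator A \<omega> * ennreal (Z v t \<omega>) \<partial>M) = (\<integral>\<^sup>+\<omega>. indicator A \<omega> * ennreal (Z v s \<omega>) \<partial>M)"
    if "s \<le> t" "t - s \<le> real k * \<epsilon>" for k t
    using that
  proof (induction k arbitrary: t)
    case 0
    then show ?case by simp
  next
    case (Suc k)
    show ?case
    proof (cases "t - s \<le> \<epsilon>")
      case True
      show ?thesis by (rule step[OF order_refl Suc.prems(1) True])
    next
      case False
      then have 1: "s \<le> t - \<epsilon>" by simp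
      have "real (Suc k) * \<epsilon> = real k * \<epsilon> + \<epsilon>" by (simp add: distrib_right)
      then have 2: "(t - \<epsilon>) - s \<le> real k * \<epsilon>" using Suc.prems(2) by linarith
      have "(\<integral>\<^sup>+\<omega>. indicator A \<omega> * ennreal (Z v t \<omega>) \<partial>M) = (\<integral>\<^sup>+\<omega>. indicator A \<omega> * ennreal (Z v (t - \<epsilon>) \<omega>) \<partial>M)"
        by (rule step[OF 1]) (use eps in auto)
      also have "\<dots> = (\<integral>\<^sup>+\<omega>. indicator A \<omega> * ennreal (Z v s \<omega>) \<partial>M)" by (rule Suc.IH[OF 1 2])
      finally show ?thesis .
    qed
  qed
  moreover obtain k :: nat where "(t - s) / \<epsilon> < real k" using reals_Archimedean2 by blast
  then have "t - s \<le> real k * \<epsilon>" using eps by (simp add: divide_less_eq)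
  ultimately show ?thesis using st by blast
qed

section \<open>Identification with the stochastic exponential, and transfer of the integrability
  conditions\<close>

lemma has_ls_integral_N:
  assumes \<omega>: "\<omega> \<in> space M" and ut: "0 \<le> u" "u \<le> t" and f: "set_borel_measurable borel {u<..t} f"
  shows "has_ls_integral f (\<lambda>s. N i s \<omega>) u t (\<Sum>r\<in>J i \<omega> \<inter> {u<..t}. f r)"
proof -
  interpret marked_path "\<lambda>i. J i \<omega>" "\<lambda>i s. 1" by (rule rate_marked_path[OF rate_one \<omega>])
  have "has_ls_integral f (\<lambda>s. N i u \<omega> + (\<Sum>r\<in>J i \<omega> \<inter> {u<..s}. 1)) u t (0 + (\<Sum>r\<in>J i \<omega> \<inter> {u<..t}. 1 * f r))"
    by (rule has_ls_integral_add[OF has_ls_integral_const[OF f] has_ls_integral_jumps[OF f ut(1)]])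
  then have "has_ls_integral f (\<lambda>s. N i s \<omega>) u t (0 + (\<Sum>r\<in>J i \<omega> \<inter> {u<..t}. 1 * f r))"
  proof (rule has_ls_integral_cong)
    show "N i u \<omega> + (\<Sum>r\<in>J i \<omega> \<inter> {u<..s}. 1) = N i s \<omega>" if "s \<in> {u..t}" for s
      using N_increment[OF \<omega> ut(1), of s i] that by simp
  qed simp
  then show ?thesis by simp
qed

lemma has_ls_integral_compensated:
  assumes \<omega>: "\<omega> \<in> space M" and t: "0 \<le> t" and f: "set_borel_measurable borel {0<..t} f"
    and K: "\<And>s. s \<in> {0<..t} \<Longrightarrow> \<bar>f s\<bar> \<le> K"
  shows "has_ls_integral f (\<lambda>s. N i s \<omega> - s) 0 t ((\<Sum>r\<in>J i \<omega> \<inter> {0<..t}. f r) - (LBINT s:{0<..t}. f s))"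
proof -
  have "has_ls_integral f (\<lambda>s. LBINT r:{0<..s}. 1) 0 t (LBINT r:{0<..t}. f r * 1)"
    by (rule has_ls_integral_absolutely_continuous[of _ _ _ _ "max K 1"]) (use f K t in \<open>auto simp: le_max_iff_disj\<close>)
  then have "has_ls_integral f (\<lambda>s. s) 0 t (LBINT r:{0<..t}. f r * 1)"
    by (rule has_ls_integral_cong) (simp_all add: set_lebesgue_integral_def)
  then show ?thesis
    using has_ls_integral_diff[OF has_ls_integral_N[OF \<omega> order_refl t f]] by simp
qed

end

text \<open>A localising sequence is fixed, together with a null set \<open>C\<close> off which it
  exceeds every time; almost sure properties of paths become properties off
  \<open>C\<close>.\<close>

locale intensity_change = unit_intensity M F N
  for M :: "'a measure" and F and N :: "'d::finite \<Rightarrow> real \<Rightarrow> 'a \<Rightarrow> real" +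
  fixes \<mu> :: "'d \<Rightarrow> real \<Rightarrow> 'a \<Rightarrow> real" and T :: "nat \<Rightarrow> 'a \<Rightarrow> ennreal" and C :: "'a set"
  assumes \<mu>_nonneg: "nonneg_process M \<mu>" and \<mu>_predictable: "\<And>i. predictable M F (\<mu> i)"
    and T_stopping: "\<And>n. ext_stopping_time M F (T n)"
    and T_bound: "\<And>n. \<exists>K. \<forall>i. \<forall>t\<ge>0. \<forall>\<omega>\<in>space M. \<bar>stopped (\<mu> i) (T n) t \<omega>\<bar> \<le> K"
    and C_null: "C \<in> null_sets M"
    and T_unbounded: "\<And>\<omega> t. \<omega> \<in> space M \<Longrightarrow> \<omega> \<notin> C \<Longrightarrow> \<forall>\<^sub>F n in sequentially. ennreal t < T n \<omega>"
begin

text \<open>Changing \<open>\<mu>\<close> on a null set makes all paths bounded on compacts.\<close>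

definition \<nu> :: "'d \<Rightarrow> 'a process" where
  "\<nu> i s \<omega> = (if 0 < s \<and> \<omega> \<notin> C then \<mu> i s \<omega> else 1)"

lemma \<nu>_bound: obtains K where "\<And>i s \<omega>. \<omega> \<in> space M \<Longrightarrow> 0 < s \<Longrightarrow> ennreal s \<le> T n \<omega> \<Longrightarrow> \<nu> i s \<omega> \<le> K"
proof -
  obtain K where K: "\<And>i t \<omega>. 0 \<le> t \<Longrightarrow> \<omega> \<in> space M \<Longrightarrow> \<bar>stopped (\<mu> i) (T n) t \<omega>\<bar> \<le> K" using T_bound[of n] by blast
  show ?thesis
  proof (rule that)
    fix i s \<omega> assume \<omega>: "\<omega> \<in> space M" and s: "0 < s" "ennreal s \<le> T n \<omega>"
    \<comment> \<open>A positive \<open>s\<close> forces \<open>T n \<omega> > 0\<close>, so the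
      stopped process has the value of \<open>\<mu>\<close> and not the default 0.\<close>
    have "0 < ennreal s" using s(1) by simp
    then have "0 < T n \<omega>" using s(2) by (rule less_le_trans)
    then have "\<mu> i s \<omega> = stopped (\<mu> i) (T n) s \<omega>" using s(2) by (simp add: stopped_def)
    also have "\<dots> \<le> K" using K[of s \<omega> i] s(1) \<omega> by simp
    finally show "\<nu> i s \<omega> \<le> max K 1" by (auto simp: \<nu>_def)
  qed
qed

lemma rate_\<nu>: "rate \<nu>"
  unfolding rate_def
proof (intro conjI allI ballI impI)
  have [measurable]: "(\<lambda>w. \<mu> i (fst w) (snd w)) \<in> borel_measurable P" for i
    using \<mu>_predictable[of i] by (simp add: predictable_def case_prod_beta')
  \<comment> \<open>The usual conditions put \<open>C\<close> into the sigma-algebra at time 0, so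
    that changing the rate on \<open>C\<close> preserves predictability.\<close>
  have "space M - C \<in> sets (F 0)"
    using sets.compl_sets[of C "F 0"] C_null null_sets_F0 space_F[of 0] by auto
  note [measurable] = predictable_after[OF order_refl this]
  fix i
  have "(\<lambda>w. if 0 < fst w \<and> snd w \<in> space M - C then \<mu> i (fst w) (snd w) else 1) \<in> borel_measurable P" by measurable
  then show "(\<lambda>w. \<nu> i (fst w) (snd w)) \<in> borel_measurable P"
    by (rule measurable_congI) (auto simp: \<nu>_def space_P)
next
  fix \<omega> assume \<omega>: "\<omega> \<in> space M"
  show "0 \<le> \<nu> i s \<omega>" for i s using \<mu>_nonneg \<omega> by (simp add: \<nu>_def nonneg_process_def)
  show "\<nu> i s \<omega> = 1" if "s \<le> 0" for i s using that by (simp add: \<nu>_def)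
  show "\<exists>K. \<forall>i. \<forall>s\<le>t. \<nu> i s \<omega> \<le> K" for t
  proof (cases "\<omega> \<in> C")
    case True
    then show ?thesis by (intro exI[of _ 1]) (simp add: \<nu>_def)
  next
    case False
    obtain n where n: "ennreal t < T n \<omega>"
      using T_unbounded[OF \<omega> False, of t] unfolding eventually_sequentially by blast
    obtain K where K: "\<And>i s \<omega>. \<omega> \<in> space M \<Longrightarrow> 0 < s \<Longrightarrow> ennreal s \<le> T n \<omega> \<Longrightarrow> \<nu> i s \<omega> \<le> K" using \<nu>_bound by blast
    have "\<nu> i s \<omega> \<le> max K 1" if "s \<le> t" for i s
    proof (cases "0 < s")
      case True
      have "ennreal s \<le> T n \<omega>" using ennreal_leI[OF that] n by (auto intro: order_trans less_imp_le)
      then show ?thesis using K[OF \<omega> True] by (simp add: le_max_iff_disj)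
    qed (simp add: \<nu>_def)
    then show ?thesis by blast
  qed
qed

lemma AE_not_C: "AE \<omega> in M. \<omega> \<notin> C"
  by (rule AE_not_in[OF C_null])

definition X :: "'a process" where
  "X = stoch_integral (\<lambda>i t \<omega>. \<mu> i t \<omega> - 1) (\<lambda>i t \<omega>. N i t \<omega> - t)"

text \<open>Off \<open>C\<close> the path of \<open>\<nu>\<close> replaces that of
  \<open>\<mu>\<close> on \<open>(0, t]\<close>; it is bounded, so the pathwise integral exists and
  \<open>ls_integral\<close> picks it.\<close>

lemma X_eq_driver:
  assumes \<omega>: "\<omega> \<in> space M" "\<omega> \<notin> C" and t: "0 \<le> t"
  shows "X t \<omega> = marked_path.driver (\<lambda>i. J i \<omega>) (\<lambda>i s. \<nu> i s \<omega>) t"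
proof -
  interpret marked_path "\<lambda>i. J i \<omega>" "\<lambda>i s. \<nu> i s \<omega>" by (rule rate_marked_path[OF rate_\<nu> \<omega>(1)])
  obtain K where K: "0 \<le> K" "\<And>i s. s \<le> t \<Longrightarrow> \<nu> i s \<omega> \<le> K" using v_bounded' by blast
  have "ls_integral (\<lambda>s. \<mu> i s \<omega> - 1) (\<lambda>s. N i s \<omega> - s) 0 t
    = (\<Sum>r\<in>J i \<omega> \<inter> {0<..t}. \<nu> i r \<omega> - 1) - (LBINT s:{0<..t}. \<nu> i s \<omega> - 1)" for i
  proof (rule ls_integral_eqI[OF _ t])
    have "has_ls_integral (\<lambda>s. \<nu> i s \<omega> - 1) (\<lambda>s. N i s \<omega> - s) 0 t
      ((\<Sum>r\<in>J i \<omega> \<inter> {0<..t}. \<nu> i r \<omega> - 1) - (LBINT s:{0<..t}. \<nu> i s \<omega> - 1))"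
    proof (rule has_ls_integral_compensated[OF \<omega>(1) t])
      show "set_borel_measurable borel {0<..t} (\<lambda>s. \<nu> i s \<omega> - 1)"
        unfolding set_borel_measurable_def by measurable
      show "\<bar>\<nu> i s \<omega> - 1\<bar> \<le> K + 1" if "s \<in> {0<..t}" for s
        using K(2)[of s i] that v_nonneg[of i s] K(1) by (auto simp: abs_if)
    qed
    then show "has_ls_integral (\<lambda>s. \<mu> i s \<omega> - 1) (\<lambda>s. N i s \<omega> - s) 0 t
      ((\<Sum>r\<in>J i \<omega> \<inter> {0<..t}. \<nu> i r \<omega> - 1) - (LBINT s:{0<..t}. \<nu> i s \<omega> - 1))"
      by (rule has_ls_integral_cong) (use \<omega>(2) in \<open>auto simp: \<nu>_def\<close>)
  qed
  then show ?thesis by (simp add: X_def stoch_integral_def driver_def)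
qed

lemma Z_solves:
  assumes \<omega>: "\<omega> \<in> space M" "\<omega> \<notin> C" and t: "0 \<le> t"
  shows "has_ls_integral (left_limit (\<lambda>s. Z \<nu> s \<omega>)) (\<lambda>s. X s \<omega>) 0 t (Z \<nu> t \<omega> - 1)"
proof -
  interpret marked_path "\<lambda>i. J i \<omega>" "\<lambda>i s. \<nu> i s \<omega>" by (rule rate_marked_path[OF rate_\<nu> \<omega>(1)])
  have "has_ls_integral (left_limit (\<lambda>s. Z \<nu> s \<omega>)) driver 0 t (Z \<nu> t \<omega> - 1)"
    unfolding Z_def using expo_solves[OF t] .
  then show ?thesis by (rule has_ls_integral_cong) (auto simp: X_eq_driver[OF \<omega>])
qed

lemma is_doleans_dade_Z: "is_doleans_dade M F X (Z \<nu>)"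
  unfolding is_doleans_dade_def adapted_def
proof (intro conjI allI impI ballI)
  show "AE \<omega> in M. \<forall>t\<ge>0. has_ls_integral (left_limit (\<lambda>s. Z \<nu> s \<omega>)) (\<lambda>s. X s \<omega>) 0 t (Z \<nu> t \<omega> - 1)"
    by (rule AE_mp[OF AE_not_C], intro AE_I2 impI allI Z_solves)
qed (rule adapted_Z[OF rate_\<nu>] cadlag_Z[OF rate_\<nu>], assumption)+

text \<open>Both processes solve the same equation on almost every path, so
  \<open>ls_equation_unique\<close> applies path by path.\<close>

lemma doleans_dade_unique:
  assumes Z': "is_doleans_dade M F X Z'" and t: "0 \<le> t"
  shows "AE \<omega> in M. Z' t \<omega> = Z \<nu> t \<omega>"
proof -
  have "AE \<omega> in M. \<forall>t\<ge>0. has_ls_integral (left_limit (\<lambda>s. Z' s \<omega>)) (\<lambda>s. X s \<omega>) 0 t (Z' t \<omega> - 1)"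
    using Z' unfolding is_doleans_dade_def by blast
  with AE_not_C show ?thesis
  proof (rule AE_mp[OF AE_conjI], intro AE_I2 impI)
    fix \<omega> assume \<omega>: "\<omega> \<in> space M"
      and *: "\<omega> \<notin> C \<and> (\<forall>t\<ge>0. has_ls_integral (left_limit (\<lambda>s. Z' s \<omega>)) (\<lambda>s. X s \<omega>) 0 t (Z' t \<omega> - 1))"
    have "cadlag (\<lambda>t. Z' t \<omega>)" using Z' \<omega> unfolding is_doleans_dade_def by blast
    from ls_equation_unique[OF this cadlag_Z[OF rate_\<nu> \<omega>], of "\<lambda>s. X s \<omega>" t] * t Z_solves[OF \<omega>]
    show "Z' t \<omega> = Z \<nu> t \<omega>" by blast
  qed
qed

text \<open>The exponents agree off \<open>C\<close>: up to \<open>u\<close> the rate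
  \<open>after u \<nu>\<close> is 1 and \<open>log_plus 1 = 0\<close>, the endpoint \<open>u\<close>
  has Lebesgue measure 0, and at positive times \<open>\<nu>\<close> is \<open>\<mu>\<close>.
  Measurability of the left one then turns the finite nonnegative integral into
  integrability.\<close>

lemma entropy_condition:
  assumes ut: "0 \<le> u" "u \<le> t"
    and fin: "(\<integral>\<^sup>+\<omega>. ennreal (exp (\<Sum>i\<in>UNIV. LBINT s:{u..t}. \<mu> i s \<omega> * log_plus (\<mu> i s \<omega>))) \<partial>M) < \<infinity>"
  shows "integrable M (\<lambda>\<omega>. exp (LBINT s:{0<..t}. \<Sum>i\<in>UNIV. after u \<nu> i s \<omega> * log_plus (after u \<nu> i s \<omega>)))"
proof -
  have t: "0 \<le> t" using ut by simp
  have a: "rate (after u \<nu>)" by (rule rate_after[OF rate_\<nu> ut(1)])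
  let ?g = "\<lambda>w. \<Sum>i\<in>UNIV. after u \<nu> i (fst w) (snd w) * log_plus (after u \<nu> i (fst w) (snd w))"
  note rate_predictable[OF a, measurable]
  have g: "?g \<in> borel_measurable P" by measurable
  have eq: "(LBINT s:{0<..t}. ?g (s, \<omega>)) = (\<Sum>i\<in>UNIV. LBINT s:{u..t}. \<mu> i s \<omega> * log_plus (\<mu> i s \<omega>))"
    if \<omega>: "\<omega> \<in> space M" "\<omega> \<notin> C" for \<omega>
  proof -
    interpret marked_path "\<lambda>i. J i \<omega>" "\<lambda>i s. \<nu> i s \<omega>" by (rule rate_marked_path[OF rate_\<nu> \<omega>(1)])
    obtain K where K: "0 \<le> K" "\<And>i s. s \<le> t \<Longrightarrow> \<nu> i s \<omega> \<le> K" using v_bounded' by blast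
    have si: "set_integrable lborel {u<..t} (\<lambda>s. \<nu> i s \<omega> * log_plus (\<nu> i s \<omega>))" for i
    proof (rule set_integrable_bounded_interval)
      show "set_borel_measurable borel {u<..t} (\<lambda>s. \<nu> i s \<omega> * log_plus (\<nu> i s \<omega>))"
        unfolding set_borel_measurable_def by measurable
      show "\<bar>\<nu> i s \<omega> * log_plus (\<nu> i s \<omega>)\<bar> \<le> K * log_plus K" if "s \<in> {u<..t}" for s
        using K(2)[of s i] that v_nonneg[of i s] log_plus_nonneg log_plus_mono[of "\<nu> i s \<omega>" K]
        by (simp add: abs_mult mult_mono K(1))
    qed
    have "(LBINT s:{0<..t}. ?g (s, \<omega>)) = (LBINT s:{u<..t}. \<Sum>i\<in>UNIV. \<nu> i s \<omega> * log_plus (\<nu> i s \<omega>))"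
      unfolding set_lebesgue_integral_def using ut
      by (intro Bochner_Integration.integral_cong) (auto simp: after_def split: split_indicator)
    also have "\<dots> = (\<Sum>i\<in>UNIV. LBINT s:{u<..t}. \<nu> i s \<omega> * log_plus (\<nu> i s \<omega>))"
      by (rule set_integral_sum(2)[OF si])
    also have "\<dots> = (\<Sum>i\<in>UNIV. LBINT s:{u..t}. \<mu> i s \<omega> * log_plus (\<mu> i s \<omega>))"
    proof (rule sum.cong[OF refl])
      fix i
      have "(LBINT s:{u<..t}. \<nu> i s \<omega> * log_plus (\<nu> i s \<omega>)) = (LBINT s:{u<..t}. \<mu> i s \<omega> * log_plus (\<mu> i s \<omega>))"
        by (rule set_lebesgue_integral_cong) (use ut \<omega>(2) in \<open>auto simp: \<nu>_def\<close>)
      also have "\<dots> = (LBINT s:{u..t}. \<mu> i s \<omega> * log_plus (\<mu> i s \<omega>))"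
        by (rule set_integral_discrete_difference[of "{u}"]) auto
      finally show "(LBINT s:{u<..t}. \<nu> i s \<omega> * log_plus (\<nu> i s \<omega>)) = (LBINT s:{u..t}. \<mu> i s \<omega> * log_plus (\<mu> i s \<omega>))" .
    qed
    finally show ?thesis .
  qed
  have bd: "\<exists>K. \<forall>s. 0 < s \<longrightarrow> s \<le> t \<longrightarrow> \<bar>?g (s, \<omega>)\<bar> \<le> K" if \<omega>: "\<omega> \<in> space M" for \<omega>
  proof -
    obtain K where K: "\<And>i s. s \<le> t \<Longrightarrow> after u \<nu> i s \<omega> \<le> K" using rate_bounded[OF a \<omega>, of t] by blast
    have "\<bar>?g (s, \<omega>)\<bar> \<le> (\<Sum>i\<in>(UNIV::'d set). max K 0 * log_plus (max K 0))" if "s \<le> t" for s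
    proof (rule order_trans[OF sum_abs], rule sum_mono)
      fix i :: 'd
      have x: "0 \<le> after u \<nu> i s \<omega>" "after u \<nu> i s \<omega> \<le> max K 0"
        using rate_nonneg[OF a \<omega>] K[OF that, of i] by (auto simp: le_max_iff_disj)
      show "\<bar>after u \<nu> i (fst (s, \<omega>)) (snd (s, \<omega>)) * log_plus (after u \<nu> i (fst (s, \<omega>)) (snd (s, \<omega>)))\<bar> \<le> max K 0 * log_plus (max K 0)"
        using x log_plus_mono[OF x(2)] log_plus_nonneg[of "after u \<nu> i s \<omega>"] by (simp add: abs_mult mult_mono)
    qed
    then show ?thesis by blast
  qed
  have m: "(\<lambda>\<omega>. LBINT s:{0<..t}. ?g (s, \<omega>)) \<in> borel_measurable M"
    by (rule measurable_F_M[OF t adapted_integral[OF t g bd]])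
  have "(\<integral>\<^sup>+\<omega>. ennreal (exp (LBINT s:{0<..t}. ?g (s, \<omega>))) \<partial>M)
    = (\<integral>\<^sup>+\<omega>. ennreal (exp (\<Sum>i\<in>UNIV. LBINT s:{u..t}. \<mu> i s \<omega> * log_plus (\<mu> i s \<omega>))) \<partial>M)"
  proof (rule nn_integral_cong_AE, rule AE_mp[OF AE_not_C], intro AE_I2 impI)
    fix \<omega> assume \<omega>: "\<omega> \<in> space M" "\<omega> \<notin> C"
    show "ennreal (exp (LBINT s:{0<..t}. ?g (s, \<omega>))) = ennreal (exp (\<Sum>i\<in>UNIV. LBINT s:{u..t}. \<mu> i s \<omega> * log_plus (\<mu> i s \<omega>)))"
      by (simp only: eq[OF \<omega>])
  qed
  then have "integrable M (\<lambda>\<omega>. exp (LBINT s:{0<..t}. ?g (s, \<omega>)))"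
    using fin m by (intro integrableI_nonneg) auto
  then show ?thesis by simp
qed

text \<open>As in \<open>entropy_condition\<close>. A jump at \<open>u\<close> counts on neither
  side, since \<open>ls_integral\<close> runs over \<open>(u, t]\<close> and
  \<open>after u \<nu>\<close> is still 1 at \<open>u\<close>.\<close>

lemma jump_condition:
  assumes ut: "0 \<le> u" "u \<le> t"
    and fin: "(\<integral>\<^sup>+\<omega>. ennreal (exp (\<Sum>i\<in>UNIV. ls_integral (\<lambda>s. log_plus (\<mu> i s \<omega>)) (\<lambda>s. N i s \<omega>) u t)) \<partial>M) < \<infinity>"
  shows "integrable M (\<lambda>\<omega>. exp (\<Sum>i\<in>UNIV. \<Sum>r\<in>J i \<omega> \<inter> {0<..t}. log_plus (after u \<nu> i r \<omega>)))"
proof -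
  have t: "0 \<le> t" using ut by simp
  have a: "rate (after u \<nu>)" by (rule rate_after[OF rate_\<nu> ut(1)])
  note rate_predictable[OF a, measurable]
  have g: "(\<lambda>w. log_plus (after u \<nu> i (fst w) (snd w))) \<in> borel_measurable P" for i by measurable
  have eq: "(\<Sum>r\<in>J i \<omega> \<inter> {0<..t}. log_plus (after u \<nu> i r \<omega>)) = ls_integral (\<lambda>s. log_plus (\<mu> i s \<omega>)) (\<lambda>s. N i s \<omega>) u t"
    if \<omega>: "\<omega> \<in> space M" "\<omega> \<notin> C" for i \<omega>
  proof -
    interpret marked_path "\<lambda>i. J i \<omega>" "\<lambda>i s. \<nu> i s \<omega>" by (rule rate_marked_path[OF rate_\<nu> \<omega>(1)])
    have "has_ls_integral (\<lambda>s. log_plus (\<nu> i s \<omega>)) (\<lambda>s. N i s \<omega>) u t (\<Sum>r\<in>J i \<omega> \<inter> {u<..t}. log_plus (\<nu> i r \<omega>))"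
      by (rule has_ls_integral_N[OF \<omega>(1) ut]) (unfold set_borel_measurable_def, measurable)
    then have "has_ls_integral (\<lambda>s. log_plus (\<mu> i s \<omega>)) (\<lambda>s. N i s \<omega>) u t (\<Sum>r\<in>J i \<omega> \<inter> {u<..t}. log_plus (\<nu> i r \<omega>))"
      by (rule has_ls_integral_cong) (use ut \<omega>(2) in \<open>auto simp: \<nu>_def\<close>)
    then have "ls_integral (\<lambda>s. log_plus (\<mu> i s \<omega>)) (\<lambda>s. N i s \<omega>) u t = (\<Sum>r\<in>J i \<omega> \<inter> {u<..t}. log_plus (\<nu> i r \<omega>))"
      by (rule ls_integral_eqI[OF _ ut(2)])
    also have "\<dots> = (\<Sum>r\<in>J i \<omega> \<inter> {0<..t}. log_plus (after u \<nu> i r \<omega>))"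
      by (rule sum.mono_neutral_cong_left) (use ut J_finite'(1)[of i t] in \<open>auto simp: after_def\<close>)
    finally show ?thesis ..
  qed
  have "(\<lambda>\<omega>. \<Sum>r\<in>J i \<omega> \<inter> {0<..t}. log_plus (after u \<nu> i r \<omega>)) \<in> borel_measurable M" for i
    using measurable_F_M[OF t adapted_jump_sum[OF t g]] by simp
  then have m: "(\<lambda>\<omega>. exp (\<Sum>i\<in>UNIV. \<Sum>r\<in>J i \<omega> \<inter> {0<..t}. log_plus (after u \<nu> i r \<omega>))) \<in> borel_measurable M"
    by measurable
  have "(\<integral>\<^sup>+\<omega>. ennreal (exp (\<Sum>i\<in>UNIV. \<Sum>r\<in>J i \<omega> \<inter> {0<..t}. log_plus (after u \<nu> i r \<omega>))) \<partial>M)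
    = (\<integral>\<^sup>+\<omega>. ennreal (exp (\<Sum>i\<in>UNIV. ls_integral (\<lambda>s. log_plus (\<mu> i s \<omega>)) (\<lambda>s. N i s \<omega>) u t)) \<partial>M)"
  proof (rule nn_integral_cong_AE, rule AE_mp[OF AE_not_C], intro AE_I2 impI)
    fix \<omega> assume \<omega>: "\<omega> \<in> space M" "\<omega> \<notin> C"
    show "ennreal (exp (\<Sum>i\<in>UNIV. \<Sum>r\<in>J i \<omega> \<inter> {0<..t}. log_plus (after u \<nu> i r \<omega>)))
      = ennreal (exp (\<Sum>i\<in>UNIV. ls_integral (\<lambda>s. log_plus (\<mu> i s \<omega>)) (\<lambda>s. N i s \<omega>) u t))"
      by (simp only: eq[OF \<omega>])
  qed
  then show ?thesis using fin m by (intro integrableI_nonneg) auto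
qed

text \<open>\<open>Z_expectation_1\<close> applies to the rate restarted at \<open>u\<close> on each
  interval no longer than \<open>\<epsilon>\<close>, and \<open>Z_martingale\<close> chains these.
  Any other version agrees with \<open>Z \<nu>\<close> almost surely at each fixed time, which is
  enough for integrals over sets of \<open>F s\<close>.\<close>

lemma martingale_criterion:
  assumes eps: "0 < \<epsilon>"
    and cond: "\<And>u t. 0 \<le> u \<Longrightarrow> u \<le> t \<Longrightarrow> t - u \<le> \<epsilon> \<Longrightarrow>
      (\<integral>\<^sup>+\<omega>. ennreal (exp (\<Sum>i\<in>UNIV. LBINT s:{u..t}. \<mu> i s \<omega> * log_plus (\<mu> i s \<omega>))) \<partial>M) < \<infinity> \<or>
      (\<integral>\<^sup>+\<omega>. ennreal (exp (\<Sum>i\<in>UNIV. ls_integral (\<lambda>s. log_plus (\<mu> i s \<omega>)) (\<lambda>s. N i s \<omega>) u t)) \<partial>M) < \<infinity>"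
    and Z': "is_doleans_dade M F X Z'"
  shows "martingale M F Z'"
proof -
  have E: "(LINT \<omega>|M. Z (after u \<nu>) t \<omega>) = 1" if ut: "0 \<le> u" "u \<le> t" "t - u \<le> \<epsilon>" for u t
  proof (rule Z_expectation_1[OF rate_after[OF rate_\<nu> ut(1)] _ T_stopping])
    show "0 \<le> t" using ut by simp
    show "AE \<omega> in M. \<forall>\<^sub>F k in sequentially. ennreal t < T k \<omega>"
      by (rule AE_mp[OF AE_not_C], intro AE_I2 impI T_unbounded)
    show "\<exists>K. \<forall>i s. \<forall>\<omega>\<in>space M. 0 < s \<longrightarrow> ennreal s \<le> T k \<omega> \<longrightarrow> after u \<nu> i s \<omega> \<le> K" for k
    proof -
      obtain K where K: "\<And>i s \<omega>. \<omega> \<in> space M \<Longrightarrow> 0 < s \<Longrightarrow> ennreal s \<le> T k \<omega> \<Longrightarrow> \<nu> i s \<omega> \<le> K" using \<nu>_bound by blast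
      show ?thesis by (rule exI[of _ "max K 1"]) (auto simp: after_def le_max_iff_disj K)
    qed
    show "integrable M (\<lambda>\<omega>. exp (LBINT s:{0<..t}. \<Sum>i\<in>UNIV. after u \<nu> i s \<omega> * log_plus (after u \<nu> i s \<omega>))) \<or>
      integrable M (\<lambda>\<omega>. exp (\<Sum>i\<in>UNIV. \<Sum>r\<in>J i \<omega> \<inter> {0<..t}. log_plus (after u \<nu> i r \<omega>)))"
      using cond[OF ut] entropy_condition[OF ut(1,2)] jump_condition[OF ut(1,2)] by blast
  qed
  have ad: "Z' t \<in> borel_measurable (F t)" if "0 \<le> t" for t
    using Z' that unfolding is_doleans_dade_def adapted_def by blast
  have eq: "AE \<omega> in M. Z' t \<omega> = Z \<nu> t \<omega>" if "0 \<le> t" for t by (rule doleans_dade_unique[OF Z' that])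
  have mZ': "Z' t \<in> borel_measurable M" if "0 \<le> t" for t by (rule measurable_F_M[OF that ad[OF that]])
  have int: "integrable M (Z' t)" if t: "0 \<le> t" for t
    using integrable_cong_AE[OF mZ'[OF t] Z_measurable[OF rate_\<nu> t] eq[OF t]] Z_expectation_le_1(2)[OF rate_\<nu> t] by blast
  have "AE \<omega> in M. real_cond_exp M (F s) (Z' t) \<omega> = Z' s \<omega>" if st: "0 \<le> s" "s \<le> t" for s t
  proof -
    have t: "0 \<le> t" using st by simp
    interpret Fs: finite_measure_subalgebra M "F s" by unfold_locales (rule subalg[OF st(1)])
    show ?thesis
    proof (rule Fs.real_cond_exp_charact)
      fix A assume A: "A \<in> sets (F s)"
      have AM[measurable]: "A \<in> sets M" by (rule sets_F[OF st(1) A])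
      have nn: "(LINT \<omega>:A|M. Z' r \<omega>) = enn2real (\<integral>\<^sup>+\<omega>. indicator A \<omega> * ennreal (Z \<nu> r \<omega>) \<partial>M)" if r: "0 \<le> r" for r
      proof -
        note [measurable] = mZ'[OF r] Z_measurable[OF rate_\<nu> r]
        have "(LINT \<omega>:A|M. Z' r \<omega>) = (LINT \<omega>|M. indicator A \<omega> * Z \<nu> r \<omega>)"
          unfolding set_lebesgue_integral_def
          by (rule integral_cong_AE) (use eq[OF r] in \<open>auto elim: eventually_mono\<close>)
        also have "\<dots> = enn2real (\<integral>\<^sup>+\<omega>. ennreal (indicator A \<omega> * Z \<nu> r \<omega>) \<partial>M)"
          using Z_nonneg[OF rate_\<nu>] by (intro integral_eq_nn_integral) auto
        also have "(\<integral>\<^sup>+\<omega>. ennreal (indicator A \<omega> * Z \<nu> r \<omega>) \<partial>M) = (\<integral>\<^sup>+\<omega>. indicator A \<omega> * ennreal (Z \<nu> r \<omega>) \<partial>M)"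
          by (rule nn_integral_cong) (auto split: split_indicator)
        finally show ?thesis .
      qed
      show "(LINT \<omega>:A|M. Z' t \<omega>) = (LINT \<omega>:A|M. Z' s \<omega>)"
        unfolding nn[OF t] nn[OF st(1)] by (subst Z_martingale[OF rate_\<nu> eps E st A]) simp_all
    qed (rule int[OF t] int[OF st(1)] ad[OF st(1)])+
  qed
  then show ?thesis unfolding martingale_def adapted_def using ad int by blast
qed

end

theorem corollary2p5:
  fixes M :: "'a measure" and F :: "real \<Rightarrow> 'a measure"
    and N \<mu> :: "'d::finite \<Rightarrow> real \<Rightarrow> 'a \<Rightarrow> real"
  assumes "filtered_prob_space_usual M F"
    and "counting_process M N"
    and "has_intensity M F N (\<lambda>i t \<omega>. 1)"
    and "nonneg_process M \<mu>"
    and "\<And>i. predictable M F (\<mu> i)"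
    and "locally_bounded M F \<mu>"
  shows "compatible M F (\<lambda>i t \<omega>. 1) \<mu> \<and>
    (let X = stoch_integral (\<lambda>i t \<omega>. \<mu> i t \<omega> - 1) (\<lambda>i t \<omega>. N i t \<omega> - t) in
      (\<exists>Z. is_doleans_dade M F X Z) \<and>
      ((\<exists>\<epsilon>>0. \<forall>u t. 0 \<le> u \<longrightarrow> u \<le> t \<longrightarrow> t - u \<le> \<epsilon> \<longrightarrow>
          (\<integral>\<^sup>+\<omega>. ennreal (exp (\<Sum>i\<in>UNIV. LBINT s:{u..t}. \<mu> i s \<omega> * log_plus (\<mu> i s \<omega>))) \<partial>M) < \<infinity> \<or>
          (\<integral>\<^sup>+\<omega>. ennreal (exp (\<Sum>i\<in>UNIV.
             ls_integral (\<lambda>s. log_plus (\<mu> i s \<omega>)) (\<lambda>s. N i s \<omega>) u t)) \<partial>M) < \<infinity>)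
        \<longrightarrow> (\<forall>Z. is_doleans_dade M F X Z \<longrightarrow> martingale M F Z)))"
proof -
  interpret filtered_prob_space_usual M F by fact
  interpret unit_intensity M F N by unfold_locales fact+
  obtain T where T: "localising M F T"
    and K: "\<And>n. \<exists>K. \<forall>i. \<forall>t\<ge>0. \<forall>\<omega>\<in>space M. \<bar>stopped (\<mu> i) (T n) t \<omega>\<bar> \<le> K"
    using assms(6) unfolding locally_bounded_def by blast
  \<comment> \<open>One null set encloses the exceptional sample points for all times
    \<open>t\<close> at once.\<close>
  from localising_eventually[OF T] obtain C where C: "C \<in> null_sets M"
    "{\<omega> \<in> space M. \<not> (\<forall>t. \<forall>\<^sub>F n in sequentially. ennreal t < T n \<omega>)} \<subseteq> C"
    by (auto simp: eventually_ae_filter)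
  interpret intensity_change M F N \<mu> T C
  proof unfold_locales
    show "ext_stopping_time M F (T n)" for n using T unfolding localising_def by blast
    show "\<forall>\<^sub>F n in sequentially. ennreal t < T n \<omega>" if "\<omega> \<in> space M" "\<omega> \<notin> C" for \<omega> t
      using C(2) that by blast
  qed (fact assms C(1) K)+
  have "compatible M F (\<lambda>i t \<omega>. 1) \<mu>"
    using assms(6) by (simp add: compatible_def)
  then show ?thesis
    unfolding Let_def X_def[symmetric]
    using is_doleans_dade_Z martingale_criterion by blast
qed

end
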